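(* Let $n\ge 2$, $1<p<\infty$, $\mu\in\mathcal{A}_p(\mathbb{R}^n)$, let $Q_r\subset\mathbb{R}^n$ be a cube, let $Q_{r/2}$, $Q_{2r}$ be the concentric cubes, and let $K$ be a closed subset of $\overline{Q}_r$. (a) There exists $p_0=p_0(n,p,[\mu]_{\mathcal{A}_p})\in(1,p)$ such that for each $q\in[p_0,p]$ the inequality $$\left(\frac{1}{\mu(Q_r)}\int_{Q_r}\left|\frac{u}{r}\right|^p\mu\,dx\right)^{\frac1p}\le C\left(\frac{1}{\mu(Q_r)}\int_{Q_r}|\nabla u|^q\mu\,dx\right)^{\frac1q}$$ holds for all $u\in C^\infty(\overline{Q}_r)$ with $\operatorname{dist}(\operatorname{supp}u,K)>0$, with a constant $C$ satisfying $$C\le\frac{c_2}{r}\left(\frac{\mu(Q_{2r})}{\mathrm{Cap}_{q,\mu}(K,Q_{2r})}\right)^{\frac1q}$$ for some $c_2=c_2(n,p,[\mu]_{\mathcal{A}_p})$. (b) Let $q\in[p_0,p]$ and suppose that, for some constant $C$, $$\left(\frac{1}{\mu(Q_{r/2})}\int_{Q_{r/2}}\left|\frac{u}{r}\right|^p\mu\,dx\right)^{\frac1p}\le C\left(\frac{1}{\mu(Q_r)}\int_{Q_r}|\nabla u|^q\mu\,dx\right)^{\frac1q}$$ holds for every $u\in C^\infty(\overline{Q}_r)$ with $\operatorname{dist}(\operatorname{supp}u,K)>0$. Then there exists a small $\gamma=\gamma(n,p,[\mu]_{\mathcal{A}_p})\in(0,\frac12)$ such that if $K\in\mathcal{N}_{\mu;\gamma,q}(Q_r)$,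 then $$C\ge\frac{c_3}{r}\left(\frac{\mu(Q_{2r})}{\mathrm{Cap}_{q,\mu}(K,Q_{2r})}\right)^{\frac1q}$$ with a constant $c_3=c_3(n,p,[\mu]_{\mathcal{A}_p})>0$.
   Context: Cubes: $Q_r(x_0)=\{x\in\mathbb{R}^n:|x_i-x_{0,i}|<r\text{ for each }i\}$; the center is omitted when unimportant, and cubes with different radii in the same statement are concentric. A weight is a function $\mu\in L^1_{\rm loc}(\mathbb{R}^n)$ with $\mu>0$ a.e.; $\mu(E)=\int_E\mu\,dx$. For $1<p<\infty$, $\mu\in\mathcal{A}_p(\mathbb{R}^n)$ means $$[\mu]_{\mathcal{A}_p}=\sup_{Q}\left(\frac1{|Q|}\int_{Q}\mu\,dx\right)\left(\frac1{|Q|}\int_{Q}\mu^{-\frac1{p-1}}\,dx\right)^{p-1}<\infty,$$ the supremum over all cubes $Q=Q_s(x_0)\subset\mathbb{R}^n$. Weighted capacity: for an open set $U\subset\mathbb{R}^n$ and $K_0\subset U$ closed, $$\mathrm{Cap}_{q,\mu}(K_0,U)=\inf\left\{\int_U|\nabla\phi|^q\mu\,dx:\phi\in C_0^\infty(U),\ \phi\ge1\text{ on }K_0\right\}.$$ For $\gamma\in(0,\frac12)$ and $q>1$, $\mathcal{N}_{\mu;\gamma,q}(Q_r)$ is the collection of closed subsets $K$ of $\overline{Q}_r$ (the $\mu$-weighted $(\gamma,q)$-negligible subsets) satisfying $$\frac{\mathrm{Cap}_{q,\mu}(K,Q_{2r})}{\mu(Q_{2r})}\le\gamma r^{-q}.$$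 Convention: if $\mathrm{Cap}_{q,\mu}(K,Q_{2r})=0$, the quotient $\mu(Q_{2r})/\mathrm{Cap}_{q,\mu}(K,Q_{2r})$ is read as $+\infty$. The notation $c=c(a,b,\dots)$ means that the constant depends only on the listed quantities. *)

theory Defs
  imports "HOL-Analysis.Analysis"
begin

definition cube :: "real ^ 'n \<Rightarrow> real \<Rightarrow> (real ^ 'n) set" where
  "cube x0 r = {x. \<forall>i. \<bar>x $ i - x0 $ i\<bar> < r}"

(* Only meant for exponents a > 0, where \<infinity> has the power \<infinity> and 0 has the power 0. *)
definition ennreal_rpow :: "ennreal \<Rightarrow> real \<Rightarrow> ennreal" where
  "ennreal_rpow x a = (if x = \<infinity> then \<infinity> else ennreal (enn2real x powr a))"

definition weight :: "(real ^ 'n \<Rightarrow> real) \<Rightarrow> bool" where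
  "weight \<mu> \<longleftrightarrow> (\<forall>S. compact S \<longrightarrow> \<mu> absolutely_integrable_on S) \<and> (AE x in lebesgue. 0 < \<mu> x)"

definition wmeasure :: "(real ^ 'n \<Rightarrow> real) \<Rightarrow> (real ^ 'n) set \<Rightarrow> ennreal" where
  "wmeasure \<mu> E = (\<integral>\<^sup>+x\<in>E. ennreal (\<mu> x) \<partial>lebesgue)"

definition wintegral ::
    "(real ^ 'n \<Rightarrow> real) \<Rightarrow> (real ^ 'n) set \<Rightarrow> (real ^ 'n \<Rightarrow> real) \<Rightarrow> ennreal" where
  "wintegral \<mu> E f = (\<integral>\<^sup>+x\<in>E. ennreal (f x * \<mu> x) \<partial>lebesgue)"

(* The integrals are nonnegative Lebesgue integrals, so a non-integrable dual weight contributes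
   \<infinity> and not 0. *)
definition Ap_const :: "real \<Rightarrow> (real ^ 'n \<Rightarrow> real) \<Rightarrow> ennreal" where
  "Ap_const p \<mu> = (SUP (x0, s) \<in> UNIV \<times> {0<..}.
     ((\<integral>\<^sup>+x\<in>cube x0 s. ennreal (\<mu> x) \<partial>lebesgue) / emeasure lebesgue (cube x0 s)) *
     ennreal_rpow
       ((\<integral>\<^sup>+x\<in>cube x0 s. ennreal (\<mu> x powr (- 1 / (p - 1))) \<partial>lebesgue)
          / emeasure lebesgue (cube x0 s))
       (p - 1))"

definition Ap_class :: "real \<Rightarrow> (real ^ 'n \<Rightarrow> real) set" where
  "Ap_class p = {\<mu>. weight \<mu> \<and> Ap_const p \<mu> < \<infinity>}"

definition partial_deriv :: "'n \<Rightarrow> (real ^ 'n \<Rightarrow> real) \<Rightarrow> real ^ 'n \<Rightarrow> real" where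
  "partial_deriv i f x = frechet_derivative f (at x) (axis i 1)"

definition gradient :: "(real ^ 'n \<Rightarrow> real) \<Rightarrow> real ^ 'n \<Rightarrow> real ^ 'n" where
  "gradient f x = (\<chi> i. partial_deriv i f x)"

(* Meant for open U. *)
primrec Ck_on :: "nat \<Rightarrow> (real ^ 'n) set \<Rightarrow> (real ^ 'n \<Rightarrow> real) \<Rightarrow> bool" where
  "Ck_on 0 U f \<longleftrightarrow> continuous_on U f"
| "Ck_on (Suc k) U f \<longleftrightarrow> f differentiable_on U \<and> (\<forall>i. Ck_on k U (partial_deriv i f))"

definition smooth_on :: "(real ^ 'n) set \<Rightarrow> (real ^ 'n \<Rightarrow> real) \<Rightarrow> bool" where
  "smooth_on U f \<longleftrightarrow> (\<forall>k. Ck_on k U f)"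

(* Smoothness up to the boundary of a closed set S: u is smooth on some open neighbourhood of S. *)
definition smooth_up_to :: "(real ^ 'n) set \<Rightarrow> (real ^ 'n \<Rightarrow> real) \<Rightarrow> bool" where
  "smooth_up_to S u \<longleftrightarrow> (\<exists>U. open U \<and> S \<subseteq> U \<and> smooth_on U u)"

definition supp_in :: "(real ^ 'n) set \<Rightarrow> (real ^ 'n \<Rightarrow> real) \<Rightarrow> (real ^ 'n) set" where
  "supp_in S u = closure {x \<in> S. u x \<noteq> 0}"

(* Elements of C_0^\<infinity>(U), extended by 0 to the whole space. *)
definition test_functions :: "(real ^ 'n) set \<Rightarrow> (real ^ 'n \<Rightarrow> real) set" where
  "test_functions U = {\<phi>. smooth_on UNIV \<phi> \<and> compact (supp_in UNIV \<phi>) \<and> supp_in UNIV \<phi> \<subseteq> U}"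

(* The distance to the empty set is \<infinity>, unlike with the library's setdist, where it is 0. *)
definition set_dist :: "(real ^ 'n) set \<Rightarrow> (real ^ 'n) set \<Rightarrow> ennreal" where
  "set_dist A B = (INF x\<in>A. INF y\<in>B. ennreal (dist x y))"

definition smooth_vanishing_near ::
    "(real ^ 'n) set \<Rightarrow> (real ^ 'n) set \<Rightarrow> (real ^ 'n \<Rightarrow> real) set" where
  "smooth_vanishing_near S K = {u. smooth_up_to S u \<and> 0 < set_dist (supp_in S u) K}"

definition Cap ::
    "real \<Rightarrow> (real ^ 'n \<Rightarrow> real) \<Rightarrow> (real ^ 'n) set \<Rightarrow> (real ^ 'n) set \<Rightarrow> ennreal" where
  "Cap q \<mu> K0 U = (INF \<phi> \<in> {\<phi> \<in> test_functions U. \<forall>x\<in>K0. 1 \<le> \<phi> x}.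
     wintegral \<mu> U (\<lambda>x. norm (gradient \<phi> x) powr q))"

definition negligible_sets ::
    "(real ^ 'n \<Rightarrow> real) \<Rightarrow> real \<Rightarrow> real \<Rightarrow> real ^ 'n \<Rightarrow> real \<Rightarrow> (real ^ 'n) set set" where
  "negligible_sets \<mu> \<gamma> q x0 r = {K. closed K \<and> K \<subseteq> closure (cube x0 r) \<and>
     Cap q \<mu> K (cube x0 (2 * r)) / wmeasure \<mu> (cube x0 (2 * r)) \<le> ennreal (\<gamma> * r powr (- q))}"

(* (\<mu>(Q_2r) / Cap)^(1/q).  Division in ennreal gives \<infinity> when Cap = 0, since \<mu>(Q_2r) > 0. *)
definition cap_quotient ::
    "real \<Rightarrow> (real ^ 'n \<Rightarrow> real) \<Rightarrow> (real ^ 'n) set \<Rightarrow> real ^ 'n \<Rightarrow> real \<Rightarrow> ennreal" where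
  "cap_quotient q \<mu> K x0 r =
     ennreal_rpow (wmeasure \<mu> (cube x0 (2 * r)) / Cap q \<mu> K (cube x0 (2 * r))) (1 / q)"

(* The inequality on Q_s (left) and Q_r (right), both with centre x0; it is used for s = r and
   s = r/2.  The constant may be \<infinity>, in which case the inequality carries no information;
   this is spelled out because \<infinity> * 0 = 0 in ennreal. *)
definition poincare_ineq ::
    "real \<Rightarrow> real \<Rightarrow> (real ^ 'n \<Rightarrow> real) \<Rightarrow> real ^ 'n \<Rightarrow> real \<Rightarrow> real \<Rightarrow> ennreal
      \<Rightarrow> (real ^ 'n \<Rightarrow> real) \<Rightarrow> bool" where
  "poincare_ineq p q \<mu> x0 s r C u \<longleftrightarrow> C = \<infinity> \<or>
     ennreal_rpow
       (wintegral \<mu> (cube x0 s) (\<lambda>x. \<bar>u x / r\<bar> powr p) / wmeasure \<mu> (cube x0 s)) (1 / p)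
     \<le> C * ennreal_rpow
       (wintegral \<mu> (cube x0 r) (\<lambda>x. norm (gradient u x) powr q) / wmeasure \<mu> (cube x0 r)) (1 / q)"

end

theory Submission
  imports Defs "HOL-Probability.Probability"
begin

text \<open>
  Discretising the weight over the \<open>2^n\<close>-adic subcubes of a cube turns the self-improvement
  \<open>A_p \<subseteq> A_q\<close>, for \<open>q\<close> slightly below \<open>p\<close>, into a reverse Hoelder inequality on finite trees,
  which is proved by one induction over a stopping-time decomposition.  It bounds the Lebesgue
  mean of a continuous function by its weighted \<open>L^q\<close> mean; no differentiation theorem is needed.

  Both the Poincare inequality and an extension operator come from averaging over the cubes with
  centre \<open>(1 - s) x + s x0\<close> and radius \<open>s r / 2\<close>.  Integrating over \<open>s\<close> controls \<open>u - a\<close>, where \<open>a\<close>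
  is the mean of \<open>u\<close> on \<open>Q_{r/2}\<close>; letting \<open>s\<close> be comparable to the distance to \<open>Q_r\<close> gives an
  extension \<open>v\<close> of \<open>u\<close> that is equal to \<open>a\<close> far from \<open>Q_r\<close>.  A mollification of \<open>1 - v / a\<close> is
  then admissible for the capacity and bounds \<open>|a|^q Cap(K)\<close> by the energy of \<open>u\<close>.

  For the converse, a smooth truncation of \<open>1 - \<phi>\<close>, with \<open>\<phi>\<close> nearly optimal for the capacity, is
  inserted into the given inequality.  If \<open>K\<close> is negligible, then \<open>\<phi>\<close> is small on most of
  \<open>Q_{r/2}\<close> by the Poincare inequality on \<open>Q_{4r}\<close>, where \<open>\<phi>\<close> vanishes off \<open>Q_{2r}\<close>.
\<close>

section \<open>Smooth functions and mollifiers\<close>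

text \<open>All constants have to be fixed before the weight is known and have to serve a whole
  interval of exponents \<open>q\<close>. Quantitatively, the weight enters only through doubling
  with constant \<open>A\<close> and through the bound \<open>B\<close> of the self-improvement;
  powers of order \<open>q\<close> of constants are enlarged to order \<open>p\<close>.

  Passing from exponent \<open>q\<close> to exponent \<open>p\<close> on a cube of relative size
  \<open>s\<close> costs a factor \<open>s powr (- n * p * (p / q - 1))\<close>, since doubling
  loses up to \<open>s powr (n * p)\<close>. Its integrability over \<open>s\<close> is a second
  restriction on \<open>p0\<close>, besides the range of the reverse Hoelder inequality.

  Overlapping cubes are summed by exchanging integrals: the cubes that contain a given point
  \<open>z\<close> are all comparable with one cube centred at \<open>z\<close>.

  Functions are replaced by bounded continuous ones on the whole space, and their derivatives enter
  through an upper gradient \<open>f\<close>, an inequality along segments. Hence the extension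
  never has to be differentiated; its mollification gets its gradient bound from a local Lipschitz
  estimate.\<close>

definition flat :: "nat \<Rightarrow> real \<Rightarrow> real" where
  "flat m t = (if 0 < t then exp (- 1 / t) / t ^ m else 0)"

lemma flat_nonneg: "0 \<le> flat m t"
  by (simp add: flat_def)

text \<open>Substituting \<open>x = 1 / t\<close> gives the decay of \<open>x ^ m / exp x\<close> at
  infinity.\<close>

lemma flat_div_tendsto_0: "((\<lambda>t. exp (- 1 / t) / t ^ m) \<longlongrightarrow> 0) (at_right (0::real))"
proof -
  have "((\<lambda>x::real. x ^ m / exp x) \<longlongrightarrow> 0) at_top"
    by (rule tendsto_power_div_exp_0)
  then have "((\<lambda>t::real. inverse t ^ m / exp (inverse t)) \<longlongrightarrow> 0) (at_right 0)"
    by (rule filterlim_compose[OF _ filterlim_inverse_at_top_right])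
  then show ?thesis
    by (rule tendsto_cong[THEN iffD1, rotated])
      (auto simp: eventually_at_right_field exp_minus field_simps intro!: exI[of _ 1])
qed

lemma flat_has_real_derivative:
  "(flat m has_real_derivative (flat (m + 2) t - real m * flat (m + 1) t)) (at t)"
proof -
  consider "0 < t" | "t < 0" | "t = 0" by linarith
  then show ?thesis
  proof cases
    case 1
    have "((\<lambda>t. exp (- 1 / t) / t ^ m) has_real_derivative
        (exp (- 1 / t) * (1 / t\<^sup>2) * t ^ m - exp (- 1 / t) * (real m * t ^ (m - 1))) / (t ^ m * t ^ m)) (at t)"
      using 1 by (auto intro!: derivative_eq_intros simp: power2_eq_square)
    moreover have "(exp (- 1 / t) * (1 / t\<^sup>2) * t ^ m - exp (- 1 / t) * (real m * t ^ (m - 1))) / (t ^ m * t ^ m)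
        = flat (m + 2) t - real m * flat (m + 1) t"
      using 1 by (cases m) (simp_all add: flat_def field_simps power2_eq_square)
    ultimately have "((\<lambda>t. exp (- 1 / t) / t ^ m) has_real_derivative
        (flat (m + 2) t - real m * flat (m + 1) t)) (at t)"
      by simp
    moreover have "\<forall>\<^sub>F x in nhds t. exp (- 1 / x) / x ^ m = flat m x"
      using eventually_nhds_in_open[of "{0<..}" t] 1 by (auto elim!: eventually_mono simp: flat_def)
    ultimately show ?thesis
      by (subst (asm) DERIV_cong_ev[OF refl _ refl]) auto
  next
    case 2
    have "((\<lambda>t. 0) has_real_derivative (flat (m + 2) t - real m * flat (m + 1) t)) (at t)"
      using 2 by (simp add: flat_def)
    moreover have "\<forall>\<^sub>F x in nhds t. 0 = flat m x"
      using eventually_nhds_in_open[of "{..<0}" t] 2 by (auto elim!: eventually_mono simp: flat_def)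
    ultimately show ?thesis
      by (subst (asm) DERIV_cong_ev[OF refl _ refl]) auto
  next
    case 3
    \<comment> \<open>At 0 the difference quotient is again a member of the family: it equals
      \<open>flat (m + 1)\<close> on the right and 0 on the left.\<close>
    have "((\<lambda>y. flat m y / y) \<longlongrightarrow> 0) (at_right 0)"
      by (rule tendsto_cong[THEN iffD1, OF _ flat_div_tendsto_0[of "m + 1"]])
        (auto simp: eventually_at_right_field flat_def field_simps intro!: exI[of _ 1])
    moreover have "((\<lambda>y. flat m y / y) \<longlongrightarrow> 0) (at_left 0)"
      by (rule tendsto_cong[THEN iffD1, OF _ tendsto_const[of 0]])
        (auto simp: eventually_at_left_field flat_def field_simps intro!: exI[of _ "-1"])
    ultimately have "((\<lambda>y. flat m y / y) \<longlongrightarrow> 0) (at 0)"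
      by (simp add: filterlim_split_at)
    then show ?thesis using 3 by (simp add: has_field_derivative_iff flat_def)
  qed
qed

text \<open>\<open>flat 2\<close> is the derivative of \<open>flat 0\<close>, so composing with
  \<open>flat 0\<close> does not increase gradients. With \<open>x = 1 / t\<close> the bound reads
  \<open>x\<^sup>2 \<le> exp x\<close>, the square of \<open>x \<le> exp (x / 2)\<close>.\<close>

lemma flat_2_le_1: "\<bar>flat 2 t\<bar> \<le> 1"
proof (cases "0 < t")
  case True
  define x where "x = 1 / t"
  have x: "0 < x" using True by (simp add: x_def)
  have "x\<^sup>2 \<le> exp x"
  proof -
    have "(1 + x / 2 + (x/2)\<^sup>2 / 2) \<le> exp (x/2)"
      using exp_lower_Taylor_quadratic[of "x/2"] x by simp
    moreover have "x \<le> 1 + x / 2 + (x/2)\<^sup>2 / 2"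
      using sum_squares_bound[of "x/2-1" "x/2-1"] zero_le_power2[of "x - 2"]
      by (simp add: power2_eq_square field_simps)
    ultimately have "x \<le> exp (x/2)" by simp
    then have "x\<^sup>2 \<le> (exp (x/2))\<^sup>2" using x by (intro power_mono) auto
    then show ?thesis by (simp add: exp_double[symmetric])
  qed
  then show ?thesis using True
    by (simp add: flat_def x_def exp_minus field_simps power2_eq_square)
qed (simp add: flat_def)

section \<open>Gradients and closure properties of smooth functions\<close>

lemma has_derivative_imp_partial_deriv:
  assumes "(f has_derivative D) (at x)"
  shows "partial_deriv i f x = D (axis i 1)"
  using frechet_derivative_at[OF assms] by (simp add: partial_deriv_def)

lemma has_derivative_gradient:
  fixes f :: "real ^ 'n \<Rightarrow> real"
  assumes "f differentiable (at x)"
  shows "(f has_derivative (\<lambda>h. gradient f x \<bullet> h)) (at x)"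
proof -
  let ?D = "frechet_derivative f (at x)"
  have D: "(f has_derivative ?D) (at x)" using assms frechet_derivative_works by blast
  then have lin: "linear ?D" by (simp add: has_derivative_linear)
  have "?D h = gradient f x \<bullet> h" for h
  proof -
    have "?D h = ?D (\<Sum>i\<in>UNIV. h $ i *\<^sub>R axis i 1)"
      by (subst basis_expansion[of h, symmetric]) (simp add: scalar_mult_eq_scaleR)
    also have "\<dots> = (\<Sum>i\<in>UNIV. h $ i * ?D (axis i 1))"
      by (simp add: linear_sum[OF lin] linear_scale[OF lin])
    also have "\<dots> = gradient f x \<bullet> h"
      by (simp add: inner_vec_def gradient_def partial_deriv_def mult.commute)
    finally show ?thesis .
  qed
  then have "?D = (\<lambda>h. gradient f x \<bullet> h)" by auto
  with D show ?thesis by simp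
qed

lemma gradient_eqI:
  assumes "(f has_derivative (\<lambda>h. g \<bullet> h)) (at x)" shows "gradient f x = g"
  by (simp add: gradient_def vec_eq_iff has_derivative_imp_partial_deriv[OF assms] inner_axis)

lemma smooth_on_differentiable:
  assumes "smooth_on UNIV f" shows "f differentiable (at x)"
  using assms[unfolded smooth_on_def, rule_format, of 1]
  by (auto simp: differentiable_on_def)

lemma smooth_on_partial_deriv:
  assumes "smooth_on U f" shows "smooth_on U (partial_deriv i f)"
  unfolding smooth_on_def
proof
  fix k show "Ck_on k U (partial_deriv i f)"
    using assms[unfolded smooth_on_def, rule_format, of "Suc k"] by simp
qed

lemma smooth_on_continuous:
  assumes "smooth_on U f" shows "continuous_on U f"
  using assms[unfolded smooth_on_def, rule_format, of 0] by simp

lemma continuous_on_gradient: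
  assumes "smooth_on U f" shows "continuous_on U (gradient f)"
  unfolding gradient_def
  by (intro continuous_on_vec_lambda smooth_on_continuous smooth_on_partial_deriv assms)

text \<open>A coinduction principle: since \<open>Ck_on\<close> peels off one derivative at a time,
  an invariant class \<open>P\<close> replaces an induction on the order. Constants, coordinates,
  \<open>smooth_closure\<close> and convolutions each supply their own \<open>P\<close>.\<close>

lemma smooth_onI_partial:
  assumes "\<And>f. P f \<Longrightarrow> f differentiable_on UNIV"
    and "\<And>f i. P f \<Longrightarrow> P (partial_deriv i f)" and "P f"
  shows "smooth_on UNIV f"
  unfolding smooth_on_def
proof
  fix k show "Ck_on k UNIV f"
    using assms(3)
  proof (induction k arbitrary: f)
    case 0 then show ?case using assms(1) differentiable_imp_continuous_on by auto
  next
    case (Suc k) then show ?case using assms(1,2) by auto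
  qed
qed

text \<open>The class is closed under partial derivatives because the derivative of \<open>flat m\<close> is a
  combination of \<open>flat (m + 1)\<close> and \<open>flat (m + 2)\<close>.\<close>

inductive_set smooth_closure :: "(real ^ 'n \<Rightarrow> real) set" where
  base: "smooth_on UNIV f \<Longrightarrow> f \<in> smooth_closure"
| flat: "smooth_on UNIV f \<Longrightarrow> (\<lambda>x. flat m (f x)) \<in> smooth_closure"
| add: "f \<in> smooth_closure \<Longrightarrow> g \<in> smooth_closure \<Longrightarrow> (\<lambda>x. f x + g x) \<in> smooth_closure"
| mult: "f \<in> smooth_closure \<Longrightarrow> g \<in> smooth_closure \<Longrightarrow> (\<lambda>x. f x * g x) \<in> smooth_closure"

lemma smooth_on_const: "smooth_on UNIV (\<lambda>x::real^'n. c)"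
proof (rule smooth_onI_partial[where P="\<lambda>f. \<exists>c. f = (\<lambda>x. c)"])
  fix f :: "real^'n \<Rightarrow> real" and i assume "\<exists>c. f = (\<lambda>x. c)"
  then have "partial_deriv i f = (\<lambda>x. 0)"
    by (auto simp: has_derivative_imp_partial_deriv[OF has_derivative_const])
  then show "\<exists>c. partial_deriv i f = (\<lambda>x. c)" by blast
qed auto

lemma smooth_closure_step:
  assumes "f \<in> smooth_closure"
  shows "(\<forall>x. f differentiable (at x)) \<and> (\<forall>i. partial_deriv i f \<in> smooth_closure)"
  using assms
proof induction
  case (base f)
  then show ?case
    by (auto intro: smooth_on_differentiable smooth_closure.base smooth_on_partial_deriv)
next
  case (flat f m)
  have d: "((\<lambda>x. flat m (f x)) has_derivative
      (\<lambda>h. (flat (m + 2) (f x) - real m * flat (m + 1) (f x)) * (gradient f x \<bullet> h))) (at x)" for x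
    using has_derivative_compose[OF has_derivative_gradient[OF smooth_on_differentiable[OF flat]]
        flat_has_real_derivative[of m "f x", unfolded has_field_derivative_def]]
    by simp
  have "partial_deriv i (\<lambda>x. flat m (f x)) =
      (\<lambda>x. (flat (m + 2) (f x) + (- real m) * flat (m + 1) (f x)) * partial_deriv i f x)" for i
    by (rule ext) (simp add: has_derivative_imp_partial_deriv[OF d] gradient_def inner_axis)
  moreover have "(\<lambda>x. (flat (m + 2) (f x) + (- real m) * flat (m + 1) (f x)) * partial_deriv i f x)
      \<in> smooth_closure" for i
    using flat by (intro smooth_closure.add smooth_closure.mult smooth_closure.flat
      smooth_closure.base[OF smooth_on_const] smooth_closure.base[OF smooth_on_partial_deriv])
  ultimately show ?case using d by (auto simp: differentiable_def)
next
  case (add f g)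
  have d: "((\<lambda>x. f x + g x) has_derivative (\<lambda>h. gradient f x \<bullet> h + gradient g x \<bullet> h)) (at x)" for x
    by (intro has_derivative_add has_derivative_gradient) (use add in auto)
  have "partial_deriv i (\<lambda>x. f x + g x) = (\<lambda>x. partial_deriv i f x + partial_deriv i g x)" for i
    by (rule ext) (simp add: has_derivative_imp_partial_deriv[OF d] gradient_def inner_axis)
  then show ?case using d add by (auto simp: differentiable_def intro!: smooth_closure.add)
next
  case (mult f g)
  have d: "((\<lambda>x. f x * g x) has_derivative (\<lambda>h. f x * (gradient g x \<bullet> h) + (gradient f x \<bullet> h) * g x)) (at x)" for x
    by (intro has_derivative_mult has_derivative_gradient) (use mult in auto)
  have "partial_deriv i (\<lambda>x. f x * g x) = (\<lambda>x. f x * partial_deriv i g x + partial_deriv i f x * g x)" for i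
    by (rule ext) (simp add: has_derivative_imp_partial_deriv[OF d] gradient_def inner_axis)
  then show ?case using d mult by (auto simp: differentiable_def intro!: smooth_closure.add smooth_closure.mult)
qed

lemma smooth_on_closure: "f \<in> smooth_closure \<Longrightarrow> smooth_on UNIV f"
  by (rule smooth_onI_partial[where P="\<lambda>f. f \<in> smooth_closure"])
    (auto simp: differentiable_on_def dest: smooth_closure_step)

lemma smooth_on_coord: "smooth_on UNIV (\<lambda>x::real^'n. x $ i)"
proof -
  have d: "((\<lambda>x::real^'n. x $ i) has_derivative (\<lambda>h. h $ i)) (at x)" for x
    by (auto intro!: derivative_eq_intros bounded_linear_imp_has_derivative bounded_linear_vec_nth)
  show ?thesis
  proof (rule smooth_onI_partial[where P="\<lambda>f. f = (\<lambda>x. x $ i) \<or> (\<exists>c. f = (\<lambda>x. c))"])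
    fix f :: "real^'n \<Rightarrow> real" and j assume "f = (\<lambda>x. x $ i) \<or> (\<exists>c. f = (\<lambda>x. c))"
    then show "f differentiable_on UNIV"
      using d by (auto simp: differentiable_on_def differentiable_def intro: has_derivative_const)
  next
    fix f :: "real^'n \<Rightarrow> real" and j assume f: "f = (\<lambda>x. x $ i) \<or> (\<exists>c. f = (\<lambda>x. c))"
    have "partial_deriv j (\<lambda>x::real^'n. x $ i) = (\<lambda>x. axis j 1 $ i)"
      by (rule ext) (simp add: has_derivative_imp_partial_deriv[OF d])
    moreover have "partial_deriv j (\<lambda>x::real^'n. c) = (\<lambda>x. 0)" for c
      by (rule ext) (simp add: has_derivative_imp_partial_deriv[OF has_derivative_const])
    ultimately show "partial_deriv j f = (\<lambda>x. x $ i) \<or> (\<exists>c. partial_deriv j f = (\<lambda>x. c))" using f by auto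
  qed auto
qed

lemma smooth_on_sum:
  assumes "finite I" "\<And>i. i \<in> I \<Longrightarrow> smooth_on UNIV (f i)"
  shows "smooth_on UNIV (\<lambda>x. \<Sum>i\<in>I. f i x)"
  using assms
proof (induction I)
  case (insert x F)
  then have "(\<lambda>y. f x y + (\<Sum>i\<in>F. f i y)) \<in> smooth_closure"
    by (intro smooth_closure.add) (auto intro: smooth_closure.base)
  with insert show ?case by (simp add: smooth_on_closure)
qed (simp add: smooth_on_const)

text \<open>The function is \<open>flat 0\<close> of the polynomial
  \<open>e\<^sup>2 - x \<bullet> x\<close>, divided by its integral. Evenness lets a convolution be
  written as an average of the translates \<open>v (x + h)\<close>.\<close>

lemma smooth_bump:
  fixes e :: real
  assumes "0 < e"
  obtains g :: "real ^ 'n \<Rightarrow> real" where "smooth_on UNIV g" "\<And>x. 0 \<le> g x"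
    "\<And>x. e \<le> norm x \<Longrightarrow> g x = 0" "\<And>x. g (- x) = g x" "integrable lborel g"
    "(\<integral>x. g x \<partial>lborel) = 1"
proof -
  define h :: "real ^ 'n \<Rightarrow> real" where "h x = flat 0 (e\<^sup>2 - x \<bullet> x)" for x
  have "smooth_on UNIV (\<lambda>x::real^'n. e\<^sup>2 + (\<Sum>i\<in>UNIV. (-1) * (x $ i * x $ i)))"
    by (intro smooth_on_closure smooth_closure.add smooth_closure.base[OF smooth_on_const]
        smooth_closure.base[OF smooth_on_sum] smooth_closure.mult smooth_closure.base[OF smooth_on_coord]) auto
  then have sq: "smooth_on UNIV (\<lambda>x::real^'n. e\<^sup>2 - x \<bullet> x)"
    by (simp add: inner_vec_def sum_negf)
  have h: "smooth_on UNIV h" unfolding h_def using smooth_on_closure[OF smooth_closure.flat[OF sq]] .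
  have pos: "0 < h x \<longleftrightarrow> norm x < e" for x
  proof -
    have "norm x < e \<longleftrightarrow> norm x ^ 2 < e ^ 2" using assms by (auto intro: power_strict_mono power2_less_imp_less)
    then show ?thesis by (simp add: h_def flat_def dot_square_norm)
  qed
  have nn: "0 \<le> h x" for x by (simp add: h_def flat_nonneg)
  have zero: "h x = 0" if "e \<le> norm x" for x using pos[of x] nn[of x] that by linarith
  have cont: "continuous_on UNIV h" using h by (rule smooth_on_continuous)
  have le1: "h x \<le> 1" for x by (auto simp: h_def flat_def)
  have int: "integrable lborel h"
  proof (rule Bochner_Integration.integrable_bound)
    show "integrable lborel (\<lambda>x. indicator (cball 0 e) x :: real)"
      by (intro integrable_real_indicator) (use emeasure_bounded_finite[OF bounded_cball, of 0 e] in auto)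
    show "AE x in lborel. norm (h x) \<le> norm (indicator (cball 0 e) x :: real)"
      using zero le1 nn by (auto simp: indicator_def)
    show "h \<in> borel_measurable lborel" using cont by (simp add: borel_measurable_continuous_onI)
  qed
  define c where "c = (\<integral>x. h x \<partial>lborel)"
  have c: "0 < c"
  proof -
    have "c \<noteq> 0"
    proof
      assume "c = 0"
      then have "AE x in lborel. h x = 0"
        unfolding c_def using integral_nonneg_eq_0_iff_AE[OF int] nn by auto
      then have "AE x in lborel. x \<notin> ball (0::real^'n) e"
        by (rule eventually_mono) (use pos in \<open>auto simp: less_le\<close>)
      then have "emeasure lborel (ball (0::real^'n) e) = 0"
        using AE_iff_null_sets[of "ball (0::real^'n) e" lborel] by auto
      then show False using assms content_ball_pos[of e "0::real^'n"] by (simp add: measure_def)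
    qed
    moreover have "0 \<le> c" unfolding c_def using nn by (intro integral_nonneg_AE) auto
    ultimately show ?thesis by simp
  qed
  show thesis
  proof (rule that[of "\<lambda>x. 1 / c * h x"])
    show "smooth_on UNIV (\<lambda>x. 1 / c * h x)"
      by (intro smooth_on_closure smooth_closure.mult smooth_closure.base[OF smooth_on_const] smooth_closure.base[OF h])
    show "integrable lborel (\<lambda>x. 1 / c * h x)" using int by simp
    show "(\<integral>x. 1 / c * h x \<partial>lborel) = 1" using c by (simp flip: c_def)
  qed (use nn c zero in \<open>auto simp: h_def\<close>)
qed

text \<open>Every derivative falls on \<open>g\<close>, so convolutions of \<open>v\<close> with
  smooth kernels form a class closed under partial derivatives; continuity of \<open>v\<close> on
  the box is enough to differentiate under the integral.\<close>

lemma smooth_on_convolution: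
  fixes v g :: "real ^ 'n \<Rightarrow> real"
  assumes v: "continuous_on (cbox a b) v" and g: "smooth_on UNIV g"
  shows "smooth_on UNIV (\<lambda>x. integral (cbox a b) (\<lambda>y. v y * g (x - y)))"
proof -
  define F where "F g = (\<lambda>x. integral (cbox a b) (\<lambda>y. v y * g (x - y)))" for g :: "real ^ 'n \<Rightarrow> real"
  have d: "(F g has_derivative (\<lambda>h. integral (cbox a b) (\<lambda>y. v y * (gradient g (x - y) \<bullet> h)))) (at x)"
    if g: "smooth_on UNIV g" for g x
  proof -
    \<comment> \<open>The Leibniz rule takes the derivative as a bounded linear map depending
      continuously on \<open>(x, y)\<close>.\<close>
    define D where "D x y = v y *\<^sub>R blinfun_inner_right (gradient g (x - y))" for x y
    have gc: "continuous_on UNIV g" "continuous_on UNIV (gradient g)"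
      using g by (auto intro: smooth_on_continuous continuous_on_gradient)
    have Dc: "continuous_on (UNIV \<times> cbox a b) (\<lambda>(x, y). D x y)"
      unfolding D_def split_beta
      by (intro continuous_intros continuous_on_compose2[OF v]
          continuous_on_compose2[OF gc(2)] bounded_linear.continuous_on[OF bounded_linear_blinfun_inner_right]) auto
    have "(F g has_derivative blinfun_apply (integral (cbox a b) (D x))) (at x within UNIV)"
      unfolding F_def
    proof (rule leibniz_rule)
      fix x t
      have "((\<lambda>x. g (x - t)) has_derivative (\<lambda>h. gradient g (x - t) \<bullet> h)) (at x)"
        by (rule has_derivative_compose[OF _ has_derivative_gradient[OF smooth_on_differentiable[OF g]], of "\<lambda>x. x - t" "\<lambda>h. h", simplified])
          (auto intro!: derivative_eq_intros)
      then have "((\<lambda>x. v t * g (x - t)) has_derivative (\<lambda>h. v t * (gradient g (x - t) \<bullet> h))) (at x)"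
        by (rule has_derivative_mult_right)
      then show "((\<lambda>x. v t * g (x - t)) has_derivative blinfun_apply (D x t)) (at x within UNIV)"
        by (rule has_derivative_eq_rhs) (simp add: D_def blinfun.scaleR_left fun_eq_iff)
      show "(\<lambda>y. v y * g (x - y)) integrable_on cbox a b"
        by (intro integrable_continuous continuous_intros v continuous_on_compose2[OF gc(1)]) auto
    qed (use Dc in auto)
    moreover have "blinfun_apply (integral (cbox a b) (D x)) h = integral (cbox a b) (\<lambda>y. v y * (gradient g (x - y) \<bullet> h))" for h
    proof -
      have "D x integrable_on cbox a b"
        unfolding D_def
        by (intro integrable_continuous continuous_intros v continuous_on_compose2[OF gc(2)]
            bounded_linear.continuous_on[OF bounded_linear_blinfun_inner_right]) auto
      then show ?thesis
        by (simp add: blinfun_apply_integral D_def blinfun.scaleR_left)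
    qed
    ultimately show ?thesis by (simp add: fun_eq_iff has_derivative_eq_rhs)
  qed
  have p: "partial_deriv i (F g) = F (partial_deriv i g)" if "smooth_on UNIV g" for g i
    by (rule ext, subst has_derivative_imp_partial_deriv[OF d[OF that]]) (simp add: F_def gradient_def inner_axis)
  have "smooth_on UNIV (F g)"
  proof (rule smooth_onI_partial[where P="\<lambda>f. \<exists>g. smooth_on UNIV g \<and> f = F g"])
    fix f assume "\<exists>g. smooth_on UNIV g \<and> f = F g"
    then obtain g where g: "smooth_on UNIV g" and f: "f = F g" by blast
    show "f differentiable_on UNIV"
      unfolding f differentiable_on_def differentiable_def using d[OF g] by auto
    show "\<exists>g. smooth_on UNIV g \<and> partial_deriv i f = F g" for i
      unfolding f p[OF g] using smooth_on_partial_deriv[OF g] by blast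
  qed (use g in blast)
  then show ?thesis by (simp add: F_def)
qed

text \<open>The directional derivative along the normalised gradient equals the norm of the
  gradient. This allows gradient bounds for mollified functions without computing the
  gradient.\<close>

lemma norm_gradient_le_Lipschitz:
  fixes f :: "real ^ 'n \<Rightarrow> real"
  assumes d: "f differentiable (at x)" and e: "0 < e" and L: "0 \<le> L"
    and lip: "\<And>y. norm (y - x) < e \<Longrightarrow> \<bar>f y - f x\<bar> \<le> L * norm (y - x)"
  shows "norm (gradient f x) \<le> L"
proof (cases "gradient f x = 0")
  case False
  let ?g = "gradient f x"
  define w where "w = (1 / norm ?g) *\<^sub>R ?g"
  have nw: "norm w = 1" using False by (simp add: w_def)
  have gw: "?g \<bullet> w = norm ?g" using False by (simp add: w_def dot_square_norm power2_eq_square)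
  have "((\<lambda>t. f (x + t *\<^sub>R w)) has_real_derivative (norm ?g)) (at 0)"
  proof -
    have "((\<lambda>t. f (x + t *\<^sub>R w)) has_derivative (\<lambda>t. ?g \<bullet> (t *\<^sub>R w))) (at 0)"
      by (rule has_derivative_compose[of "\<lambda>t. x + t *\<^sub>R w" "\<lambda>t. t *\<^sub>R w" 0 UNIV f, simplified])
        (auto intro!: derivative_eq_intros has_derivative_gradient d)
    then show ?thesis by (simp add: has_field_derivative_def gw mult.commute[of _ "norm ?g"])
  qed
  then have lim: "((\<lambda>t. (f (x + t *\<^sub>R w) - f x) / t) \<longlongrightarrow> norm ?g) (at_right 0)"
    by (auto simp: has_field_derivative_iff intro: tendsto_mono[OF at_le])
  show ?thesis
  proof (rule tendsto_upperbound[OF lim])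
    show "\<forall>\<^sub>F t in at_right 0. (f (x + t *\<^sub>R w) - f x) / t \<le> L"
      unfolding eventually_at_right_field
    proof (intro exI[of _ e] conjI allI impI)
      fix t assume t: "0 < t" "t < e"
      have "\<bar>f (x + t *\<^sub>R w) - f x\<bar> \<le> L * t" using lip[of "x + t *\<^sub>R w"] t nw by simp
      then show "(f (x + t *\<^sub>R w) - f x) / t \<le> L" using t by (simp add: divide_le_eq)
    qed (rule e)
  qed auto
qed (use L in simp)

section \<open>Reverse Hoelder inequality on finite trees\<close>

definition mean :: "('b::finite \<Rightarrow> real) \<Rightarrow> real" where
  "mean h = (\<Sum>b\<in>UNIV. h b) / real CARD('b)"

lemma mean_add: "mean (\<lambda>b. f b + g b) = mean f + mean g"
  by (simp add: mean_def sum.distrib add_divide_distrib)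

lemma mean_diff: "mean (\<lambda>b. f b - g b) = mean f - mean g"
  by (simp add: mean_def sum_subtractf diff_divide_distrib)

lemma mean_cmult: "mean (\<lambda>b. c * f b) = c * mean f"
  by (simp add: mean_def sum_distrib_left)

lemma mean_const: "mean (\<lambda>b::'b::finite. c) = c"
  by (simp add: mean_def)

lemma mean_mono: "(\<And>b. f b \<le> g b) \<Longrightarrow> mean f \<le> mean g"
  by (simp add: mean_def divide_right_mono sum_mono)

lemma mean_nonneg: "(\<And>b. 0 \<le> f b) \<Longrightarrow> 0 \<le> mean f"
  by (simp add: mean_def sum_nonneg)

lemma mean_pos:
  assumes "\<And>b::'b::finite. 0 < f b" shows "0 < mean f"
  using assms by (simp add: mean_def sum_pos)

lemma le_card_mean:
  fixes f :: "'b::finite \<Rightarrow> real"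
  assumes "\<And>b. 0 \<le> f b"
  shows "f b \<le> real CARD('b) * mean f"
  using assms by (simp add: mean_def member_le_sum)

lemma mean_eq_0:
  fixes f :: "'b::finite \<Rightarrow> real"
  assumes "\<And>b. 0 \<le> f b" "mean f = 0" shows "f b = 0"
  using le_card_mean[of f b] assms by (simp add: order_antisym)

lemma powr_le_iff_root:
  fixes x y q :: real
  assumes "0 \<le> x" "0 \<le> y" "0 < q"
  shows "x powr q \<le> y \<longleftrightarrow> x \<le> y powr (1/q)"
proof -
  have "x powr q \<le> y \<longleftrightarrow> x powr q \<le> (y powr (1/q)) powr q"
    using assms by (simp add: powr_powr)
  also have "\<dots> \<longleftrightarrow> x \<le> y powr (1/q)"
    using assms by (metis powr_ge_zero powr_mono2 powr_less_mono2 linorder_not_le order_less_imp_le)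
  finally show ?thesis .
qed

text \<open>Young's inequality normalised at reference values \<open>Fm\<close> and
  \<open>Sm\<close>. When these are the means of \<open>F\<close> and \<open>S\<close>, the bracket
  averages to 1, which gives Hoelder's inequality with constant 1.\<close>

lemma young_product:
  fixes F S q Fm Sm :: real
  assumes "1 < q" "0 \<le> F" "0 \<le> S" "0 < Fm" "0 < Sm"
  shows "(F * S powr (q - 1)) powr (1/q) \<le>
    (Fm * Sm powr (q - 1)) powr (1/q) * (F / Fm / q + (1 - 1/q) * (S / Sm))"
proof -
  have "(F / Fm) powr (1/q) * (S / Sm) powr (1 - 1/q) \<le> (1/q) * (F/Fm) + (1 - 1/q) * (S/Sm)"
  proof (cases "F = 0 \<or> S = 0")
    case False
    then show ?thesis using assms by (intro Youngs_inequality_0) auto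
  qed (use assms in auto)
  moreover have "(F * S powr (q - 1)) powr (1/q) =
     (Fm * Sm powr (q - 1)) powr (1/q) * ((F / Fm) powr (1/q) * (S / Sm) powr (1 - 1/q))"
  proof -
    have e: "(q - 1) / q = 1 - 1/q" using assms by (simp add: diff_divide_distrib)
    show ?thesis using assms by (simp add: powr_mult powr_powr powr_divide e)
  qed
  ultimately show ?thesis
    using mult_left_mono[of "(F / Fm) powr (1/q) * (S / Sm) powr (1 - 1/q)"
        "F / Fm / q + (1 - 1/q) * (S / Sm)" "(Fm * Sm powr (q - 1)) powr (1/q)"]
    by (simp add: mult.commute)
qed

text \<open>Hoelder's inequality in the form that an induction over trees needs: an estimate valid
  at every child passes unchanged to the parent.\<close>

lemma mean_Holder:
  fixes x F S :: "'b::finite \<Rightarrow> real"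
  assumes q: "1 < q" and nn: "\<And>b. 0 \<le> x b" "\<And>b. 0 \<le> F b" "\<And>b. 0 \<le> S b"
    and le: "\<And>b. x b powr q \<le> F b * S b powr (q - 1)"
  shows "mean x powr q \<le> mean F * mean S powr (q - 1)"
proof (cases "mean F = 0 \<or> mean S = 0")
  \<comment> \<open>The normalisation by the means is impossible here, but a vanishing mean of
    nonnegative values makes every \<open>x b\<close> vanish.\<close>
  case True
  then have "F b * S b powr (q - 1) = 0" for b
    using mean_eq_0[of F b] mean_eq_0[of S b] nn by auto
  then have "x b = 0" for b
    using le[of b] nn(1)[of b] by (smt (verit) powr_gt_zero)
  then have "mean x = 0" by (simp add: mean_def)
  then show ?thesis using nn by (simp add: mean_nonneg)
next
  case False
  then have p: "0 < mean F" "0 < mean S" using mean_nonneg[of F] mean_nonneg[of S] nn by force+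
  define K where "K = (mean F * mean S powr (q - 1)) powr (1/q)"
  have "x b \<le> K * (F b / mean F / q + (1 - 1/q) * (S b / mean S))" for b
  proof -
    have "x b \<le> (F b * S b powr (q - 1)) powr (1/q)"
      using le[of b] nn q by (subst powr_le_iff_root[symmetric]) auto
    also have "\<dots> \<le> K * (F b / mean F / q + (1 - 1/q) * (S b / mean S))"
      unfolding K_def using q nn p by (intro young_product) auto
    finally show ?thesis .
  qed
  then have "mean x \<le> mean (\<lambda>b. K * ((1 / mean F / q) * F b + ((1 - 1/q) / mean S) * S b))"
    by (intro mean_mono) (simp add: field_simps)
  also have "\<dots> = K * ((1 / mean F / q) * mean F + ((1 - 1/q) / mean S) * mean S)"
    by (simp only: mean_cmult mean_add)
  also have "\<dots> = K" using p q by (simp add: field_simps)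
  finally show ?thesis
    unfolding K_def using nn q p by (subst powr_le_iff_root) (auto intro: mean_nonneg)
qed

text \<open>The branching type is an arbitrary finite type. It is instantiated with
  \<open>'n set\<close>, one child for each of the \<open>2^n\<close> half-size subcubes, so
  \<open>CARD('b)\<close> acts as the Lebesgue doubling constant.\<close>

datatype 'b tree = Leaf real | Node "'b \<Rightarrow> 'b tree"

primrec tmean :: "(real \<Rightarrow> real) \<Rightarrow> 'b::finite tree \<Rightarrow> real" where
  "tmean h (Leaf x) = h x"
| "tmean h (Node c) = mean (\<lambda>b. tmean h (c b))"

text \<open>The leaf values are averages of a weight over equal cells; the dual weight is
  discretised as a function of these averages.\<close>

primrec tree_Ap :: "real \<Rightarrow> real \<Rightarrow> 'b::finite tree \<Rightarrow> bool" where
  "tree_Ap p A (Leaf x) \<longleftrightarrow> 0 < x"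
| "tree_Ap p A (Node c) \<longleftrightarrow> (\<forall>b. tree_Ap p A (c b)) \<and>
     tmean (\<lambda>x. x) (Node c) * tmean (\<lambda>x. x powr (- 1 / (p - 1))) (Node c) powr (p - 1) \<le> A"

text \<open>The proportion of the tree, and the amount of its \<open>s\<close>-mass, lying in the
  maximal subtrees on which the mean of \<open>s\<close> exceeds \<open>l\<close>.\<close>

primrec stop_frac :: "(real \<Rightarrow> real) \<Rightarrow> real \<Rightarrow> 'b::finite tree \<Rightarrow> real" where
  "stop_frac s l (Leaf x) = (if l < s x then 1 else 0)"
| "stop_frac s l (Node c) =
     (if l < tmean s (Node c) then 1 else mean (\<lambda>b. stop_frac s l (c b)))"

primrec stop_mass :: "(real \<Rightarrow> real) \<Rightarrow> real \<Rightarrow> 'b::finite tree \<Rightarrow> real" where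
  "stop_mass s l (Leaf x) = (if l < s x then s x else 0)"
| "stop_mass s l (Node c) =
     (if l < tmean s (Node c) then tmean s (Node c) else mean (\<lambda>b. stop_mass s l (c b)))"

lemma tmean_pos:
  assumes "tree_Ap p A t" "\<And>x. 0 < x \<Longrightarrow> 0 < h x" shows "0 < tmean h t"
  using assms by (induction t) (auto intro!: mean_pos)

lemma stop_mass_le:
  assumes "tree_Ap p A t" "\<And>x. 0 < x \<Longrightarrow> 0 < s x"
  shows "0 \<le> stop_mass s l t \<and> stop_mass s l t \<le> tmean s t"
  using assms
proof (induction t)
  case (Leaf x) then show ?case by (auto simp: less_imp_le)
next
  case (Node c)
  have "0 < tmean s (Node c)" using Node.prems by (rule tmean_pos)
  with Node show ?case by (auto intro!: mean_nonneg mean_mono)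
qed

text \<open>The last conjunct is the Chebyshev bound of the stopping time: on each stopped subtree
  the mean of \<open>s\<close> exceeds \<open>l\<close>.\<close>

lemma stop_frac_le:
  assumes "tree_Ap p A t" "\<And>x. 0 < x \<Longrightarrow> 0 < s x" "0 \<le> l"
  shows "0 \<le> stop_frac s l t \<and> stop_frac s l t \<le> 1 \<and> l * stop_frac s l t \<le> stop_mass s l t"
  using assms
proof (induction t)
  case (Leaf x) then show ?case by auto
next
  case (Node c)
  have ih: "0 \<le> stop_frac s l (c b) \<and> stop_frac s l (c b) \<le> 1 \<and> l * stop_frac s l (c b) \<le> stop_mass s l (c b)" for b
    using Node by auto
  have "mean (\<lambda>b. stop_frac s l (c b)) \<le> mean (\<lambda>b::'a. 1)" by (rule mean_mono) (use ih in auto)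
  moreover have "l * mean (\<lambda>b. stop_frac s l (c b)) \<le> mean (\<lambda>b. stop_mass s l (c b))"
    unfolding mean_cmult[symmetric] by (rule mean_mono) (use ih in auto)
  ultimately show ?case using ih by (auto intro!: mean_nonneg simp: mean_const)
qed

lemma dual_powr_cancel:
  fixes x p :: real
  assumes "0 < x" "1 < p" shows "x * (x powr (- 1 / (p - 1))) powr (p - 1) = 1"

proof -
  have "(x powr (- 1 / (p - 1))) powr (p - 1) = x powr (- 1)"
    using assms by (simp only: powr_powr) simp
  then show ?thesis using assms by (simp add: powr_minus)
qed

text \<open>At an unstopped leaf the value times \<open>s powr (p - 1)\<close> is 1, and Hoelder's
  inequality carries this upwards. It shows that a large unstopped part must hold a definite share
  of the \<open>s\<close>-mass. A stopped node is harmless because its left-hand side is 0.\<close>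

lemma stop_frac_Holder:
  assumes p: "1 < p" and t: "tree_Ap p A t" and l: "0 \<le> l"
  defines "s \<equiv> \<lambda>x::real. x powr (- 1 / (p - 1))"
  shows "(1 - stop_frac s l t) powr p \<le>
    tmean (\<lambda>x. x) t * (tmean s t - stop_mass s l t) powr (p - 1)"
  using t
proof (induction t)
  case (Leaf x)
  then show ?case using dual_powr_cancel[of x p] p by (auto simp: s_def)
next
  case (Node c)
  have spos: "0 < s x" if "0 < x" for x using that by (simp add: s_def)
  note Ap = Node.prems
  have c: "tree_Ap p A (c b)" for b using Ap by auto
  show ?case
  proof (cases "l < tmean s (Node c)")
    case True
    have "0 < tmean (\<lambda>x. x) (Node c)" using Ap by (rule tmean_pos)
    then show ?thesis using True by simp
  next
    case False
    have "mean (\<lambda>b. 1 - stop_frac s l (c b)) powr p \<le> mean (\<lambda>b. tmean (\<lambda>x. x) (c b)) *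
        mean (\<lambda>b. tmean s (c b) - stop_mass s l (c b)) powr (p - 1)"
    proof (rule mean_Holder[OF p])
      fix b
      show "0 \<le> 1 - stop_frac s l (c b)" using stop_frac_le[OF c[of b], of s l] spos l by auto
      show "0 \<le> tmean (\<lambda>x. x) (c b)" using tmean_pos[OF c, of "\<lambda>x. x" b] by auto
      show "0 \<le> tmean s (c b) - stop_mass s l (c b)" using stop_mass_le[OF c[of b], of s l] spos by auto
      show "(1 - stop_frac s l (c b)) powr p \<le> tmean (\<lambda>x. x) (c b) *
         (tmean s (c b) - stop_mass s l (c b)) powr (p - 1)"
        using Node.IH c by auto
    qed
    then show ?thesis using False by (simp add: mean_diff mean_const)
  qed
qed

text \<open>The second conjunct is the stopping-time estimate on subtrees.  At the root it is used with
  \<open>l\<close> twice the mean: then at most half of the tree is stopped, and the lemma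
  \<open>stop_frac_Holder\<close> together with the \<open>A_p\<close> condition bounds the stopped mass by the fraction
  \<open>1 - b0\<close> of the total.\<close>

lemma tree_reverse_Holder_step:
  fixes p A eps C :: real and s :: "real \<Rightarrow> real"
  assumes p: "1 < p" and A: "1 \<le> A" and eps: "0 \<le> eps"
    and b0: "0 < b0" "b0 \<le> 1" and b0_def: "b0 = (1 / (2 powr p * A)) powr (1 / (p - 1))"
    and C: "2 powr eps + C * (2 * real CARD('b)) powr eps * (1 - b0) \<le> C" "1 \<le> C"
  defines "s \<equiv> \<lambda>x::real. x powr (- 1 / (p - 1))"
  assumes t: "tree_Ap p A (t::'b::finite tree)"
  shows "tmean (\<lambda>x. s x powr (1 + eps)) t \<le> C * tmean s t powr (1 + eps) \<and>
    (\<forall>l>0. tmean s t \<le> real CARD('b) * l \<longrightarrow>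
      tmean (\<lambda>x. s x powr (1 + eps)) t \<le> l powr eps * (tmean s t - stop_mass s l t) +
        C * (real CARD('b) * l) powr eps * stop_mass s l t)"
  using t
proof (induction t)
  case (Leaf x)
  let ?N = "real CARD('b)"
  have sx: "0 < s x" using Leaf by (simp add: s_def)
  have e: "s x powr (1 + eps) = s x powr eps * s x" using sx by (simp add: powr_add)
  have "s x powr eps * s x \<le> C * ((?N * l) powr eps * s x)"
    if l: "0 < l" "s x \<le> ?N * l" for l
  proof -
    have "s x powr eps * s x \<le> (?N * l) powr eps * s x"
      using sx l eps by (intro mult_right_mono powr_mono2) auto
    also have "\<dots> \<le> C * ((?N * l) powr eps * s x)"
      using mult_right_mono[OF C(2), of "(?N * l) powr eps * s x"] sx by simp
    finally show ?thesis .
  qed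
  moreover have "s x powr eps * s x \<le> l powr eps * s x" if "\<not> l < s x" for l
    using sx that eps by (intro mult_right_mono powr_mono2) auto
  ultimately show ?case using C(2) sx by (auto simp: e mult_ac)
next
  case (Node c)
  let ?N = "real CARD('b)" and ?R = "tmean (\<lambda>x. s x powr (1 + eps))" and ?X = "tmean s"
  let ?t = "Node c"
  have spos: "0 < s x" if "0 < x" for x using that by (simp add: s_def)
  have c: "tree_Ap p A (c b)" for b using Node.prems by auto
  have Xc: "0 < ?X (c b)" for b using c spos by (rule tmean_pos)
  have X: "0 < ?X ?t" using Node.prems spos by (rule tmean_pos)
  have N: "1 \<le> ?N" by (simp add: Suc_leI)
  have Xle: "?X (c b) \<le> ?N * ?X ?t" for b
    using le_card_mean[of "\<lambda>b. ?X (c b)" b] Xc by (simp add: less_imp_le)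
  \<comment> \<open>The condition with the factor \<open>CARD('b)\<close> is what a child inherits
    from an unstopped parent, because the mean of a child is at most \<open>CARD('b)\<close> times
    that of the parent. The induction hypothesis at level \<open>l\<close> can therefore be averaged
    over the children.\<close>
  have low: "?R ?t \<le> l powr eps * (?X ?t - stop_mass s l ?t) + C * (?N * l) powr eps * stop_mass s l ?t"
    if l: "0 < l" "?X ?t \<le> l" for l
  proof -
    have Xl: "?X (c b) \<le> ?N * l" for b
      using order_trans[OF Xle[of b] mult_left_mono[OF l(2), of ?N]] by simp
    have "?R ?t \<le> mean (\<lambda>b. l powr eps * (?X (c b) - stop_mass s l (c b)) +
        (C * (?N * l) powr eps) * stop_mass s l (c b))"
      using Node.IH c Xl l by (auto intro!: mean_mono)
    also have "\<dots> = l powr eps * (?X ?t - mean (\<lambda>b. stop_mass s l (c b))) +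
        C * (?N * l) powr eps * mean (\<lambda>b. stop_mass s l (c b))"
      by (simp only: mean_add mean_cmult mean_diff tmean.simps)
    finally show ?thesis using l by simp
  qed
  have RH: "?R ?t \<le> C * ?X ?t powr (1 + eps)"
  proof -
    define l where "l = 2 * ?X ?t"
    have l: "0 < l" "?X ?t \<le> l" using X by (auto simp: l_def)
    define e Y where "e = stop_frac s l ?t" and "Y = stop_mass s l ?t"
    have eY: "l * e \<le> Y" "0 \<le> Y" "Y \<le> ?X ?t" "0 \<le> e" "e \<le> 1"
      using stop_frac_le[OF Node.prems, of s l] stop_mass_le[OF Node.prems, of s l] l spos
      by (auto simp: e_def Y_def)
    have "2 * ?X ?t * e \<le> ?X ?t" using eY by (simp add: l_def)
    then have e: "e \<le> 1/2" using X by (simp add: field_simps)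
    have "(1/2) powr p \<le> (1 - e) powr p" using e p by (intro powr_mono2) auto
    also have "\<dots> \<le> tmean (\<lambda>x. x) ?t * (?X ?t - Y) powr (p - 1)"
      using stop_frac_Holder[OF p Node.prems, of l] l by (simp add: e_def Y_def s_def)
    finally have 1: "(1/2) powr p \<le> tmean (\<lambda>x. x) ?t * (?X ?t - Y) powr (p - 1)" .
    have "tmean (\<lambda>x. x) ?t * ?X ?t powr (p - 1) \<le> A" using Node.prems by (simp add: s_def)
    then have "tmean (\<lambda>x. x) ?t * ?X ?t powr (p - 1) * (?X ?t - Y) powr (p - 1) \<le> A * (?X ?t - Y) powr (p - 1)"
      by (intro mult_right_mono) auto
    moreover have "(1/2) powr p * ?X ?t powr (p - 1) \<le>
       tmean (\<lambda>x. x) ?t * (?X ?t - Y) powr (p - 1) * ?X ?t powr (p - 1)"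
      using 1 by (intro mult_right_mono) auto
    ultimately have "(1/2) powr p * ?X ?t powr (p - 1) \<le> A * (?X ?t - Y) powr (p - 1)"
      by (simp add: mult_ac)
    then have "1 / (2 powr p * A) * ?X ?t powr (p - 1) \<le> (?X ?t - Y) powr (p - 1)"
      using A by (simp add: powr_divide field_simps)
    then have "(1 / (2 powr p * A) * ?X ?t powr (p - 1)) powr (1 / (p - 1)) \<le> ?X ?t - Y"
      using eY p A by (subst powr_le_iff_root) (auto simp: powr_powr)
    moreover have "(1 / (2 powr p * A) * ?X ?t powr (p - 1)) powr (1 / (p - 1)) = b0 * ?X ?t"
      unfolding b0_def using p A X by (subst powr_mult) (simp_all add: powr_powr)
    ultimately have "b0 * ?X ?t \<le> ?X ?t - Y" by simp
    then have Y: "Y \<le> (1 - b0) * ?X ?t" by (simp add: algebra_simps)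
    have "?R ?t \<le> l powr eps * (?X ?t - Y) + C * (?N * l) powr eps * Y"
      using low[OF l] by (simp add: Y_def)
    also have "\<dots> \<le> l powr eps * ?X ?t + C * (?N * l) powr eps * ((1 - b0) * ?X ?t)"
      using Y eY C by (intro add_mono mult_left_mono) auto
    \<comment> \<open>As \<open>l\<close> is a multiple of the mean, both terms scale like the power
      \<open>1 + eps\<close> of the mean, and the assumed inequality for \<open>C\<close> closes the
      recursion.\<close>
    also have "\<dots> = (2 powr eps + C * (2 * ?N) powr eps * (1 - b0)) * (?X ?t powr eps * ?X ?t)"
      using X by (simp add: l_def powr_mult algebra_simps)
    also have "\<dots> \<le> C * (?X ?t powr eps * ?X ?t)"
      using C X by (intro mult_right_mono) auto
    finally show ?thesis using X by (simp add: powr_add mult_ac)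
  qed
  have "?R ?t \<le> l powr eps * (?X ?t - stop_mass s l ?t) + C * (?N * l) powr eps * stop_mass s l ?t"
    if l: "0 < l" "?X ?t \<le> ?N * l" for l
  proof (cases "?X ?t \<le> l")
    \<comment> \<open>Here the root itself is stopped, so \<open>stop_mass\<close> is the whole mean
      and the reverse Hoelder inequality just proved for this node applies.\<close>
    case False
    have "?X ?t powr eps * ?X ?t \<le> (?N * l) powr eps * ?X ?t"
      using X l eps by (intro mult_right_mono powr_mono2) auto
    then have "C * (?X ?t powr (1 + eps)) \<le> C * ((?N * l) powr eps * ?X ?t)"
      using C X by (intro mult_left_mono) (auto simp: powr_add mult_ac)
    then show ?thesis using RH False by (simp add: mult_ac)
  qed (use low l in auto)
  with RH show ?case by blast
qed

text \<open>The recursion for \<open>C\<close> contracts once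
  \<open>(2 * N) powr eps * (1 - b0)\<close>, with \<open>N = CARD('b)\<close>, is below 1, which
  holds for small \<open>eps\<close>. One \<open>C\<close> is needed for the whole range of
  \<open>eps\<close>, because \<open>eps\<close> is later determined by \<open>q\<close>.\<close>

lemma tree_reverse_Holder:
  fixes p A :: real
  assumes p: "1 < p" and A: "1 \<le> A"
  obtains eps0 C where "0 < eps0" "1 \<le> C"
    "\<And>eps (t :: 'b::finite tree). 0 \<le> eps \<Longrightarrow> eps \<le> eps0 \<Longrightarrow> tree_Ap p A t \<Longrightarrow>
      tmean (\<lambda>x. (x powr (- 1 / (p - 1))) powr (1 + eps)) t \<le>
        C * tmean (\<lambda>x. x powr (- 1 / (p - 1))) t powr (1 + eps)"
proof -
  define b0 where "b0 = (1 / (2 powr p * A)) powr (1 / (p - 1))"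
  have "1 \<le> 2 powr p * A" using p A using mult_mono[of 1 "2 powr p" 1 A] by (simp add: ge_one_powr_ge_zero)
  then have "(1 / (2 powr p * A)) \<le> 1" by simp
  then have "(1 / (2 powr p * A)) powr (1 / (p - 1)) \<le> 1 powr (1 / (p - 1))"
    using p A by (intro powr_mono2) auto
  then have b0: "0 < b0" "b0 \<le> 1" using p A by (auto simp: b0_def)
  let ?N = "real CARD('b)"
  have N: "1 \<le> ?N" by (simp add: Suc_leI)
  have "((\<lambda>e. (2 * ?N) powr e * (1 - b0)) \<longlongrightarrow> (2 * ?N) powr 0 * (1 - b0)) (at_right 0)"
    using N by (intro tendsto_intros) auto
  moreover have "(2 * ?N) powr 0 * (1 - b0) < 1 - b0 / 2" using b0 N by simp
  ultimately have "eventually (\<lambda>e. (2 * ?N) powr e * (1 - b0) < 1 - b0 / 2) (at_right 0)"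
    by (rule order_tendstoD)
  then obtain d where d: "0 < d" "\<And>e. 0 < e \<Longrightarrow> e < d \<Longrightarrow> (2 * ?N) powr e * (1 - b0) < 1 - b0 / 2"
    unfolding eventually_at_right_field by auto
  define eps0 where "eps0 = min 1 (d/2)"
  have eps0: "0 < eps0" "eps0 \<le> 1" "(2 * ?N) powr eps0 * (1 - b0) \<le> 1 - b0 / 2"
    using d(1) d(2)[of eps0] by (auto simp: eps0_def min_def)
  \<comment> \<open>This is the solution of \<open>2 + C * (1 - b0 / 2) = C\<close>.\<close>
  define C where "C = 4 / b0"
  have C: "1 \<le> C" using b0 by (simp add: C_def)
  show thesis
  proof (rule that[OF eps0(1) C])
    fix eps and t :: "'b tree"
    assume e: "0 \<le> eps" "eps \<le> eps0" and t: "tree_Ap p A t"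
    have "(2 * ?N) powr eps * (1 - b0) \<le> (2 * ?N) powr eps0 * (1 - b0)"
      using e N b0 by (intro mult_right_mono powr_mono) linarith+
    then have "(2 * ?N) powr eps * (1 - b0) \<le> 1 - b0 / 2" using eps0 by simp
    then have "C * ((2 * ?N) powr eps * (1 - b0)) \<le> C * (1 - b0 / 2)" using C by (intro mult_left_mono) auto
    moreover have "2 powr eps \<le> (2::real) powr 1" using e eps0 by (intro powr_mono) auto
    ultimately have "2 powr eps + C * (2 * ?N) powr eps * (1 - b0) \<le> 2 + C * (1 - b0/2)"
      by (simp add: mult_ac)
    also have "\<dots> = C" using b0 by (simp add: C_def field_simps)
    finally show "tmean (\<lambda>x. (x powr (- 1 / (p - 1))) powr (1 + eps)) t \<le>
        C * tmean (\<lambda>x. x powr (- 1 / (p - 1))) t powr (1 + eps)"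
      using tree_reverse_Holder_step[OF p A e(1) b0 b0_def _ C t] by blast
  qed
qed

section \<open>Muckenhoupt weights on cubes\<close>

lemma cube_eq_infnorm: "cube (x::real^'n) r = {y. infnorm (y - x) < r}"
proof -
  have "(\<forall>i. \<bar>z $ i\<bar> < r) \<longleftrightarrow> infnorm z < r" for z :: "real^'n"
    by (subst infnorm_Max, subst Max_less_iff) (auto simp: Basis_vec_def inner_axis)
  then show ?thesis unfolding cube_def by (intro Collect_cong) (simp flip: vector_minus_component)
qed

lemma mem_cube: "y \<in> cube x r \<longleftrightarrow> infnorm (y - x) < r"
  by (simp add: cube_eq_infnorm)

lemma cube_box: "cube (x::real^'n) r = box (x - r *\<^sub>R 1) (x + r *\<^sub>R 1)"
proof -
  have "\<bar>a - b\<bar> < r \<longleftrightarrow> b - r < a \<and> a < b + r" for a b :: real by linarith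
  then show ?thesis by (auto simp: cube_def mem_box_cart)
qed

lemma open_cube [simp]: "open (cube (x::real^'n) r)"
  by (simp add: cube_box open_box)

lemma cube_borel [measurable, simp]: "cube (x::real^'n) r \<in> sets borel"
  by (simp add: borel_open)

lemma bounded_cube [simp]: "bounded (cube (x::real^'n) r)"
  by (simp add: cube_box)

lemma cbox_eq_infnorm: "cbox (x - r *\<^sub>R 1) (x + r *\<^sub>R 1) = {y::real^'n. infnorm (y - x) \<le> r}"
proof -
  have *: "(\<forall>i. \<bar>z $ i\<bar> \<le> r) \<longleftrightarrow> infnorm z \<le> r" for z :: "real^'n"
    by (subst infnorm_Max, subst Max_le_iff) (auto simp: Basis_vec_def inner_axis)
  have "y \<in> cbox (x - r *\<^sub>R 1) (x + r *\<^sub>R 1) \<longleftrightarrow> infnorm (y - x) \<le> r" for y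
    unfolding *[symmetric] mem_box_cart by (intro iff_allI) (auto simp: abs_le_iff)
  then show ?thesis by blast
qed

lemma closure_cube_cbox: "0 < r \<Longrightarrow> closure (cube (x::real^'n) r) = cbox (x - r *\<^sub>R 1) (x + r *\<^sub>R 1)"
  unfolding cube_box by (rule closure_box) (auto simp: box_ne_empty inner_simps Basis_vec_def inner_axis)

lemma closure_cube: "0 < r \<Longrightarrow> closure (cube (x::real^'n) r) = {y. infnorm (y - x) \<le> r}"
  by (simp add: closure_cube_cbox cbox_eq_infnorm)

lemma emeasure_cube: "0 \<le> r \<Longrightarrow> emeasure lborel (cube (x::real^'n) r) = ennreal ((2 * r) ^ CARD('n))"
proof -
  assume r: "0 \<le> r"
  have "(\<Prod>b\<in>Basis. ((x + r *\<^sub>R 1) - (x - r *\<^sub>R 1)) \<bullet> b) = (\<Prod>b\<in>(Basis::(real^'n) set). 2 * r)"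
    by (rule prod.cong) (auto simp: Basis_vec_def inner_axis)
  moreover have "emeasure lborel (box (x - r *\<^sub>R 1) (x + r *\<^sub>R 1)) =
      ennreal (\<Prod>b\<in>Basis. ((x + r *\<^sub>R 1) - (x - r *\<^sub>R 1)) \<bullet> b)"
    by (rule emeasure_lborel_box) (use r in \<open>auto simp: inner_simps Basis_vec_def inner_axis\<close>)
  ultimately show ?thesis by (simp add: cube_box)
qed

lemma measure_cube: "0 \<le> r \<Longrightarrow> measure lborel (cube (x::real^'n) r) = (2 * r) ^ CARD('n)"
  by (simp add: measure_def emeasure_cube)

lemma infnorm_one: "infnorm (c *\<^sub>R (1 :: real^'a)) = \<bar>c\<bar>"
proof -
  have "(1 :: real^'a) \<in> cbox (0 - 1 *\<^sub>R 1) (0 + 1 *\<^sub>R 1)" by (simp add: mem_box_cart)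
  then have "infnorm (1 :: real^'a) \<le> 1" unfolding cbox_eq_infnorm by simp
  moreover have "infnorm (1::real^'a) \<ge> 1"
    using component_le_infnorm_cart[of "1::real^'a" undefined] by simp
  ultimately have "infnorm (1::real^'a) = 1" by simp
  then show ?thesis by (simp add: infnorm_mul)
qed

lemma norm_le_card_infnorm: "norm (x::real^'n) \<le> real CARD('n) * infnorm x"
proof -
  have "1 \<le> real CARD('n)" by (simp add: Suc_leI)
  then have "real CARD('n) \<le> (real CARD('n))\<^sup>2" by (simp add: power2_eq_square)
  then have "sqrt (real CARD('n)) \<le> real CARD('n)" by (intro real_le_lsqrt) auto
  then have "sqrt (real CARD('n)) * infnorm x \<le> real CARD('n) * infnorm x"
    by (intro mult_right_mono infnorm_pos_le)
  then show ?thesis using norm_le_infnorm[of x] by simp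
qed

lemma cube_subset: "infnorm (y - x) + t \<le> s \<Longrightarrow> cube y t \<subseteq> cube (x::real^'n) s"
proof
  fix z assume "infnorm (y - x) + t \<le> s" "z \<in> cube y t"
  then show "z \<in> cube x s" using infnorm_triangle[of "z - y" "y - x"] by (simp add: mem_cube)
qed

text \<open>\<open>e\<close> is the set of coordinates in which the subcube lies on the upper side;
  this makes the finite type \<open>'n set\<close> the index of the subcubes.\<close>

definition child :: "real^'n \<Rightarrow> real \<Rightarrow> 'n set \<Rightarrow> real^'n" where
  "child x s e = (\<chi> i. x $ i + (if i \<in> e then s / 2 else - s / 2))"

lemma child_subset: "cube (child x s e) (s / 2) \<subseteq> cube x s"
proof
  fix y assume y: "y \<in> cube (child x s e) (s / 2)"
  show "y \<in> cube x s"
    unfolding cube_def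
  proof (intro CollectI allI)
    fix i
    have "\<bar>y $ i - (x $ i + (if i \<in> e then s / 2 else - s / 2))\<bar> < s / 2"
      using y by (simp add: cube_def child_def)
    then show "\<bar>y $ i - x $ i\<bar> < s" by (cases "i \<in> e") (auto simp: abs_less_iff field_simps)
  qed
qed

text \<open>The open subcubes miss only points on the hyperplanes \<open>y $ i = x $ i\<close>,
  which are null sets. Off them the sign pattern \<open>e0\<close> singles out one subcube.\<close>

lemma cube_children:
  fixes x :: "real^'n"
  shows "AE y in lborel. indicator (cube x s) y = (\<Sum>e\<in>UNIV. indicator (cube (child x s e) (s / 2)) y :: real)"
proof -
  have "negligible {y::real^'n. y \<bullet> axis i 1 = x $ i}" for i
    by (rule negligible_standard_hyperplane) (simp add: axis_in_Basis_iff)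
  then have "{y::real^'n. y $ i = x $ i} \<in> null_sets lebesgue" for i
    by (simp add: inner_axis negligible_iff_null_sets)
  then have "{y::real^'n. y $ i = x $ i} \<in> null_sets lborel" for i
    by (simp add: null_sets_completion_iff)
  then have "AE y in lborel. y \<notin> {y::real^'n. y $ i = x $ i}" for i
    by (rule AE_not_in)
  then have "AE y in lborel. \<forall>i. y $ i \<noteq> x $ i"
    by (subst AE_all_countable) (auto elim!: eventually_mono)
  then show ?thesis
  proof (rule eventually_mono)
    fix y assume y: "\<forall>i. y $ i \<noteq> x $ i"
    define e0 where "e0 = {i. x $ i < y $ i}"
    have mem: "y \<in> cube (child x s e) (s / 2) \<longleftrightarrow> e = e0 \<and> y \<in> cube x s" for e
    proof
      assume a: "y \<in> cube (child x s e) (s / 2)"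
      have "i \<in> e \<longleftrightarrow> i \<in> e0" for i
      proof -
        have "\<bar>y $ i - (x $ i + (if i \<in> e then s / 2 else - s / 2))\<bar> < s / 2"
          using a by (simp add: cube_def child_def)
        then show ?thesis by (cases "i \<in> e") (auto simp: e0_def abs_less_iff field_simps)
      qed
      then show "e = e0 \<and> y \<in> cube x s" using a child_subset by blast
    next
      assume a: "e = e0 \<and> y \<in> cube x s"
      have "\<bar>y $ i - (x $ i + (if i \<in> e then s / 2 else - s / 2))\<bar> < s / 2" for i
      proof -
        have "\<bar>y $ i - x $ i\<bar> < s" "y $ i \<noteq> x $ i" using a y by (auto simp: cube_def)
        then show ?thesis using a by (auto simp: e0_def abs_less_iff field_simps)
      qed
      then show "y \<in> cube (child x s e) (s / 2)" by (simp add: cube_def child_def)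
    qed
    have "(\<Sum>e\<in>UNIV. indicator (cube (child x s e) (s / 2)) y :: real) =
        (\<Sum>e\<in>UNIV. if e = e0 then indicator (cube x s) y else 0)"
      by (intro sum.cong refl) (simp add: indicator_def mem)
    then show "indicator (cube x s) y = (\<Sum>e\<in>UNIV. indicator (cube (child x s e) (s / 2)) y :: real)"
      by simp
  qed
qed

section \<open>Averages over cubes and lower Darboux means\<close>

lemma set_integral_mono_subset:
  fixes h :: "'a \<Rightarrow> real"
  assumes "set_integrable N F h" "E \<subseteq> F" "E \<in> sets N" "\<And>x. 0 \<le> h x"
  shows "(LINT x:E|N. h x) \<le> (LINT x:F|N. h x)"
  unfolding set_lebesgue_integral_def
  using set_integrable_subset[OF assms(1,3,2)] assms
  by (intro integral_mono) (auto simp: set_integrable_def indicator_def)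

text \<open>The divisor is the Lebesgue volume even when \<open>N\<close> is a weighted measure. The
  average over a cube is then the unweighted mean of the averages over its subcubes, whatever
  \<open>N\<close> is.\<close>

definition cube_avg :: "(real^'n) measure \<Rightarrow> (real^'n \<Rightarrow> real) \<Rightarrow> real^'n \<Rightarrow> real \<Rightarrow> real" where
  "cube_avg N g x s = (LINT y:cube x s|N. g y) / (2 * s) ^ CARD('n)"

lemma cube_avg_children:
  fixes x :: "real^'n"
  assumes N: "sets N = sets borel"
    and ae: "AE y in N. indicator (cube x s) y = (\<Sum>e\<in>UNIV. indicator (cube (child x s e) (s / 2)) y :: real)"
    and g: "set_integrable N (cube x s) g" and s: "0 < s"
  shows "cube_avg N g x s = mean (\<lambda>e. cube_avg N g (child x s e) (s / 2))"
proof -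
  have gi: "set_integrable N (cube (child x s e) (s / 2)) g" for e
    by (rule set_integrable_subset[OF g _ child_subset]) (simp add: N)
  have "(LINT y:cube x s|N. g y) = (\<integral>y. (\<Sum>e\<in>UNIV. indicator (cube (child x s e) (s / 2)) y *\<^sub>R g y) \<partial>N)"
    unfolding set_lebesgue_integral_def
  proof (rule integral_cong_AE)
    show "(\<lambda>y. indicator (cube x s) y *\<^sub>R g y) \<in> borel_measurable N"
      using g by (auto simp: set_integrable_def)
    show "(\<lambda>y. \<Sum>e\<in>UNIV. indicator (cube (child x s e) (s / 2)) y *\<^sub>R g y) \<in> borel_measurable N"
      using gi by (intro borel_measurable_sum) (auto simp: set_integrable_def)
    show "AE y in N. indicator (cube x s) y *\<^sub>R g y = (\<Sum>e\<in>UNIV. indicator (cube (child x s e) (s / 2)) y *\<^sub>R g y)"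
      using ae by eventually_elim (simp add: sum_distrib_right)
  qed
  also have "\<dots> = (\<Sum>e\<in>UNIV. LINT y:cube (child x s e) (s / 2)|N. g y)"
    unfolding set_lebesgue_integral_def using gi
    by (intro Bochner_Integration.integral_sum) (auto simp: set_integrable_def)
  finally have "cube_avg N g x s = (\<Sum>e\<in>UNIV. LINT y:cube (child x s e) (s / 2)|N. g y) / (2 * s) ^ CARD('n)"
    by (simp add: cube_avg_def)
  moreover have "card (UNIV :: 'n set set) = 2 ^ CARD('n)"
    by (simp add: card_Pow flip: Pow_UNIV)
  ultimately show ?thesis using s
    by (simp add: cube_avg_def mean_def power_mult_distrib sum_divide_distrib field_simps)
qed

lemma cube_nonempty: assumes "0 < s" shows "cube x s \<noteq> {}"
proof -
  have "x \<in> cube x s" using assms by (simp add: mem_cube infnorm_0)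
  then show ?thesis by blast
qed

lemma set_integrable_bounded_continuous:
  fixes f :: "real^'n \<Rightarrow> real"
  assumes "continuous_on UNIV f" and N: "sets N = sets borel" "emeasure N (cube x s) < \<infinity>"
  shows "set_integrable N (cube x s) f"
proof -
  have "bounded (f ` closure (cube x s))"
    using assms(1) by (intro compact_imp_bounded compact_continuous_image)
      (auto intro: continuous_on_subset simp: compact_closure)
  then obtain B where B: "\<And>y. y \<in> cube x s \<Longrightarrow> \<bar>f y\<bar> \<le> B"
    unfolding bounded_iff using closure_subset by fastforce
  show ?thesis
    unfolding set_integrable_def
  proof (rule Bochner_Integration.integrable_bound)
    show "integrable N (\<lambda>y. B * indicator (cube x s) y)"
      using N by (intro integrable_mult_right integrable_real_indicator) auto
    have "f \<in> borel_measurable borel" using assms(1) by (rule borel_measurable_continuous_onI)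
    then show "(\<lambda>y. indicator (cube x s) y *\<^sub>R f y) \<in> borel_measurable N"
      using N(1) by (simp cong: measurable_cong_sets)
    show "AE y in N. norm (indicator (cube x s) y *\<^sub>R f y) \<le> norm (B * indicator (cube x s) y)"
      using B by (intro AE_I2) (force simp: indicator_def)
  qed
qed

text \<open>A lower Darboux sum after \<open>k\<close> bisections. With an infimum at the leaves,
  \<open>f\<close> is constant on each cell, which makes the weighted Hoelder estimate at a leaf
  immediate.\<close>

primrec lower_mean :: "(real^'n \<Rightarrow> real) \<Rightarrow> nat \<Rightarrow> real^'n \<Rightarrow> real \<Rightarrow> real" where
  "lower_mean f 0 x s = (INF y\<in>cube x s. f y)"
| "lower_mean f (Suc k) x s = mean (\<lambda>e. lower_mean f k (child x s e) (s / 2))"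

text \<open>After \<open>k\<close> bisections a cell has \<open>infnorm\<close> diameter at most
  \<open>2 * s / 2 ^ k\<close>, so infimum and average differ by at most \<eta>. The fixed cube
  around \<open>x0\<close> keeps the oscillation hypothesis the same for all children.\<close>

lemma lower_mean_ge:
  fixes f :: "real^'n \<Rightarrow> real" and x x0 :: "real^'n"
  assumes f: "continuous_on UNIV f" "\<And>y. 0 \<le> f y" and s: "0 < s" and sub: "cube x s \<subseteq> cube x0 s0"
    and osc: "\<And>y z. y \<in> cube x0 s0 \<Longrightarrow> z \<in> cube x0 s0 \<Longrightarrow> infnorm (y - z) < d \<Longrightarrow> f y \<le> f z + \<eta>"
    and d: "2 * s / 2 ^ k \<le> d"
  shows "cube_avg lborel f x s - \<eta> \<le> lower_mean f k x s"
  using s sub d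
proof (induction k arbitrary: x s)
  case 0
  let ?i = "INF y\<in>cube x s. f y" and ?Q = "(2 * s) ^ CARD('n)"
  have Q: "0 < ?Q" using 0 by simp
  have fin: "emeasure lborel (cube x s) < \<infinity>" using 0 by (simp add: emeasure_cube)
  have le: "f y - \<eta> \<le> ?i" if y: "y \<in> cube x s" for y
  proof (rule cINF_greatest)
    fix z assume z: "z \<in> cube x s"
    have "infnorm (y - z) < 2 * s"
      using y z infnorm_triangle[of "y - x" "x - z"] by (simp add: mem_cube infnorm_sub[of x z])
    then show "f y - \<eta> \<le> f z" using osc[of y z] y z 0 by force
  qed (use cube_nonempty 0 in blast)
  have "(LINT y:cube x s|lborel. f y) \<le> (LINT y:cube x s|lborel. ?i + \<eta>)"
    using fin f by (intro set_integral_mono set_integrable_bounded_continuous) (auto dest!: le)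
  also have "\<dots> = (?i + \<eta>) * ?Q"
    using 0 fin by (simp add: set_lebesgue_integral_def measure_cube)
  finally show ?case using Q by (simp add: cube_avg_def field_simps)
next
  case (Suc k)
  have fin: "emeasure lborel (cube x s) < \<infinity>" using Suc by (simp add: emeasure_cube)
  have "cube_avg lborel f x s - \<eta> = mean (\<lambda>e. cube_avg lborel f (child x s e) (s / 2) - \<eta>)"
    using Suc.prems f fin
    by (subst cube_avg_children[OF _ cube_children]) (auto simp: mean_diff mean_const intro!: set_integrable_bounded_continuous)
  also have "\<dots> \<le> mean (\<lambda>e. lower_mean f k (child x s e) (s / 2))"
  proof (rule mean_mono)
    fix e
    have "2 * (s / 2) / 2 ^ k \<le> d" using Suc.prems by (simp add: field_simps)
    then show "cube_avg lborel f (child x s e) (s / 2) - \<eta> \<le> lower_mean f k (child x s e) (s / 2)"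
      using Suc.prems child_subset[of x s e] by (intro Suc.IH) auto
  qed
  finally show ?case by simp
qed

text \<open>The weight is a nonnegative Borel representative, so that \<open>density\<close> and
  product measurability can be used with \<open>borel\<close>. \<open>A\<close> is any real bound
  not below 1, which lets many weights share it.\<close>

locale Ap_weight =
  fixes w :: "real^'n \<Rightarrow> real" and p A :: real
  assumes p: "1 < p" and A: "1 \<le> A"
    and w_borel [measurable]: "w \<in> borel_measurable borel"
    and w_nonneg: "\<And>x. 0 \<le> w x" and w_pos: "AE x in lborel. 0 < w x"
    and w_int: "\<And>x s. set_integrable lborel (cube x s) w"
    and dual_int: "\<And>x s. set_integrable lborel (cube x s) (\<lambda>y. w y powr (- 1 / (p - 1)))"
    and Ap: "\<And>x s. 0 < s \<Longrightarrow> cube_avg lborel w x s *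
      cube_avg lborel (\<lambda>y. w y powr (- 1 / (p - 1))) x s powr (p - 1) \<le> A"
begin

abbreviation dual :: "real^'n \<Rightarrow> real" where
  "dual y \<equiv> w y powr (- 1 / (p - 1))"

definition M :: "(real^'n) measure" where
  "M = density lborel (\<lambda>x. ennreal (w x))"

lemma sets_M [simp, measurable_cong]: "sets M = sets borel"
  by (simp add: M_def)

lemma space_M [simp]: "space M = UNIV"
  by (simp add: M_def)

lemma AE_M: "AE x in lborel. P x \<Longrightarrow> AE x in M. P x"
  unfolding M_def by (subst AE_density) (auto elim: eventually_mono)

lemma emeasure_M:
  assumes [measurable]: "E \<in> sets borel" "E \<subseteq> cube x s"
  shows "emeasure M E = ennreal (LINT y:E|lborel. w y)"
proof -
  have "set_integrable lborel E w"
    using set_integrable_subset[OF w_int, of E x s] assms by simp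
  then show ?thesis
    unfolding M_def set_lebesgue_integral_def set_integrable_def
    by (subst emeasure_density)
       (auto intro!: nn_integral_cong simp: w_nonneg nn_integral_eq_integral[symmetric] indicator_def)
qed

lemma M_finite: "E \<in> sets borel \<Longrightarrow> E \<subseteq> cube x s \<Longrightarrow> emeasure M E < \<infinity>"
  by (simp add: emeasure_M)

lemma measure_M:
  "E \<in> sets borel \<Longrightarrow> E \<subseteq> cube x s \<Longrightarrow> measure M E = (LINT y:E|lborel. w y)"
  by (simp add: measure_def emeasure_M set_lebesgue_integral_def integral_nonneg_AE w_nonneg)

lemma cube_integral_pos:
  fixes h :: "real^'n \<Rightarrow> real"
  assumes "AE y in lborel. 0 < h y" "set_integrable lborel (cube x s) h" "0 < s"
  shows "0 < (LINT y:cube x s|lborel. h y)"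
proof -
  have ae: "AE y in lborel. 0 \<le> indicator (cube x s) y *\<^sub>R h y"
    using assms(1) by eventually_elim (auto simp: indicator_def)
  have "(LINT y:cube x s|lborel. h y) \<noteq> 0"
  proof
    assume "(LINT y:cube x s|lborel. h y) = 0"
    then have "AE y in lborel. indicator (cube x s) y *\<^sub>R h y = 0"
      unfolding set_lebesgue_integral_def
      using integral_nonneg_eq_0_iff_AE[OF _ ae] assms(2) by (simp add: set_integrable_def)
    with assms(1) have "AE y in lborel. y \<notin> cube x s"
      by eventually_elim (auto simp: indicator_def split: if_splits)
    then have "emeasure lborel (cube x s) = 0"
      using AE_iff_null_sets[of "cube x s" lborel] by auto
    then show False using assms(3) by (simp add: emeasure_cube)
  qed
  moreover have "0 \<le> (LINT y:cube x s|lborel. h y)"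
    unfolding set_lebesgue_integral_def using ae by (rule integral_nonneg_AE)
  ultimately show ?thesis by simp
qed

lemma M_cube_pos: "0 < s \<Longrightarrow> 0 < measure M (cube x s)"
  using cube_integral_pos[OF w_pos w_int] by (simp add: measure_M[of _ x s])

lemma dual_pos: "0 < s \<Longrightarrow> 0 < (LINT y:cube x s|lborel. dual y)"
  by (rule cube_integral_pos[OF _ dual_int]) (use w_pos in \<open>auto elim: eventually_mono\<close>)

text \<open>Hoelder's inequality applied to
  \<open>1 = w powr (1 / p) * dual powr (1 - 1 / p)\<close> on the small cube. The dual integral is
  enlarged to the big cube, since that is where doubling invokes the \<open>A_p\<close>
  condition.\<close>

lemma volume_powr_le:
  assumes E: "cube y t \<subseteq> cube x s" and t: "0 < t" and s: "0 < s"
  shows "((2 * t) ^ CARD('n)) powr p \<le>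
    measure M (cube y t) * (LINT z:cube x s|lborel. dual z) powr (p - 1)"
proof -
  let ?m = "measure M (cube y t)" and ?d = "LINT z:cube x s|lborel. dual z"
  define K where "K = (?m * ?d powr (p - 1)) powr (1 / p)"
  have pos: "0 < ?m" "0 < ?d" using M_cube_pos t dual_pos s by auto
  have wE: "set_integrable lborel (cube y t) w" by (rule w_int)
  have dE: "set_integrable lborel (cube y t) dual" by (rule dual_int)
  have "1 \<le> K * (w z / ?m / p + (1 - 1 / p) * (dual z / ?d))" if "0 < w z" for z
    using young_product[OF p, of "w z" "dual z" ?m ?d] dual_powr_cancel[of "w z" p] that pos p
    by (simp add: K_def)
  then have "AE z in lborel. 1 \<le> K * (w z / ?m / p + (1 - 1 / p) * (dual z / ?d))"
    using w_pos by (auto elim: eventually_mono)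
  then have "(LINT z:cube y t|lborel. 1) \<le> (LINT z:cube y t|lborel. K * (w z / ?m / p + (1 - 1 / p) * (dual z / ?d)))"
    by (intro set_integral_mono_AE set_integrable_mult_right set_integral_add set_integrable_divide wE dE)
       (auto simp: set_integrable_def emeasure_cube t less_imp_le)
  also have "\<dots> = K * ((LINT z:cube y t|lborel. w z) / ?m / p + (1 - 1 / p) * ((LINT z:cube y t|lborel. dual z) / ?d))"
  proof -
    have i: "set_integrable lborel (cube y t) (\<lambda>z. w z / ?m / p)"
      "set_integrable lborel (cube y t) (\<lambda>z. (1 - 1 / p) * (dual z / ?d))"
      by (intro set_integrable_mult_right set_integrable_divide wE dE)+
    show ?thesis
      by (simp only: set_integral_mult_right set_integral_add(2)[OF i] set_integral_divide_zero)
  qed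
  also have "(LINT z:cube y t|lborel. w z) / ?m = 1"
    using pos by (simp add: measure_M[of _ y t])
  finally have "(LINT z:cube y t|lborel. 1) \<le> K * (1 / p + (1 - 1 / p) * ((LINT z:cube y t|lborel. dual z) / ?d))" .
  also have "(LINT z:cube y t|lborel. dual z) \<le> ?d"
    by (rule set_integral_mono_subset[OF dual_int E]) auto
  then have "K * (1 / p + (1 - 1 / p) * ((LINT z:cube y t|lborel. dual z) / ?d)) \<le> K * (1 / p + (1 - 1 / p) * 1)"
    using pos p by (intro mult_left_mono add_left_mono) (auto simp: K_def)
  finally have "(2 * t) ^ CARD('n) \<le> K"
    using t by (simp add: set_lebesgue_integral_def measure_cube)
  then show ?thesis
    unfolding K_def using pos p t by (subst powr_le_iff_root) auto
qed

text \<open>The \<open>A_p\<close> condition on the large cube bounds its mass by a power of its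
  volume over the dual integral; \<open>volume_powr_le\<close> bounds the mass of the small cube
  from below with the same dual integral, which cancels.\<close>

lemma doubling:
  assumes E: "cube y t \<subseteq> cube x s" and t: "0 < t" and s: "0 < s"
  shows "measure M (cube x s) * (t / s) powr (CARD('n) * p) \<le> A * measure M (cube y t)"
proof -
  let ?d = "LINT z:cube x s|lborel. dual z"
  define Q where "Q = (2 * s) ^ CARD('n)"
  have Q: "0 < Q" using s by (simp add: Q_def)
  have pos: "0 < measure M (cube x s)" "0 < ?d" using s M_cube_pos dual_pos by auto
  have "measure M (cube x s) / Q * (?d / Q) powr (p - 1) \<le> A"
    using Ap[OF s, of x] by (simp add: cube_avg_def measure_M[of _ x s] Q_def)
  then have "measure M (cube x s) * ?d powr (p - 1) \<le> A * (Q * Q powr (p - 1))"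
    using Q pos by (simp add: powr_divide field_simps)
  also have "Q * Q powr (p - 1) = Q powr p"
    using Q powr_mult_base[of Q "p - 1"] by simp
  finally have 1: "measure M (cube x s) * ?d powr (p - 1) \<le> A * Q powr p" .
  have "measure M (cube x s) * ((2 * t) ^ CARD('n)) powr p * ?d powr (p - 1) \<le>
      measure M (cube x s) * (measure M (cube y t) * ?d powr (p - 1)) * ?d powr (p - 1)"
    using volume_powr_le[OF E t s] pos by (intro mult_right_mono mult_left_mono) auto
  also have "\<dots> = measure M (cube y t) * (measure M (cube x s) * ?d powr (p - 1)) * ?d powr (p - 1)" by simp
  also have "\<dots> \<le> measure M (cube y t) * (A * Q powr p) * ?d powr (p - 1)"
    using 1 by (intro mult_right_mono mult_left_mono) auto
  finally have "measure M (cube x s) * ((2 * t) ^ CARD('n)) powr p \<le> measure M (cube y t) * (A * Q powr p)"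
    using pos by simp
  then have "measure M (cube x s) * (((2 * t) ^ CARD('n)) powr p / Q powr p) \<le> A * measure M (cube y t)"
    using Q by (simp add: field_simps)
  also have "((2 * t) ^ CARD('n)) powr p / Q powr p = (t / s) powr (CARD('n) * p)"
    using s t by (simp add: Q_def powr_divide[symmetric] powr_powr power_divide[symmetric] flip: powr_realpow)
  finally show ?thesis .
qed

section \<open>From trees of averages to continuous functions\<close>

primrec avg_tree :: "nat \<Rightarrow> real^'n \<Rightarrow> real \<Rightarrow> 'n set tree" where
  "avg_tree 0 x s = Leaf (cube_avg lborel w x s)"
| "avg_tree (Suc k) x s = Node (\<lambda>e. avg_tree k (child x s e) (s / 2))"

lemma cube_avg_pos: "0 < s \<Longrightarrow> 0 < cube_avg lborel w x s"
  using cube_integral_pos[OF w_pos w_int] by (simp add: cube_avg_def)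

lemma tmean_avg_tree: "0 < s \<Longrightarrow> tmean (\<lambda>x. x) (avg_tree k x s) = cube_avg lborel w x s"
proof (induction k arbitrary: x s)
  case (Suc k)
  then show ?case using cube_avg_children[OF _ cube_children w_int, of s x] by simp
qed simp

text \<open>At a leaf this is Jensen's inequality for the convex function
  \<open>x powr (- 1 / (p - 1))\<close>, read off \<open>volume_powr_le\<close> with both cubes
  equal. Thus discretisation preserves the \<open>A_p\<close> condition with the same
  constant.\<close>

lemma tmean_dual_avg_tree:
  "0 < s \<Longrightarrow> tmean (\<lambda>x. x powr (- 1 / (p - 1))) (avg_tree k x s) \<le> cube_avg lborel dual x s"
proof (induction k arbitrary: x s)
  case 0
  define Q where "Q = (2 * s) ^ CARD('n)"
  let ?m = "cube_avg lborel w x s" and ?d = "cube_avg lborel dual x s"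
  have Q: "0 < Q" using 0 by (simp add: Q_def)
  have m: "0 < ?m" using 0 by (rule cube_avg_pos)
  have d: "0 < ?d" using dual_pos[OF 0, of x] 0 by (simp add: cube_avg_def)
  have "Q powr p \<le> measure M (cube x s) * (LINT z:cube x s|lborel. dual z) powr (p - 1)"
    using volume_powr_le[of x s x s] 0 by (simp add: Q_def)
  also have "\<dots> = (?m * Q) * (?d * Q) powr (p - 1)"
    using 0 by (simp add: cube_avg_def measure_M[of _ x s] Q_def)
  also have "\<dots> = ?m * ?d powr (p - 1) * (Q * Q powr (p - 1))"
    using Q d by (simp add: powr_mult)
  also have "Q * Q powr (p - 1) = Q powr p"
    using Q powr_mult_base[of Q "p - 1"] by simp
  finally have "1 \<le> ?m * ?d powr (p - 1)" using Q by simp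
  then have "inverse ?m \<le> ?d powr (p - 1)" using m by (simp add: field_simps)
  then have "inverse ?m powr (1 / (p - 1)) \<le> (?d powr (p - 1)) powr (1 / (p - 1))"
    using m p by (intro powr_mono2) auto
  then show ?case using m d p by (simp add: powr_powr powr_minus inverse_powr)
next
  case (Suc k)
  then show ?case using cube_avg_children[OF _ cube_children dual_int, of s x]
    by (auto intro!: mean_mono)
qed

lemma avg_tree_dual_le:
  assumes "0 < s"
  shows "tmean (\<lambda>x. x) (avg_tree k x s) * tmean (\<lambda>x. x powr (- 1 / (p - 1))) (avg_tree k x s) powr (p - 1) \<le> A"
proof -
  have t: "0 \<le> tmean (\<lambda>x. x powr (- 1 / (p - 1))) (t :: 'n set tree)" for t
    by (induction t) (auto intro!: mean_nonneg)
  have "tmean (\<lambda>x. x) (avg_tree k x s) * tmean (\<lambda>x. x powr (- 1 / (p - 1))) (avg_tree k x s) powr (p - 1)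
      \<le> cube_avg lborel w x s * cube_avg lborel dual x s powr (p - 1)"
    unfolding tmean_avg_tree[OF assms]
    by (intro mult_left_mono powr_mono2 tmean_dual_avg_tree assms t)
      (use p cube_avg_pos[OF assms, of x] in auto)
  also have "\<dots> \<le> A" using Ap[OF assms] .
  finally show ?thesis .
qed

lemma tree_Ap_avg_tree: "0 < s \<Longrightarrow> tree_Ap p A (avg_tree k x s)"
proof (induction k arbitrary: x s)
  case (Suc k)
  then show ?case using avg_tree_dual_le[of s "Suc k" x] by simp
qed (simp add: cube_avg_pos)

text \<open>At a leaf, the infimum to the power \<open>q\<close> times the average of
  \<open>w\<close> is at most the weighted average of \<open>f powr q\<close>, and the inverse of
  that average is its own dual to the power \<open>q - 1\<close>. \<open>mean_Holder\<close> does
  the rest. No \<open>A_q\<close> information enters yet; it is needed only to bound the dual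
  factor.\<close>

lemma lower_mean_Holder:
  assumes f: "continuous_on UNIV f" "\<And>y. 0 \<le> f y" and q: "1 < q" and s: "0 < s"
  shows "0 \<le> lower_mean f k x s \<and> lower_mean f k x s powr q \<le>
    cube_avg M (\<lambda>y. f y powr q) x s * tmean (\<lambda>x. x powr (- 1 / (q - 1))) (avg_tree k x s) powr (q - 1)"
  using s
proof (induction k arbitrary: x s)
  case 0
  let ?i = "INF y\<in>cube x s. f y" and ?m = "cube_avg lborel w x s" and ?Q = "(2 * s) ^ CARD('n)"
  have bdd: "bdd_below (f ` cube x s)" using f(2) by (auto intro!: bdd_belowI2)
  have i0: "0 \<le> ?i" using f(2) cube_nonempty[OF 0] by (intro cINF_greatest) auto
  have i: "?i \<le> f y" if "y \<in> cube x s" for y using bdd that by (rule cINF_lower)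
  have fq: "continuous_on UNIV (\<lambda>y. f y powr q)" using f q by (intro continuous_on_powr') auto
  have m: "0 < ?m" using 0 by (rule cube_avg_pos)
  have fin: "emeasure M (cube x s) < \<infinity>" by (rule M_finite) auto
  have "?i powr q * measure M (cube x s) = (LINT y:cube x s|M. ?i powr q)"
    using fin by (simp add: set_lebesgue_integral_def)
  also have "\<dots> \<le> (LINT y:cube x s|M. f y powr q)"
    using i i0 q fq fin by (intro set_integral_mono set_integrable_bounded_continuous) (auto intro!: powr_mono2)
  finally have "?i powr q * measure M (cube x s) / ?Q \<le> cube_avg M (\<lambda>y. f y powr q) x s"
    using 0 by (simp add: cube_avg_def divide_right_mono)
  then have "?i powr q * ?m \<le> cube_avg M (\<lambda>y. f y powr q) x s"
    by (simp add: cube_avg_def measure_M[of _ x s])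
  then have "?i powr q \<le> cube_avg M (\<lambda>y. f y powr q) x s * inverse ?m"
    using m by (simp add: field_simps)
  also have "inverse ?m = (?m powr (- 1 / (q - 1))) powr (q - 1)"
    using dual_powr_cancel[OF m q] m by (simp add: field_simps)
  finally show ?case using i0 by simp
next
  case (Suc k)
  have fq: "continuous_on UNIV (\<lambda>y. f y powr q)" using f q by (intro continuous_on_powr') auto
  have nn: "0 \<le> tmean (\<lambda>x. x powr (- 1 / (q - 1))) (t :: 'n set tree)" for t
    by (induction t) (auto intro!: mean_nonneg)
  have ih: "0 \<le> lower_mean f k (child x s e) (s / 2) \<and> lower_mean f k (child x s e) (s / 2) powr q \<le>
    cube_avg M (\<lambda>y. f y powr q) (child x s e) (s / 2) *
    tmean (\<lambda>x. x powr (- 1 / (q - 1))) (avg_tree k (child x s e) (s / 2)) powr (q - 1)" for e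
    using Suc by simp
  have "mean (\<lambda>e. lower_mean f k (child x s e) (s / 2)) powr q \<le>
      mean (\<lambda>e. cube_avg M (\<lambda>y. f y powr q) (child x s e) (s / 2)) *
      mean (\<lambda>e. tmean (\<lambda>x. x powr (- 1 / (q - 1))) (avg_tree k (child x s e) (s / 2))) powr (q - 1)"
  proof (rule mean_Holder[OF q])
    show "0 \<le> cube_avg M (\<lambda>y. f y powr q) (child x s e) (s / 2)" for e
      using Suc.prems by (auto simp: cube_avg_def set_lebesgue_integral_def intro!: divide_nonneg_nonneg integral_nonneg_AE)
  qed (use ih nn in auto)
  moreover have "cube_avg M (\<lambda>y. f y powr q) x s = mean (\<lambda>e. cube_avg M (\<lambda>y. f y powr q) (child x s e) (s / 2))"
    using Suc.prems fq
    by (intro cube_avg_children AE_M cube_children set_integrable_bounded_continuous M_finite) auto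
  ultimately show ?case using ih by (auto intro!: mean_nonneg)
qed

text \<open>A reverse Hoelder inequality for the \<open>p\<close>-dual weight with exponent
  \<open>(p - 1) / (q - 1)\<close> bounds the \<open>q\<close>-dual tree mean, uniformly in the
  depth \<open>k\<close>. Uniform continuity then recovers the true mean of \<open>f\<close> as
  \<open>k\<close> grows.\<close>

lemma cube_avg_powr_le:
  assumes f: "continuous_on UNIV f" "\<And>y. 0 \<le> f y" and s: "0 < s"
    and q: "1 < q" "q \<le> p" and C: "0 \<le> C"
    and RH: "\<And>t :: 'n set tree. tree_Ap p A t \<Longrightarrow>
      tmean (\<lambda>x. (x powr (- 1 / (p - 1))) powr ((p - 1) / (q - 1))) t \<le>
        C * tmean (\<lambda>x. x powr (- 1 / (p - 1))) t powr ((p - 1) / (q - 1))"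
  shows "cube_avg lborel f x s powr q * cube_avg lborel w x s \<le>
    (C powr (q - 1) * A) * cube_avg M (\<lambda>y. f y powr q) x s"
proof -
  let ?F = "cube_avg M (\<lambda>y. f y powr q) x s" and ?m = "cube_avg lborel w x s"
  let ?f = "cube_avg lborel f x s"
  have m: "0 < ?m" using s by (rule cube_avg_pos)
  have F: "0 \<le> ?F"
    using s by (auto simp: cube_avg_def set_lebesgue_integral_def intro!: divide_nonneg_nonneg integral_nonneg_AE)
  define K where "K = (C powr (q - 1) * A) * ?F / ?m"
  have K: "0 \<le> K" using C A F m by (simp add: K_def)
  have low: "lower_mean f k x s powr q \<le> K" "0 \<le> lower_mean f k x s" for k
  proof -
    let ?t = "avg_tree k x s" and ?r = "(p - 1) / (q - 1)"
    let ?X = "tmean (\<lambda>x. x powr (- 1 / (p - 1))) ?t" and ?R = "tmean (\<lambda>x. x powr (- 1 / (q - 1))) ?t"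
    have t: "tree_Ap p A ?t" using s by (rule tree_Ap_avg_tree)
    have R0: "0 < ?R" "0 < ?X" using t by (auto intro!: tmean_pos)
    \<comment> \<open>The exponent turns the \<open>p\<close>-dual weight into the
      \<open>q\<close>-dual weight.\<close>
    have e: "(x powr (- 1 / (p - 1))) powr ((p - 1) / (q - 1)) = x powr (- 1 / (q - 1))" for x :: real
    proof -
      have "(- 1 / (p - 1)) * ((p - 1) / (q - 1)) = - 1 / (q - 1)" using p by (simp add: field_simps)
      then show ?thesis by (simp only: powr_powr)
    qed
    have "?R \<le> C * ?X powr ?r" using RH[OF t] by (simp only: e)
    then have "?R powr (q - 1) \<le> (C * ?X powr ?r) powr (q - 1)"
      using q R0 by (intro powr_mono2) auto
    also have "\<dots> = C powr (q - 1) * ?X powr (p - 1)"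
      using q C R0 by (simp add: powr_mult powr_powr)
    finally have R: "?R powr (q - 1) \<le> C powr (q - 1) * ?X powr (p - 1)" .
    have "?m * ?X powr (p - 1) \<le> A" using avg_tree_dual_le[OF s, of k x] s by (simp add: tmean_avg_tree)
    then have X: "?X powr (p - 1) \<le> A / ?m" using m by (simp add: field_simps)
    have "?R powr (q - 1) \<le> C powr (q - 1) * (A / ?m)"
      using R X by (meson mult_left_mono order_trans powr_ge_zero)
    then have "?F * ?R powr (q - 1) \<le> ?F * (C powr (q - 1) * (A / ?m))" using F by (rule mult_left_mono)
    then show "lower_mean f k x s powr q \<le> K" "0 \<le> lower_mean f k x s"
      using lower_mean_Holder[OF f q(1) s, of k x] by (auto simp: K_def mult_ac)
  qed
  have "?f \<le> K powr (1 / q)"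
  proof (rule field_le_epsilon)
    fix \<eta> :: real assume \<eta>: "0 < \<eta>"
    have "uniformly_continuous_on (closure (cube x s)) f"
      using f(1) by (intro compact_uniformly_continuous) (auto intro: continuous_on_subset simp: compact_closure)
    then obtain d where d: "0 < d" "\<And>y z. y \<in> closure (cube x s) \<Longrightarrow> z \<in> closure (cube x s) \<Longrightarrow>
        dist z y < d \<Longrightarrow> dist (f z) (f y) < \<eta>"
      using \<eta> unfolding uniformly_continuous_on_def by meson
    define d' where "d' = d / real CARD('n)"
    have d': "0 < d'" using d by (simp add: d'_def)
    have osc: "f y \<le> f z + \<eta>" if "y \<in> cube x s" "z \<in> cube x s" "infnorm (y - z) < d'" for y z
    proof -
      have "norm (y - z) \<le> real CARD('n) * infnorm (y - z)" by (rule norm_le_card_infnorm)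
      also have "\<dots> < d" using that(3) by (simp add: d'_def field_simps)
      finally have "dist (f y) (f z) < \<eta>"
        using that closure_subset[of "cube x s"] by (intro d(2)) (auto simp: dist_norm)
      then show ?thesis by (simp add: dist_real_def)
    qed
    \<comment> \<open>The depth depends on the modulus of continuity of \<open>f\<close>, but the
      bound \<open>K\<close> does not depend on the depth.\<close>
    obtain k where "2 * s / d' < 2 ^ k" using real_arch_pow[of 2 "2 * s / d'"] by auto
    then have k: "2 * s / 2 ^ k \<le> d'" using d' by (simp add: field_simps)
    have "?f - \<eta> \<le> lower_mean f k x s"
      by (rule lower_mean_ge[OF f s order_refl osc k])
    also have "\<dots> \<le> K powr (1 / q)"
      using low[of k] K q by (subst powr_le_iff_root[symmetric]) auto
    finally show "?f \<le> K powr (1 / q) + \<eta>" by simp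
  qed
  moreover have "0 \<le> ?f"
    using s f by (auto simp: cube_avg_def set_lebesgue_integral_def intro!: divide_nonneg_nonneg integral_nonneg_AE)
  ultimately have "?f powr q \<le> K" using K q by (subst powr_le_iff_root) auto
  then show ?thesis using m by (simp add: K_def field_simps)
qed

end

text \<open>\<open>p0\<close> and \<open>B\<close> are obtained before \<open>w\<close> and
  \<open>q\<close>, which is how the dependence on dimension, \<open>p\<close> and \<open>A\<close>
  alone is secured.\<close>

lemma Ap_open_ended:
  fixes p A :: real
  assumes p: "1 < p" and A: "1 \<le> A"
  obtains p0 B where "1 < p0" "p0 < p" "1 \<le> B"
    "\<And>q. p0 \<le> q \<Longrightarrow> q \<le> p \<Longrightarrow> real CARD('n) * p * (p / q - 1) \<le> 1 / 2"
    "\<And>(w :: real^'n \<Rightarrow> real) q f x s. Ap_weight w p A \<Longrightarrow> p0 \<le> q \<Longrightarrow> q \<le> p \<Longrightarrow>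
      continuous_on UNIV f \<Longrightarrow> (\<And>y. 0 \<le> f y) \<Longrightarrow> 0 < s \<Longrightarrow>
      cube_avg lborel f x s powr q * cube_avg lborel w x s \<le>
        B * cube_avg (Ap_weight.M w) (\<lambda>y. f y powr q) x s"
proof -
  obtain eps0 C where eps0: "0 < eps0" and C: "1 \<le> C" and
    RH: "\<And>eps (t :: 'n set tree). 0 \<le> eps \<Longrightarrow> eps \<le> eps0 \<Longrightarrow> tree_Ap p A t \<Longrightarrow>
      tmean (\<lambda>x. (x powr (- 1 / (p - 1))) powr (1 + eps)) t \<le>
        C * tmean (\<lambda>x. x powr (- 1 / (p - 1))) t powr (1 + eps)"
    using tree_reverse_Holder[OF p A] by metis
  define N where "N = 2 * real CARD('n) * p"
  have N: "0 < N" using p by (simp add: N_def)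
  \<comment> \<open>For \<open>q \<ge> a\<close> the exponent \<open>(p - 1) / (q - 1)\<close> is at
    most \<open>1 + eps0\<close>; for \<open>q \<ge> b\<close> the quantity \<open>p / q - 1\<close>
    is at most \<open>1 / N\<close>.\<close>
  define a b where "a = 1 + (p - 1) / (1 + eps0)" and "b = p / (1 + 1 / N)"
  have a: "1 < a" "a < p"
  proof -
    have "(p - 1) / (1 + eps0) < p - 1" using p eps0 by (simp add: divide_less_eq mult.commute)
    then show "1 < a" "a < p" using p eps0 by (auto simp: a_def)
  qed
  have b: "b < p" using p N by (simp add: b_def field_simps)
  have pos: "0 < 1 + 1 / N" using N by (simp add: add_pos_pos)
  show thesis
  proof (rule that[of "max a b" "C powr (p - 1) * A"])
    show "1 \<le> C powr (p - 1) * A" using C A p mult_mono[of 1 "C powr (p - 1)" 1 A] by (simp add: ge_one_powr_ge_zero)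
    fix q assume q: "max a b \<le> q" "q \<le> p"
    then have q1: "1 < q" using a by simp
    have "p \<le> q * (1 + 1 / N)" using q pos by (simp add: b_def pos_divide_le_eq)
    then have "p / q - 1 \<le> 1 / N" using q1 by (simp add: field_simps)
    then have "(N / 2) * (p / q - 1) \<le> (N / 2) * (1 / N)" using N by (intro mult_left_mono) auto
    then show "real CARD('n) * p * (p / q - 1) \<le> 1 / 2"
      using N p by (simp add: N_def mult.commute)
    fix w f :: "real^'n \<Rightarrow> real" and x and s :: real
    assume w: "Ap_weight w p A" and f: "continuous_on UNIV f" "\<And>y. 0 \<le> f y" and s: "0 < s"
    interpret Ap_weight w p A by (rule w)
    define eps where "eps = (p - 1) / (q - 1) - 1"
    have "(p - 1) / (1 + eps0) \<le> q - 1" using q by (simp add: a_def)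
    then have "p - 1 \<le> (q - 1) * (1 + eps0)" using eps0 by (simp add: pos_divide_le_eq)
    then have "(p - 1) / (q - 1) \<le> 1 + eps0" using q1 by (simp add: pos_divide_le_eq mult.commute)
    then have eps: "0 \<le> eps" "eps \<le> eps0" using q q1 by (auto simp: eps_def)
    have e: "1 + eps = (p - 1) / (q - 1)" by (simp add: eps_def)
    have "cube_avg lborel f x s powr q * cube_avg lborel w x s \<le>
        (C powr (q - 1) * A) * cube_avg M (\<lambda>y. f y powr q) x s"
      using RH[OF eps, unfolded e] C q by (intro cube_avg_powr_le f s q1) auto
    \<comment> \<open>Since \<open>C \<ge> 1\<close>, raising the exponent from \<open>q - 1\<close>
      to \<open>p - 1\<close> removes the dependence on \<open>q\<close>.\<close>
    also have "\<dots> \<le> (C powr (p - 1) * A) * cube_avg M (\<lambda>y. f y powr q) x s"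
    proof (intro mult_right_mono powr_mono)
      show "0 \<le> cube_avg M (\<lambda>y. f y powr q) x s"
        using s by (auto simp: cube_avg_def set_lebesgue_integral_def intro!: divide_nonneg_nonneg integral_nonneg_AE)
    qed (use q C A in auto)
    finally show "cube_avg lborel f x s powr q * cube_avg lborel w x s \<le>
        (C powr (p - 1) * A) * cube_avg M (\<lambda>y. f y powr q) x s" .
  qed (use a b in auto)
qed

section \<open>Averages over cubes and bounded overlap\<close>

lemma infnorm_borel [measurable]: "(infnorm :: real^'n \<Rightarrow> real) \<in> borel_measurable borel"
  by (intro borel_measurable_continuous_onI continuous_intros)

text \<open>Normalised Lebesgue measure on the unit cube. Averages over variable cubes become
  integrals over one fixed probability space, so centre and radius occur only in the integrand; this
  gives continuity, measurability and Fubini.\<close>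

definition unit_cube :: "(real^'n) measure" where
  "unit_cube = density lborel (\<lambda>y. ennreal (indicator (cube 0 1) y / 2 ^ CARD('n)))"

lemma sets_unit_cube [simp, measurable_cong]: "sets (unit_cube :: (real^'n) measure) = sets borel"
  by (simp add: unit_cube_def)

lemma space_unit_cube [simp]: "space (unit_cube :: (real^'n) measure) = UNIV"
  by (simp add: unit_cube_def)

lemma prob_space_unit_cube: "prob_space (unit_cube :: (real^'n) measure)"
proof (rule prob_spaceI)
  have "emeasure (unit_cube :: (real^'n) measure) (space unit_cube) =
      (\<integral>\<^sup>+y. ennreal (1 / 2 ^ CARD('n)) * indicator (cube 0 1) (y::real^'n) \<partial>lborel)"
    unfolding unit_cube_def
    by (subst emeasure_density) (auto intro!: nn_integral_cong simp: indicator_def)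
  also have "\<dots> = ennreal (1 / 2 ^ CARD('n)) * ennreal (2 ^ CARD('n))"
    by (simp add: nn_integral_cmult_indicator emeasure_cube)
  also have "\<dots> = 1" by (simp flip: ennreal_mult)
  finally show "emeasure (unit_cube :: (real^'n) measure) (space unit_cube) = 1" .
qed

lemma AE_unit_cube: "AE y in (unit_cube :: (real^'n) measure). infnorm y < 1"
  unfolding unit_cube_def by (subst AE_density) (auto simp: mem_cube indicator_def)

lemma cube_avg_unit_cube:
  fixes f :: "real^'n \<Rightarrow> real"
  assumes t: "0 < t" and [measurable]: "f \<in> borel_measurable borel"
  shows "cube_avg lborel f c t = (\<integral>y. f (c + t *\<^sub>R y) \<partial>unit_cube)"
proof -
  have "(LINT z:cube c t|lborel. f z) =
      (\<integral>z. indicator (cube c t) z *\<^sub>R f z \<partial>density (distr lborel borel (\<lambda>y. c + t *\<^sub>R y)) (\<lambda>_. ennreal (\<bar>t\<bar>^DIM(real^'n))))"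
    unfolding set_lebesgue_integral_def using t by (subst lborel_affine[of t c]) auto
  also have "\<dots> = (\<integral>y. \<bar>t\<bar>^DIM(real^'n) *\<^sub>R (indicator (cube c t) (c + t *\<^sub>R y) *\<^sub>R f (c + t *\<^sub>R y)) \<partial>lborel)"
    by (subst integral_density) (auto simp: integral_distr)
  also have "\<dots> = (\<integral>y. t^CARD('n) * (indicator (cube 0 1) y * f (c + t *\<^sub>R y)) \<partial>lborel)"
    using t by (intro Bochner_Integration.integral_cong) (auto simp: mem_cube infnorm_mul indicator_def)
  finally have 1: "(LINT z:cube c t|lborel. f z) = t^CARD('n) * (\<integral>y. indicator (cube 0 1) y * f (c + t *\<^sub>R y) \<partial>lborel)"
    by simp
  have "(\<integral>y. f (c + t *\<^sub>R y) \<partial>unit_cube) = (\<integral>y. (indicator (cube 0 1) y / 2 ^ CARD('n)) *\<^sub>R f (c + t *\<^sub>R y) \<partial>lborel)"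
    unfolding unit_cube_def by (subst integral_density) auto
  also have "\<dots> = (\<integral>y. indicator (cube 0 1) y * f (c + t *\<^sub>R y) \<partial>lborel) / 2 ^ CARD('n)"
    by simp
  finally show ?thesis
    using t by (simp add: cube_avg_def 1 power_mult_distrib field_simps)
qed

text \<open>Jensen's inequality for the power \<open>p\<close>, obtained by integrating Young's
  inequality normalised at the mean.\<close>

lemma (in prob_space) expectation_powr_le:
  fixes X :: "'a \<Rightarrow> real"
  assumes p: "1 < p" and X: "integrable M X" "integrable M (\<lambda>x. X x powr p)" "\<And>x. 0 \<le> X x"
  shows "expectation X powr p \<le> expectation (\<lambda>x. X x powr p)"
proof (cases "expectation X = 0")
  case True
  then show ?thesis by simp
next
  case False
  define m where "m = expectation X"
  have "0 \<le> m" unfolding m_def using X by (intro integral_nonneg_AE) auto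
  then have m: "0 < m" using False by (simp add: m_def)
  have le: "X x \<le> m * ((X x / m) powr p / p + (1 - 1 / p))" for x
  proof (cases "X x = 0")
    case False
    then have "0 < X x" using X(3)[of x] by simp
    then have "((X x / m) powr p) powr (1 / p) * 1 powr (1 - 1 / p) \<le> (1 / p) * (X x / m) powr p + (1 - 1 / p) * 1"
      using p m by (intro Youngs_inequality_0) auto
    then have "X x / m \<le> (X x / m) powr p / p + (1 - 1 / p)"
      using p m \<open>0 < X x\<close> by (simp add: powr_powr)
    then show ?thesis using m by (simp add: pos_divide_le_eq mult.commute)
  qed (use m p in simp)
  have "m \<le> expectation (\<lambda>x. m * ((X x / m) powr p / p + (1 - 1 / p)))"
    unfolding m_def by (rule integral_mono) (use le X m in \<open>auto simp: powr_divide m_def[symmetric]\<close>)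
  also have "\<dots> = m * (expectation (\<lambda>x. X x powr p) / m powr p / p + (1 - 1 / p))"
    using X m by (simp add: powr_divide prob_space)
  finally have "1 \<le> expectation (\<lambda>x. X x powr p) / m powr p / p + (1 - 1 / p)"
    using m by (simp add: mult_le_cancel_left1)
  then have "1 \<le> expectation (\<lambda>x. X x powr p) / m powr p"
    using p by (simp add: field_simps)
  then show ?thesis using m by (simp add: m_def[symmetric] pos_le_divide_eq)
qed

context Ap_weight
begin

lemma sigma_finite_M: "sigma_finite_measure M"
proof
  let ?C = "range (\<lambda>n::nat. cube 0 (real n) :: (real^'n) set)"
  have "x \<in> \<Union> ?C" for x
  proof -
    obtain n :: nat where "infnorm x < real n" using reals_Archimedean2 by blast
    then show ?thesis by (auto simp: mem_cube)
  qed
  then show "\<exists>C. countable C \<and> C \<subseteq> sets M \<and> \<Union> C = space M \<and> (\<forall>a\<in>C. emeasure M a \<noteq> \<infinity>)"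
    using M_finite[OF cube_borel order_refl] by (intro exI[of _ ?C]) (auto simp: less_top[symmetric])
qed

lemma M_borel_nn_integral:
  assumes "(\<lambda>(x, y). f x y) \<in> borel_measurable (N \<Otimes>\<^sub>M M)"
  shows "(\<lambda>x. \<integral>\<^sup>+y. f x y \<partial>M) \<in> borel_measurable N"
  using sigma_finite_measure.borel_measurable_nn_integral[OF sigma_finite_M assms] .

text \<open>By Fubini, everything reduces to a fixed \<open>z\<close> and the integral of
  \<open>1 / measure M (cube (c x) (t x))\<close> over those \<open>x\<close> whose cube contains
  \<open>z\<close>. All these \<open>x\<close> and their cubes lie in
  \<open>cube z (\<rho> z)\<close>, whose radius is at most \<open>k * t x\<close>; by doubling the
  integrand is at most a constant over the mass of that cube, and its integral is at most that
  constant.\<close>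

lemma overlap:
  fixes c :: "real^'n \<Rightarrow> real^'n" and t :: "real^'n \<Rightarrow> real"
  assumes [measurable]: "c \<in> borel_measurable borel" "t \<in> borel_measurable borel"
      "E \<in> sets borel" "Q \<in> sets borel" "g \<in> borel_measurable borel"
    and t: "\<And>x. x \<in> E \<Longrightarrow> 0 < t x" and Q: "\<And>x. x \<in> E \<Longrightarrow> cube (c x) (t x) \<subseteq> Q"
    and k: "0 < k"
    and \<rho>: "\<And>x z. x \<in> E \<Longrightarrow> z \<in> cube (c x) (t x) \<Longrightarrow>
      x \<in> cube z (\<rho> z) \<and> cube (c x) (t x) \<subseteq> cube z (\<rho> z) \<and> \<rho> z \<le> k * t x"
  shows "(\<integral>\<^sup>+x\<in>E. (\<integral>\<^sup>+z\<in>cube (c x) (t x). g z \<partial>M) * ennreal (1 / measure M (cube (c x) (t x))) \<partial>M)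
    \<le> ennreal (A * k powr (CARD('n) * p)) * (\<integral>\<^sup>+z\<in>Q. g z \<partial>M)"
proof -
  interpret sigma_finite_measure M by (rule sigma_finite_M)
  interpret pair_sigma_finite M M ..
  \<comment> \<open>The set does not depend on \<open>v\<close>: it is everything or nothing. In
    this form joint measurability reduces to that of an inequality in \<open>x\<close> and
    \<open>z\<close>.\<close>
  define I :: "real^'n \<Rightarrow> real^'n \<Rightarrow> ennreal" where "I x z = indicator {v. infnorm (z - c x) < t x} x" for x z
  have I: "indicator (cube (c x) (t x)) z = I x z" for x z
    by (simp add: I_def indicator_def mem_cube)
  have I_meas [measurable]: "(\<lambda>(x, z). I x z) \<in> borel_measurable (M \<Otimes>\<^sub>M M)"
    unfolding I_def indicator_def by measurable
  define R where "R x = ennreal (1 / measure M (cube (c x) (t x)))" for x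
  \<comment> \<open>The mass of the cube attached to \<open>x\<close> is measurable in
    \<open>x\<close> because it is the integral of the jointly measurable \<open>I x z\<close> over
    \<open>z\<close>.\<close>
  have "(\<lambda>x. \<integral>\<^sup>+z. I x z \<partial>M) \<in> borel_measurable M"
    by (rule M_borel_nn_integral) measurable
  then have "(\<lambda>x. ennreal (1 / enn2real (\<integral>\<^sup>+z. I x z \<partial>M))) \<in> borel_measurable M" by measurable
  moreover have "(\<integral>\<^sup>+z. I x z \<partial>M) = emeasure M (cube (c x) (t x))" for x
    by (simp flip: I)
  ultimately have R_meas [measurable]: "R \<in> borel_measurable M"
    by (simp add: R_def[abs_def] measure_def)
  let ?D = "A * k powr (CARD('n) * p)"
  have inner: "(\<integral>\<^sup>+x. indicator E x * (I x z * R x) \<partial>M) \<le> ennreal ?D * indicator Q z" for z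
  proof (cases "\<exists>x\<in>E. z \<in> cube (c x) (t x)")
    case True
    then obtain x1 where x1: "x1 \<in> E" "z \<in> cube (c x1) (t x1)" by blast
    then have zQ: "z \<in> Q" using Q by auto
    have "x1 \<in> cube z (\<rho> z)" using \<rho>[OF x1] by simp
    then have rpos: "0 < \<rho> z" using infnorm_pos_le[of "x1 - z"] by (simp add: mem_cube)
    let ?m = "measure M (cube z (\<rho> z))"
    have m: "0 < ?m" using rpos by (rule M_cube_pos)
    have "indicator E x * (I x z * R x) \<le> ennreal (?D / ?m) * indicator (cube z (\<rho> z)) x" for x
    proof (cases "x \<in> E \<and> z \<in> cube (c x) (t x)")
      case True
      then have x: "x \<in> cube z (\<rho> z)" "cube (c x) (t x) \<subseteq> cube z (\<rho> z)" "\<rho> z \<le> k * t x" "0 < t x"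
        using \<rho> t by auto
      let ?mx = "measure M (cube (c x) (t x))"
      have mx: "0 < ?mx" using x by (intro M_cube_pos)
      have "(1 / k) powr (CARD('n) * p) \<le> (t x / \<rho> z) powr (CARD('n) * p)"
        using x k rpos p by (intro powr_mono2) (auto simp: field_simps)
      then have "?m * (1 / k) powr (CARD('n) * p) \<le> A * ?mx"
        using doubling[OF x(2) x(4) rpos] m by (meson mult_left_mono order_trans measure_nonneg)
      then have "1 / ?mx \<le> ?D / ?m"
        using m mx k by (simp add: powr_divide field_simps)
      then show ?thesis using True x by (auto simp: I[symmetric] R_def intro: ennreal_leI)
    next
      case False
      then show ?thesis by (auto simp: I[symmetric] indicator_def)
    qed
    then have "(\<integral>\<^sup>+x. indicator E x * (I x z * R x) \<partial>M) \<le> (\<integral>\<^sup>+x. ennreal (?D / ?m) * indicator (cube z (\<rho> z)) x \<partial>M)"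
      by (intro nn_integral_mono) auto
    also have "\<dots> = ennreal (?D / ?m) * emeasure M (cube z (\<rho> z))"
      by (simp add: nn_integral_cmult_indicator)
    also have "emeasure M (cube z (\<rho> z)) = ennreal ?m"
      using M_finite[OF cube_borel order_refl, of z "\<rho> z"] by (intro emeasure_eq_ennreal_measure) auto
    also have "ennreal (?D / ?m) * ennreal ?m = ennreal ?D"
      using m A k by (simp flip: ennreal_mult)
    finally show ?thesis using zQ by simp
  next
    case False
    then have "(\<integral>\<^sup>+x. indicator E x * (I x z * R x) \<partial>M) = (\<integral>\<^sup>+x. 0 \<partial>M)"
      by (intro nn_integral_cong) (auto simp: I[symmetric] indicator_def)
    then show ?thesis by simp
  qed
  have "(\<integral>\<^sup>+x\<in>E. (\<integral>\<^sup>+z\<in>cube (c x) (t x). g z \<partial>M) * R x \<partial>M) =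
      (\<integral>\<^sup>+x. \<integral>\<^sup>+z. g z * (indicator E x * (I x z * R x)) \<partial>M \<partial>M)"
  proof (intro nn_integral_cong)
    fix x
    have "(\<integral>\<^sup>+z. g z * (indicator E x * (I x z * R x)) \<partial>M) = (\<integral>\<^sup>+z. (R x * indicator E x) * (g z * I x z) \<partial>M)"
      by (intro nn_integral_cong) (simp add: mult_ac)
    also have "\<dots> = (R x * indicator E x) * (\<integral>\<^sup>+z. g z * I x z \<partial>M)"
      by (intro nn_integral_cmult) measurable
    finally show "(\<integral>\<^sup>+z\<in>cube (c x) (t x). g z \<partial>M) * R x * indicator E x =
       (\<integral>\<^sup>+z. g z * (indicator E x * (I x z * R x)) \<partial>M)"
      by (simp add: I mult_ac)
  qed
  also have "\<dots> = (\<integral>\<^sup>+z. \<integral>\<^sup>+x. g z * (indicator E x * (I x z * R x)) \<partial>M \<partial>M)"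
    by (rule Fubini'[symmetric]) measurable
  also have "\<dots> = (\<integral>\<^sup>+z. g z * (\<integral>\<^sup>+x. indicator E x * (I x z * R x) \<partial>M) \<partial>M)"
    by (intro nn_integral_cong nn_integral_cmult) measurable
  also have "\<dots> \<le> (\<integral>\<^sup>+z. g z * (ennreal ?D * indicator Q z) \<partial>M)"
    by (intro nn_integral_mono mult_left_mono inner) auto
  also have "\<dots> = ennreal ?D * (\<integral>\<^sup>+z\<in>Q. g z \<partial>M)"
    by (subst nn_integral_cmult[symmetric]) (auto simp: mult_ac)
  finally show ?thesis by (simp add: R_def)
qed

end

section \<open>Weighted Poincare inequality\<close>

text \<open>Unlike \<open>cube_avg\<close>, this makes sense for \<open>t = 0\<close>, where it is
  the value at the centre; the extension relies on this inside the cube.\<close>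

definition cube_mean :: "(real^'a \<Rightarrow> real) \<Rightarrow> real^'a \<Rightarrow> real \<Rightarrow> real" where
  "cube_mean f c t = (\<integral>y. f (c + t *\<^sub>R y) \<partial>unit_cube)"

lemma cube_mean_nonneg: "(\<And>y. 0 \<le> f y) \<Longrightarrow> 0 \<le> cube_mean f c t"
  by (auto simp: cube_mean_def intro!: integral_nonneg_AE)

lemma cube_mean_0: "cube_mean f c 0 = f c"
proof -
  interpret V: prob_space "unit_cube :: (real^'a) measure" by (rule prob_space_unit_cube)
  show ?thesis using V.prob_space by (simp add: cube_mean_def)
qed

text \<open>\<open>B\<close> comes from \<open>Ap_open_ended\<close> and is shared by all weights
  with bound \<open>A\<close> and all admissible \<open>q\<close>. Constants defined below from the
  dimension, \<open>p\<close>, \<open>A\<close> and \<open>B\<close> therefore do not depend on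
  \<open>w\<close> or \<open>q\<close>.\<close>

locale Aq_weight = Ap_weight +
  fixes q B :: real
  assumes q: "1 < q" "q \<le> p" and B: "1 \<le> B"
    and exponent_gap: "real CARD('a) * p * (p / q - 1) \<le> 1 / 2"
    and Aq: "\<And>f x s. continuous_on UNIV f \<Longrightarrow> (\<And>y. 0 \<le> f y) \<Longrightarrow> 0 < s \<Longrightarrow>
      cube_avg lborel f x s powr q * cube_avg lborel w x s \<le> B * cube_avg M (\<lambda>y. f y powr q) x s"
begin

lemma set_integrable_powr:
  assumes "continuous_on UNIV f" "\<And>y. 0 \<le> f y"
  shows "set_integrable M (cube x s) (\<lambda>y. f y powr q)"
proof (rule set_integrable_bounded_continuous)
  show "continuous_on UNIV (\<lambda>y. f y powr q)" using assms q by (intro continuous_on_powr') auto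
  show "emeasure M (cube x s) < \<infinity>" by (rule M_finite) auto
qed auto

lemma cube_mean_powr_le:
  assumes f: "continuous_on UNIV f" "\<And>y. 0 \<le> f y" and t: "0 < t"
  shows "cube_mean f c t powr q \<le> B * ((LINT z:cube c t|M. f z powr q) / measure M (cube c t))"
proof -
  define Q where "Q = (2 * t) ^ CARD('a)"
  have Q: "0 < Q" using t by (simp add: Q_def)
  have m: "0 < measure M (cube c t)" using t by (rule M_cube_pos)
  have "f \<in> borel_measurable borel" using f(1) by (rule borel_measurable_continuous_onI)
  then have "cube_avg lborel f c t = cube_mean f c t" using t by (simp add: cube_avg_unit_cube cube_mean_def)
  then have "cube_mean f c t powr q * (measure M (cube c t) / Q) \<le> B * ((LINT z:cube c t|M. f z powr q) / Q)"
    using Aq[OF f t, of c] by (simp add: cube_avg_def measure_M[of _ c t] Q_def)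
  then show ?thesis using m Q by (simp add: field_simps)
qed

lemma nn_integral_powr:
  assumes "continuous_on UNIV f" "\<And>y. 0 \<le> f y"
  shows "(\<integral>\<^sup>+z\<in>cube x s. ennreal (f z powr q) \<partial>M) = ennreal (LINT z:cube x s|M. f z powr q)"
proof -
  have "(\<integral>\<^sup>+z. ennreal (indicator (cube x s) z *\<^sub>R f z powr q) \<partial>M) = ennreal (LINT z:cube x s|M. f z powr q)"
    unfolding set_lebesgue_integral_def
    using set_integrable_powr[OF assms] by (intro nn_integral_eq_integral) (auto simp: set_integrable_def)
  moreover have "(\<integral>\<^sup>+z. ennreal (indicator (cube x s) z *\<^sub>R f z powr q) \<partial>M) = (\<integral>\<^sup>+z\<in>cube x s. ennreal (f z powr q) \<partial>M)"
    by (intro nn_integral_cong) (simp add: indicator_def)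
  ultimately show ?thesis by simp
qed

text \<open>The assumption \<open>exponent_gap\<close> makes the singularity at \<open>s = 0\<close> integrable.\<close>

lemma radial_average_bound:
  fixes f :: "real^'a \<Rightarrow> real" and x0 :: "real^'a"
  assumes f: "continuous_on UNIV f" "\<And>y. 0 \<le> f y" and r: "0 < r" and s: "0 < s" "s \<le> 1"
  defines "m \<equiv> measure M (cube x0 r)" and "I \<equiv> LINT z:cube x0 r|M. f z powr q"
  shows "(\<integral>\<^sup>+x\<in>cube x0 r. ennreal (cube_mean f ((1 - s) *\<^sub>R x + s *\<^sub>R x0) (s * r / 2) powr p) \<partial>M)
    \<le> ennreal (B powr p * A * 2 * (A * 4 powr (CARD('a) * p)) * m * (I / m) powr (p / q)) * ennreal (s powr (- 1 / 2))"
proof -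
  let ?c = "\<lambda>x. (1 - s) *\<^sub>R x + s *\<^sub>R x0" and ?t = "s * r / 2" and ?Q = "cube x0 r"
  let ?J = "\<lambda>x. LINT z:cube (?c x) ?t|M. f z powr q" and ?mx = "\<lambda>x. measure M (cube (?c x) ?t)"
  define \<theta> where "\<theta> = p / q - 1"
  have th: "0 \<le> \<theta>" "CARD('a) * p * \<theta> \<le> 1 / 2" using q exponent_gap by (auto simp: \<theta>_def)
  have "1 * \<theta> \<le> (CARD('a) * p) * \<theta>" using p th mult_mono[of 1 "real CARD('a)" 1 p]
    by (intro mult_right_mono) (auto simp: Suc_leI)
  then have th1: "\<theta> \<le> 1" using th by simp
  have m: "0 < m" using r by (simp add: m_def M_cube_pos)
  have t: "0 < ?t" using r s by simp
  have I0: "0 \<le> I" unfolding I_def set_lebesgue_integral_def by (intro integral_nonneg_AE) auto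
  have sub: "cube (?c x) ?t \<subseteq> ?Q" if "x \<in> ?Q" for x
  proof (rule cube_subset)
    have "?c x - x0 = (1 - s) *\<^sub>R (x - x0)" by (simp add: algebra_simps)
    then have "infnorm (?c x - x0) = (1 - s) * infnorm (x - x0)" using s by (simp add: infnorm_mul)
    also have "\<dots> \<le> (1 - s) * r" using that s by (intro mult_left_mono) (auto simp: mem_cube)
    finally have "infnorm (?c x - x0) \<le> r - s * r" by (simp add: algebra_simps)
    moreover have "0 < s * r" using r s by simp
    ultimately show "infnorm (?c x - x0) + ?t \<le> r" by linarith
  qed
  define K where "K = B powr (p / q) * ((I / m) powr \<theta> * (A * 2 * s powr (- 1 / 2)))"
  have K: "0 \<le> K" using B A by (simp add: K_def)
  \<comment> \<open>The power \<open>p / q\<close> is split as \<open>\<theta> + 1\<close>. In the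
    factor with exponent \<theta> the local mean is replaced by the global one, at the price of a
    doubling factor and hence of a power of \<open>s\<close>; the remaining factor is linear and is
    left to \<open>overlap\<close>.\<close>
  have pw: "cube_mean f (?c x) ?t powr p \<le> K * (?J x / ?mx x)" if x: "x \<in> ?Q" for x
  proof -
    have mx: "0 < ?mx x" using t by (rule M_cube_pos)
    have J0: "0 \<le> ?J x" unfolding set_lebesgue_integral_def by (intro integral_nonneg_AE) auto
    have JI: "?J x \<le> I" unfolding I_def
      by (rule set_integral_mono_subset[OF set_integrable_powr[OF f] sub[OF x]]) auto
    have "m * (s / 2) powr (CARD('a) * p) \<le> A * ?mx x"
      using doubling[OF sub[OF x] t r] r by (simp add: m_def)
    then have dm: "1 / ?mx x \<le> A * (2 / s) powr (CARD('a) * p) / m"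
      using m mx s by (simp add: powr_divide field_simps)
    have "cube_mean f (?c x) ?t powr p = (cube_mean f (?c x) ?t powr q) powr (p / q)"
      using q by (simp add: powr_powr)
    also have "\<dots> \<le> (B * (?J x / ?mx x)) powr (p / q)"
      using cube_mean_powr_le[OF f t] p q by (intro powr_mono2) auto
    also have "\<dots> = B powr (p / q) * ((?J x / ?mx x) powr \<theta> * (?J x / ?mx x))"
      using B J0 mx powr_mult_base[of "?J x / ?mx x" \<theta>] by (subst powr_mult) (auto simp: \<theta>_def mult_ac)
    finally have 1: "cube_mean f (?c x) ?t powr p \<le> B powr (p / q) * ((?J x / ?mx x) powr \<theta> * (?J x / ?mx x))" .
    have "(?J x / ?mx x) powr \<theta> \<le> (I / m * (A * (2 / s) powr (CARD('a) * p))) powr \<theta>"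
    proof (rule powr_mono2)
      have "?J x * (1 / ?mx x) \<le> I * (A * (2 / s) powr (CARD('a) * p) / m)"
        using JI dm I0 mx J0 by (intro mult_mono) auto
      then show "?J x / ?mx x \<le> I / m * (A * (2 / s) powr (CARD('a) * p))" by simp
    qed (use th J0 in auto)
    also have "\<dots> = (I / m) powr \<theta> * (A powr \<theta> * (2 / s) powr (CARD('a) * p * \<theta>))"
      using I0 m A s by (simp add: powr_mult powr_powr del: times_divide_eq_left)
    finally have 2: "(?J x / ?mx x) powr \<theta> \<le> (I / m) powr \<theta> * (A powr \<theta> * (2 / s) powr (CARD('a) * p * \<theta>))" .
    have "A powr \<theta> * (2 / s) powr (CARD('a) * p * \<theta>) \<le> A powr 1 * (2 / s) powr (1 / 2)"
      using A th th1 s by (intro mult_mono powr_mono) auto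
    also have "\<dots> = A * (2 powr (1 / 2) * s powr (- 1 / 2))"
      using A s by (simp add: powr_divide powr_minus field_simps)
    also have "\<dots> \<le> A * (2 * s powr (- 1 / 2))"
      using A powr_mono[of "1/2" 1 "2::real"] by (intro mult_left_mono mult_right_mono) auto
    finally have "(I / m) powr \<theta> * (A powr \<theta> * (2 / s) powr (CARD('a) * p * \<theta>)) \<le> (I / m) powr \<theta> * (A * (2 * s powr (- 1 / 2)))"
      by (rule mult_left_mono) simp
    with 2 have "(?J x / ?mx x) powr \<theta> \<le> (I / m) powr \<theta> * (A * (2 * s powr (- 1 / 2)))" by (rule order_trans)
    then have "B powr (p / q) * ((?J x / ?mx x) powr \<theta> * (?J x / ?mx x)) \<le>
        B powr (p / q) * ((I / m) powr \<theta> * (A * (2 * s powr (- 1 / 2))) * (?J x / ?mx x))"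
      using J0 mx by (intro mult_left_mono mult_right_mono) auto
    with 1 show ?thesis by (simp add: K_def mult_ac)
  qed
  have [measurable]: "f \<in> borel_measurable borel" using f(1) by (rule borel_measurable_continuous_onI)
  have gint: "(\<integral>\<^sup>+z\<in>cube y t'. (ennreal K * ennreal (f z powr q)) \<partial>M) =
      ennreal K * ennreal (LINT z:cube y t'|M. f z powr q)" for y t'
    unfolding mult.assoc
    by (subst nn_integral_cmult) (auto simp: nn_integral_powr[OF f])
  have "(\<integral>\<^sup>+x\<in>?Q. ennreal (cube_mean f (?c x) ?t powr p) \<partial>M) \<le>
      (\<integral>\<^sup>+x\<in>?Q. (\<integral>\<^sup>+z\<in>cube (?c x) ?t. (ennreal K * ennreal (f z powr q)) \<partial>M) * ennreal (1 / ?mx x) \<partial>M)"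
  proof (intro nn_integral_mono)
    fix x
    show "ennreal (cube_mean f (?c x) ?t powr p) * indicator ?Q x \<le>
      (\<integral>\<^sup>+z\<in>cube (?c x) ?t. (ennreal K * ennreal (f z powr q)) \<partial>M) * ennreal (1 / ?mx x) * indicator ?Q x"
    proof (cases "x \<in> ?Q")
      case True
      have "0 \<le> ?J x" unfolding set_lebesgue_integral_def by (intro integral_nonneg_AE) auto
      then show ?thesis unfolding gint using pw[OF True] True K
        by (simp add: ennreal_mult[symmetric] ennreal_leI)
    qed simp
  qed
  \<comment> \<open>With \<open>\<rho> = 2 * s * r\<close>: the centre is within
    \<open>s * r\<close> of \<open>x\<close> and within \<open>s * r / 2\<close> of
    \<open>z\<close>, and \<rho> is 4 times the radius \<open>s * r / 2\<close>.\<close>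
  also have "\<dots> \<le> ennreal (A * 4 powr (CARD('a) * p)) * (\<integral>\<^sup>+z\<in>?Q. (ennreal K * ennreal (f z powr q)) \<partial>M)"
  proof (intro overlap)
    show "(\<lambda>z. ennreal K * ennreal (f z powr q)) \<in> borel_measurable borel" by measurable
    fix x z assume x: "x \<in> ?Q" and z: "z \<in> cube (?c x) ?t"
    have "?c x - x = s *\<^sub>R (x0 - x)" by (simp add: algebra_simps)
    then have "infnorm (?c x - x) \<le> s * r" using s x by (simp add: infnorm_mul mem_cube infnorm_sub)
    moreover have zc: "infnorm (?c x - z) < ?t" using z by (simp add: mem_cube infnorm_sub)
    moreover have "infnorm (x - z) \<le> infnorm (x - ?c x) + infnorm (?c x - z)"
      using infnorm_triangle[of "x - ?c x" "?c x - z"] by simp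
    ultimately have "infnorm (x - z) < 2 * s * r" using infnorm_sub[of x "?c x"] t by linarith
    moreover have "cube (?c x) ?t \<subseteq> cube z (2 * s * r)"
    proof (rule cube_subset)
      have "2 * s * r = 4 * ?t" by simp
      then show "infnorm (?c x - z) + ?t \<le> 2 * s * r" using zc t by linarith
    qed
    ultimately show "x \<in> cube z (2 * s * r) \<and> cube (?c x) ?t \<subseteq> cube z (2 * s * r) \<and> 2 * s * r \<le> 4 * ?t"
      by (simp add: mem_cube)
  qed (use t sub in auto)
  also have "\<dots> = ennreal (K * ((A * 4 powr (CARD('a) * p)) * I))"
    unfolding gint using A I0 K by (simp add: ennreal_mult[symmetric] mult_ac flip: I_def)
  also have "\<dots> \<le> ennreal ((B powr p * A * 2 * (A * 4 powr (CARD('a) * p)) * m * (I / m) powr (p / q)) * s powr (- 1 / 2))"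
  proof (rule ennreal_leI)
    have "(I / m) powr \<theta> * I = m * (I / m) powr (p / q)"
    proof -
      have "I / m * (I / m) powr \<theta> = (I / m) powr (1 + \<theta>)" using I0 m by (intro powr_mult_base) auto
      moreover have "1 + \<theta> = p / q" by (simp add: \<theta>_def)
      ultimately have "m * (I / m * (I / m) powr \<theta>) = m * (I / m) powr (p / q)" by simp
      then show ?thesis using m by (simp add: mult.commute)
    qed
    then have "K * ((A * 4 powr (CARD('a) * p)) * I) =
        B powr (p / q) * (A * 2 * (A * 4 powr (CARD('a) * p)) * (m * (I / m) powr (p / q)) * s powr (- 1 / 2))"
      by (simp add: K_def algebra_simps)
    also have "\<dots> \<le> B powr p * (A * 2 * (A * 4 powr (CARD('a) * p)) * (m * (I / m) powr (p / q)) * s powr (- 1 / 2))"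
      using B A m p q by (intro mult_right_mono powr_mono) (auto simp: divide_le_eq)
    finally show "K * ((A * 4 powr (CARD('a) * p)) * I) \<le>
        (B powr p * A * 2 * (A * 4 powr (CARD('a) * p)) * m * (I / m) powr (p / q)) * s powr (- 1 / 2)"
      by (simp add: mult_ac)
  qed
  also have "\<dots> = ennreal (B powr p * A * 2 * (A * 4 powr (CARD('a) * p)) * m * (I / m) powr (p / q)) * ennreal (s powr (- 1 / 2))"
    using B A m by (intro ennreal_mult) auto
  finally show ?thesis .
qed

text \<open>The mean \<open>a\<close> is an average of \<open>u\<close> over points
  \<open>x0 + (r / 2) *\<^sub>R y\<close>. On the segment from \<open>x\<close> to such a point, the
  point at time \<open>s\<close> is \<open>(1 - s) *\<^sub>R x + s *\<^sub>R x0 + (s * r / 2)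
  *\<^sub>R y\<close>, so averaging over \<open>y\<close> first produces the means over the
  shrinking cubes. Jensen's inequality in \<open>s\<close> and \<open>radial_average_bound\<close>
  finish.\<close>

lemma poincare:
  fixes u f :: "real^'a \<Rightarrow> real" and x0 :: "real^'a"
  assumes f: "continuous_on UNIV f" "\<And>y. 0 \<le> f y" "\<And>y. f y \<le> bf"
    and u: "continuous_on UNIV u" "\<And>y. \<bar>u y\<bar> \<le> bu" and r: "0 < r"
    and grad: "\<And>x y. infnorm (x - x0) \<le> r \<Longrightarrow> infnorm (y - x0) \<le> r \<Longrightarrow>
      \<bar>u x - u y\<bar> \<le> norm (x - y) * (\<integral>s. f ((1 - s) *\<^sub>R x + s *\<^sub>R y) \<partial>uniform_measure lborel {0..1})"
  defines "m \<equiv> measure M (cube x0 r)" and "I \<equiv> LINT z:cube x0 r|M. f z powr q"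
    and "a \<equiv> cube_mean u x0 (r / 2)"
  shows "(\<integral>\<^sup>+x\<in>cube x0 r. ennreal (\<bar>u x - a\<bar> powr p) \<partial>M)
    \<le> ennreal ((2 * CARD('a)) powr p * (B powr p * A * 4 * (A * 4 powr (CARD('a) * p))) * r powr p * m * (I / m) powr (p / q))"
proof -
  define U where "U = uniform_measure lborel {0..1::real}"
  have Usets [simp, measurable_cong]: "sets U = sets borel" by (simp add: U_def)
  have space_U: "space U = UNIV" by (simp add: U_def)
  interpret U: prob_space U unfolding U_def by (rule prob_space_uniform_measure) auto
  interpret V: prob_space "unit_cube :: (real^'a) measure" by (rule prob_space_unit_cube)
  have V_1: "measure (unit_cube :: (real^'a) measure) UNIV = 1" using V.prob_space by simp
  interpret UV: pair_sigma_finite U "unit_cube :: (real^'a) measure" ..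
  interpret sM: sigma_finite_measure M by (rule sigma_finite_M)
  interpret UM: pair_sigma_finite U M ..
  have [measurable]: "f \<in> borel_measurable borel" "u \<in> borel_measurable borel"
    using f u by (auto intro: borel_measurable_continuous_onI)
  let ?c = "\<lambda>x s. (1 - s) *\<^sub>R x + s *\<^sub>R x0"
  define g where "g x s = cube_mean f (?c x s) (s * r / 2)" for x s
  have bf: "0 \<le> bf" using f(2)[of 0] f(3)[of 0] by linarith
  have g01: "0 \<le> g x s" "g x s \<le> bf" for x s
  proof -
    show "0 \<le> g x s" unfolding g_def by (rule cube_mean_nonneg) (rule f)
    have "g x s \<le> (\<integral>y. bf \<partial>(unit_cube :: (real^'a) measure))"
      unfolding g_def cube_mean_def
      by (intro integral_mono V.integrable_const_bound[of _ bf]) (use f bf in auto)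
    then show "g x s \<le> bf" using V.prob_space by simp
  qed
  have g_meas [measurable]: "(\<lambda>(x, s). g x s) \<in> borel_measurable (M \<Otimes>\<^sub>M U)"
    unfolding g_def cube_mean_def split_beta
    by (rule V.borel_measurable_lebesgue_integral) (simp add: split_beta)
  \<comment> \<open>An upper bound for the distance of two points of the closed cube: their
    \<open>infnorm\<close> distance is at most \<open>2 * r\<close>.\<close>
  define l where "l = 2 * real CARD('a) * r"
  have l: "0 < l" using r by (simp add: l_def)
  have AE_U: "AE s in U. 0 < s \<and> s \<le> 1"
    unfolding U_def
  proof (rule AE_uniform_measureI)
    have "AE s in lborel. s \<noteq> (0::real)" by (rule AE_lborel_singleton)
    then show "AE s in lborel. s \<in> {0..1} \<longrightarrow> 0 < s \<and> s \<le> (1::real)" by eventually_elim auto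
  qed auto
  have dev: "\<bar>u x - a\<bar> \<le> l * (\<integral>s. g x s \<partial>U)" if x: "x \<in> cube x0 r" for x
  proof -
    let ?y = "\<lambda>y. x0 + (r / 2) *\<^sub>R y"
    let ?h = "\<lambda>y s. f ((1 - s) *\<^sub>R x + s *\<^sub>R ?y y)"
    have iu: "integrable unit_cube (\<lambda>y. u (?y y))"
      by (rule V.integrable_const_bound[of _ bu]) (use u in auto)
    have hU: "(\<lambda>y. \<integral>s. ?h y s \<partial>U) \<in> borel_measurable unit_cube"
      by (rule U.borel_measurable_lebesgue_integral) (simp add: split_beta)
    have hb: "\<bar>\<integral>s. ?h y s \<partial>U\<bar> \<le> bf" for y
    proof -
      have "(\<integral>s. ?h y s \<partial>U) \<le> (\<integral>s. bf \<partial>U)"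
        by (intro integral_mono U.integrable_const_bound[of _ bf]) (use f bf in auto)
      moreover have "0 \<le> (\<integral>s. ?h y s \<partial>U)" using f by (intro integral_nonneg_AE) auto
      ultimately show ?thesis using U.prob_space by (simp add: space_U)
    qed
    have "u x - a = (\<integral>y. u x - u (?y y) \<partial>unit_cube)"
      using iu by (simp add: a_def cube_mean_def V_1)
    also have "\<bar>\<dots>\<bar> \<le> (\<integral>y. \<bar>u x - u (?y y)\<bar> \<partial>unit_cube)"
      by (rule integral_abs_bound)
    also have "\<dots> \<le> (\<integral>y. l * (\<integral>s. ?h y s \<partial>U) \<partial>unit_cube)"
    proof (rule integral_mono_AE)
      show "integrable unit_cube (\<lambda>y. \<bar>u x - u (?y y)\<bar>)" using iu by auto
      show "integrable unit_cube (\<lambda>y. l * (\<integral>s. ?h y s \<partial>U))"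
        by (intro integrable_mult_right V.integrable_const_bound[of _ bf]) (use hb hU in auto)
      show "AE y in unit_cube. \<bar>u x - u (?y y)\<bar> \<le> l * (\<integral>s. ?h y s \<partial>U)"
        using AE_unit_cube
      proof eventually_elim
        fix y :: "real^'a" assume y: "infnorm y < 1"
        have yi: "infnorm (?y y - x0) \<le> r / 2" using y r by (simp add: infnorm_mul)
        have xi: "infnorm (x - x0) \<le> r" using x by (simp add: mem_cube)
        have "norm (x - ?y y) \<le> real CARD('a) * infnorm (x - ?y y)" by (rule norm_le_card_infnorm)
        also have "\<dots> \<le> real CARD('a) * (2 * r)"
        proof (rule mult_left_mono)
          have "infnorm (x - ?y y) \<le> infnorm (x - x0) + infnorm (x0 - ?y y)"
            using infnorm_triangle[of "x - x0" "x0 - ?y y"] by (simp add: diff_diff_eq)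
          then show "infnorm (x - ?y y) \<le> 2 * r" using xi yi r infnorm_sub[of x0 "?y y"] by linarith
        qed simp
        finally have n: "norm (x - ?y y) \<le> l" by (simp add: l_def)
        have "\<bar>u x - u (?y y)\<bar> \<le> norm (x - ?y y) * (\<integral>s. ?h y s \<partial>U)"
          unfolding U_def using xi yi r by (intro grad) auto
        also have "\<dots> \<le> l * (\<integral>s. ?h y s \<partial>U)"
          using n f by (intro mult_right_mono integral_nonneg_AE) auto
        finally show "\<bar>u x - u (?y y)\<bar> \<le> l * (\<integral>s. ?h y s \<partial>U)" .
      qed
    qed
    also have "\<dots> = l * (\<integral>y. \<integral>s. ?h y s \<partial>U \<partial>unit_cube)" by simp
    also have "(\<integral>y. \<integral>s. ?h y s \<partial>U \<partial>unit_cube) = (\<integral>s. \<integral>y. ?h y s \<partial>unit_cube \<partial>U)"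
    proof (rule UV.Fubini_integral)
      interpret UV': pair_prob_space U "unit_cube :: (real^'a) measure" ..
      show "integrable (U \<Otimes>\<^sub>M unit_cube) (\<lambda>(s, y). ?h y s)"
        by (rule UV'.P.integrable_const_bound[of _ bf]) (use f bf in \<open>auto simp: split_beta\<close>)
    qed
    also have "\<dots> = (\<integral>s. g x s \<partial>U)"
      unfolding g_def cube_mean_def by (intro Bochner_Integration.integral_cong refl arg_cong[where f=f]) (simp add: algebra_simps)
    finally show ?thesis .
  qed
  have gi: "integrable U (g x)" "integrable U (\<lambda>s. g x s powr p)" for x
  proof -
    have [measurable]: "g x \<in> borel_measurable U"
      unfolding g_def[abs_def] cube_mean_def
      by (rule V.borel_measurable_lebesgue_integral) (simp add: split_beta)
    show "integrable U (g x)" by (rule U.integrable_const_bound[of _ bf]) (use g01 in auto)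
    show "integrable U (\<lambda>s. g x s powr p)"
      by (rule U.integrable_const_bound[of _ "bf powr p"]) (use g01 p in \<open>auto intro!: powr_mono2\<close>)
  qed
  have pw: "\<bar>u x - a\<bar> powr p \<le> l powr p * (\<integral>s. g x s powr p \<partial>U)" if "x \<in> cube x0 r" for x
  proof -
    have g0: "0 \<le> (\<integral>s. g x s \<partial>U)" using g01 by (intro integral_nonneg_AE) auto
    have "\<bar>u x - a\<bar> powr p \<le> (l * (\<integral>s. g x s \<partial>U)) powr p"
      using dev[OF that] p by (intro powr_mono2) auto
    also have "\<dots> = l powr p * (\<integral>s. g x s \<partial>U) powr p" using l g0 by (simp add: powr_mult)
    also have "\<dots> \<le> l powr p * (\<integral>s. g x s powr p \<partial>U)"
      using U.expectation_powr_le[OF p gi] g01 by (intro mult_left_mono) auto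
    finally show ?thesis .
  qed
  define C where "C = B powr p * A * 2 * (A * 4 powr (CARD('a) * p)) * m * (I / m) powr (p / q)"
  have C: "0 \<le> C" using A by (simp add: C_def m_def)
  have "(\<integral>\<^sup>+x\<in>cube x0 r. ennreal (\<bar>u x - a\<bar> powr p) \<partial>M) \<le>
      (\<integral>\<^sup>+x. \<integral>\<^sup>+s. ennreal (l powr p) * (ennreal (g x s powr p) * indicator (cube x0 r) x) \<partial>U \<partial>M)"
  proof (intro nn_integral_mono)
    fix x
    have [measurable]: "g x \<in> borel_measurable U" using gi(1) by auto
    show "ennreal (\<bar>u x - a\<bar> powr p) * indicator (cube x0 r) x \<le>
      (\<integral>\<^sup>+s. ennreal (l powr p) * (ennreal (g x s powr p) * indicator (cube x0 r) x) \<partial>U)"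
    proof (cases "x \<in> cube x0 r")
      case True
      have "(\<integral>\<^sup>+s. ennreal (l powr p) * (ennreal (g x s powr p) * indicator (cube x0 r) x) \<partial>U)
        = ennreal (l powr p) * (\<integral>\<^sup>+s. ennreal (g x s powr p) \<partial>U)"
        using True by (simp add: nn_integral_cmult)
      also have "\<dots> = ennreal (l powr p * (\<integral>s. g x s powr p \<partial>U))"
        using gi(2) by (subst nn_integral_eq_integral) (auto simp: ennreal_mult)
      finally show ?thesis using pw[OF True] True by (simp add: ennreal_leI)
    qed simp
  qed
  also have "\<dots> = (\<integral>\<^sup>+s. \<integral>\<^sup>+x. ennreal (l powr p) * (ennreal (g x s powr p) * indicator (cube x0 r) x) \<partial>M \<partial>U)"
  proof (rule UM.Fubini')
    have "(\<lambda>z. g (snd z) (fst z)) \<in> borel_measurable (U \<Otimes>\<^sub>M M)"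
      using measurable_compose[OF measurable_pair_swap' g_meas] by (simp add: split_beta)
    then show "(\<lambda>(s, x). ennreal (l powr p) * (ennreal (g x s powr p) * indicator (cube x0 r) x)) \<in> borel_measurable (U \<Otimes>\<^sub>M M)"
      by (simp add: split_beta)
  qed
  also have "\<dots> \<le> (\<integral>\<^sup>+s. ennreal (l powr p * C) * ennreal (s powr (- 1 / 2)) \<partial>U)"
  proof (rule nn_integral_mono_AE)
    show "AE s in U. (\<integral>\<^sup>+x. ennreal (l powr p) * (ennreal (g x s powr p) * indicator (cube x0 r) x) \<partial>M)
        \<le> ennreal (l powr p * C) * ennreal (s powr (- 1 / 2))"
      using AE_U
    proof eventually_elim
      fix s :: real assume s: "0 < s \<and> s \<le> 1"
      have "(\<lambda>x. g x s) \<in> borel_measurable M"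
        unfolding g_def[abs_def] cube_mean_def
        by (rule V.borel_measurable_lebesgue_integral) (simp add: split_beta)
      then have "(\<integral>\<^sup>+x. ennreal (l powr p) * (ennreal (g x s powr p) * indicator (cube x0 r) x) \<partial>M)
         = ennreal (l powr p) * (\<integral>\<^sup>+x\<in>cube x0 r. ennreal (g x s powr p) \<partial>M)"
        by (intro nn_integral_cmult) auto
      also have "\<dots> \<le> ennreal (l powr p) * (ennreal C * ennreal (s powr (- 1 / 2)))"
        using radial_average_bound[OF f(1,2) r, of s x0] s
        by (intro mult_left_mono) (auto simp: g_def C_def m_def I_def)
      also have "\<dots> = ennreal (l powr p * C) * ennreal (s powr (- 1 / 2))"
        using C by (simp add: ennreal_mult mult_ac)
      finally show "(\<integral>\<^sup>+x. ennreal (l powr p) * (ennreal (g x s powr p) * indicator (cube x0 r) x) \<partial>M)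
        \<le> ennreal (l powr p * C) * ennreal (s powr (- 1 / 2))" .
    qed
  qed
  also have "\<dots> = ennreal (l powr p * C) * (\<integral>\<^sup>+s. ennreal (s powr (- 1 / 2)) \<partial>U)"
    by (rule nn_integral_cmult) measurable
  \<comment> \<open>This doubles the constant of \<open>radial_average_bound\<close>, hence 4 in
    place of 2 in the statement.\<close>
  also have "(\<integral>\<^sup>+s. ennreal (s powr (- 1 / 2)) \<partial>U) = 2"
  proof -
    have "((\<lambda>s::real. s powr (- 1 / 2)) has_integral (1 powr (- 1 / 2 + 1) / (- 1 / 2 + 1))) {0..1}"
      by (rule has_integral_powr_from_0) auto
    then have h: "((\<lambda>s::real. s powr (- 1 / 2)) has_integral 2) {0..1}" by simp
    have "(\<integral>\<^sup>+s. ennreal (indicator {0..1} s * s powr (- 1 / 2)) \<partial>lborel) = ennreal 2"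
    proof (intro nn_integral_has_integral_lborel)
      have "(\<lambda>s::real. indicator {0..1} s * s powr (- 1 / 2)) = (\<lambda>s. if s \<in> {0..1} then s powr (- 1 / 2) else 0)"
        by (auto simp: fun_eq_iff)
      moreover note h
      ultimately show "((\<lambda>s::real. indicator {0..1} s * s powr (- 1 / 2)) has_integral 2) UNIV"
        by (simp only: has_integral_restrict_UNIV)
    qed auto
    then show ?thesis
      unfolding U_def by (subst nn_integral_uniform_measure)
        (auto simp: divide_ennreal_def mult.commute indicator_def of_bool_def if_distrib[of ennreal] if_distrib[of "\<lambda>x. _ * x"] cong: if_cong)
  qed
  also have "ennreal (l powr p * C) * 2 = ennreal (l powr p * C * 2)"
    using C by (simp add: ennreal_mult)
  also have "l powr p * C * 2 = (2 * CARD('a)) powr p * (B powr p * A * 4 * (A * 4 powr (CARD('a) * p))) * r powr p * m * (I / m) powr (p / q)"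
    using r by (simp add: l_def C_def powr_mult mult_ac)
  finally show ?thesis .
qed

end

section \<open>Capacity of Lipschitz functions\<close>

text \<open>Mollifying at a scale below \<open>d\<close> keeps the variable Lipschitz bound
  \<open>G + \<omega>\<close> but may lower the function on \<open>K\<close>. At a small enough
  scale it stays above \<open>1 / 2\<close> there, and doubling it restores admissibility; this is
  the factor 2 in the gradient bound.\<close>

lemma mollified_test_function:
  fixes v G :: "real^'n \<Rightarrow> real" and x0 :: "real^'n"
  assumes v: "continuous_on UNIV v" and supp: "\<And>x. R' \<le> infnorm (x - x0) \<Longrightarrow> v x = 0"
    and R: "R' < R" and K: "K \<subseteq> cube x0 R" "\<And>x. x \<in> K \<Longrightarrow> 1 \<le> v x"
    and \<omega>: "0 < \<omega>" and d: "0 < d" and G: "\<And>x. 0 \<le> G x" "\<And>x. G x \<le> bG"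
    and lip: "\<And>x x' x''. x \<in> cube x0 R \<Longrightarrow> norm (x' - x) < d \<Longrightarrow> norm (x'' - x) < d \<Longrightarrow>
      \<bar>v x' - v x''\<bar> \<le> norm (x' - x'') * (G x + \<omega>)"
  shows "\<exists>\<phi>\<in>test_functions (cube x0 R). (\<forall>x\<in>K. 1 \<le> \<phi> x) \<and>
    (\<forall>x\<in>cube x0 R. norm (gradient \<phi> x) \<le> 2 * (G x + \<omega>))"
proof -
  have bG: "0 \<le> bG" using G(1)[of 0] G(2)[of 0] by linarith
  \<comment> \<open>The three bounds serve, in order, the local Lipschitz hypothesis, the support
    inside the cube, and a change of at most \<open>1 / 2\<close> on \<open>K\<close>.\<close>
  define e where "e = Min {d / 2, (R - R') / 2, 1 / (2 * (bG + \<omega>))}"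
  have e: "0 < e" "e \<le> d / 2" "e \<le> (R - R') / 2" "e \<le> 1 / (2 * (bG + \<omega>))"
  proof -
    show "0 < e" unfolding e_def using d R bG \<omega> by (subst Min_gr_iff) auto
    show "e \<le> d / 2" "e \<le> (R - R') / 2" "e \<le> 1 / (2 * (bG + \<omega>))"
      unfolding e_def by (rule Min_le; simp)+
  qed
  obtain g :: "real^'n \<Rightarrow> real" where g: "smooth_on UNIV g" "\<And>x. 0 \<le> g x"
    "\<And>x. e \<le> norm x \<Longrightarrow> g x = 0" "\<And>x. g (- x) = g x" "integrable lborel g" "(\<integral>x. g x \<partial>lborel) = 1"
    using smooth_bump[OF e(1)] by metis
  have gc: "continuous_on UNIV g" using g(1) by (rule smooth_on_continuous)
  have [measurable]: "v \<in> borel_measurable borel" "g \<in> borel_measurable borel"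
    using v gc by (auto intro: borel_measurable_continuous_onI)
  let ?a = "x0 - R' *\<^sub>R 1" and ?b = "x0 + R' *\<^sub>R 1"
  have out: "v x = 0" if "x \<notin> cbox ?a ?b" for x
    using that supp[of x] by (simp add: cbox_eq_infnorm)
  have "bounded (v ` cbox ?a ?b)"
    by (intro compact_imp_bounded compact_continuous_image continuous_on_subset[OF v]) auto
  then obtain bv0 where "\<And>x. x \<in> cbox ?a ?b \<Longrightarrow> \<bar>v x\<bar> \<le> bv0" unfolding bounded_iff by fastforce
  then have bv: "\<bar>v x\<bar> \<le> max bv0 0" for x using out[of x] by (cases "x \<in> cbox ?a ?b") force+
  define F where "F x = integral (cbox ?a ?b) (\<lambda>y. v y * g (x - y))" for x
  have int: "integrable lborel (\<lambda>h. v (x + h) * g h)" for x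
  proof (rule Bochner_Integration.integrable_bound)
    show "integrable lborel (\<lambda>h. max bv0 0 * g h)" using g by simp
    show "AE h in lborel. norm (v (x + h) * g h) \<le> norm (max bv0 0 * g h)"
      using bv g(2) by (intro AE_I2) (auto simp: abs_mult intro!: mult_right_mono)
  qed simp
  have F: "F x = (\<integral>h. v (x + h) * g h \<partial>lborel)" for x
  proof -
    have "set_integrable lborel (cbox ?a ?b) (\<lambda>y. v y * g (x - y))"
      unfolding set_integrable_def
      by (rule borel_integrable_compact) (auto intro!: continuous_intros continuous_on_subset[OF v] continuous_on_compose2[OF gc])
    then have "F x = (LINT y:cbox ?a ?b|lborel. v y * g (x - y))"
      unfolding F_def by (rule set_borel_integral_eq_integral(2)[symmetric])
    also have "\<dots> = (\<integral>y. v y * g (x - y) \<partial>lborel)"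
      unfolding set_lebesgue_integral_def using out
      by (intro Bochner_Integration.integral_cong) (auto simp: indicator_def)
    also have "\<dots> = (\<integral>y. v y * g (x - y) \<partial>distr lborel borel ((+) x))"
      by (simp add: lborel_distr_plus)
    also have "\<dots> = (\<integral>h. v (x + h) * g (x - (x + h)) \<partial>lborel)"
      by (rule integral_distr) auto
    finally show ?thesis by (simp add: g(4))
  qed
  have diff: "\<bar>F x - c\<bar> \<le> L" if "\<And>h. norm h < e \<Longrightarrow> \<bar>v (x + h) - c\<bar> \<le> L" for x c L
  proof -
    have "F x - c = (\<integral>h. (v (x + h) - c) * g h \<partial>lborel)"
      using int[of x] g by (simp add: F left_diff_distrib)
    also have "\<bar>\<dots>\<bar> \<le> (\<integral>h. \<bar>(v (x + h) - c) * g h\<bar> \<partial>lborel)" by (rule integral_abs_bound)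
    also have "\<dots> \<le> (\<integral>h. L * g h \<partial>lborel)"
    proof (rule integral_mono)
      show "integrable lborel (\<lambda>h. \<bar>(v (x + h) - c) * g h\<bar>)"
        using int[of x] g by (simp add: left_diff_distrib)
      show "integrable lborel (\<lambda>h. L * g h)" using g by simp
      show "\<bar>(v (x + h) - c) * g h\<bar> \<le> L * g h" for h
        using that[of h] g(2,3)[of h] by (cases "norm h < e") (auto simp: abs_mult intro!: mult_right_mono)
    qed
    finally show ?thesis using g by simp
  qed
  have diff2: "\<bar>F x - F y\<bar> \<le> L" if "\<And>h. norm h < e \<Longrightarrow> \<bar>v (x + h) - v (y + h)\<bar> \<le> L" for x y L
  proof -
    have "F x - F y = (\<integral>h. (v (x + h) - v (y + h)) * g h \<partial>lborel)"
      using int[of x] int[of y] by (simp add: F left_diff_distrib)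
    also have "\<bar>\<dots>\<bar> \<le> (\<integral>h. \<bar>(v (x + h) - v (y + h)) * g h\<bar> \<partial>lborel)" by (rule integral_abs_bound)
    also have "\<dots> \<le> (\<integral>h. L * g h \<partial>lborel)"
    proof (rule integral_mono)
      show "integrable lborel (\<lambda>h. \<bar>(v (x + h) - v (y + h)) * g h\<bar>)"
        using int[of x] int[of y] by (simp add: left_diff_distrib)
      show "integrable lborel (\<lambda>h. L * g h)" using g by simp
      show "\<bar>(v (x + h) - v (y + h)) * g h\<bar> \<le> L * g h" for h
        using that[of h] g(2,3)[of h] by (cases "norm h < e") (auto simp: abs_mult intro!: mult_right_mono)
    qed
    finally show ?thesis using g by simp
  qed
  have "smooth_on UNIV F"
    unfolding F_def by (rule smooth_on_convolution[OF continuous_on_subset[OF v] g(1)]) auto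
  then have sm: "smooth_on UNIV (\<lambda>x. 2 * F x)"
    by (rule smooth_on_closure[OF smooth_closure.mult[OF smooth_closure.base[OF smooth_on_const] smooth_closure.base]])
  show ?thesis
  proof (rule bexI[of _ "\<lambda>x. 2 * F x"], intro conjI ballI)
    fix x assume x: "x \<in> K"
    have "\<bar>F x - v x\<bar> \<le> e * (G x + \<omega>)"
    proof (rule diff)
      fix h :: "real^'n" assume h: "norm h < e"
      have "\<bar>v (x + h) - v x\<bar> \<le> norm (x + h - x) * (G x + \<omega>)"
        using x K h e d by (intro lip) auto
      also have "\<dots> \<le> e * (G x + \<omega>)" using h G(1)[of x] \<omega> by (intro mult_right_mono) auto
      finally show "\<bar>v (x + h) - v x\<bar> \<le> e * (G x + \<omega>)" .
    qed
    also have "\<dots> \<le> 1 / (2 * (bG + \<omega>)) * (bG + \<omega>)"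
      using e G(1)[of x] G(2)[of x] \<omega> by (intro mult_mono) auto
    also have "\<dots> = 1 / 2" using bG \<omega> by simp
    finally show "1 \<le> 2 * F x" using K(2)[OF x] by linarith
  next
    fix x assume x: "x \<in> cube x0 R"
    show "norm (gradient (\<lambda>x. 2 * F x) x) \<le> 2 * (G x + \<omega>)"
    proof (rule norm_gradient_le_Lipschitz)
      show "(\<lambda>x. 2 * F x) differentiable (at x)" using sm by (rule smooth_on_differentiable)
      show "0 < d / 2" using d by simp
      show "0 \<le> 2 * (G x + \<omega>)" using G(1)[of x] \<omega> by simp
      fix y assume y: "norm (y - x) < d / 2"
      have "\<bar>F y - F x\<bar> \<le> norm (y - x) * (G x + \<omega>)"
      proof (rule diff2)
        fix h :: "real^'n" assume h: "norm h < e"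
        have "norm (y + h - x) < d" using norm_triangle_ineq[of "y - x" h] y h e by (simp add: algebra_simps)
        then have "\<bar>v (y + h) - v (x + h)\<bar> \<le> norm (y + h - (x + h)) * (G x + \<omega>)"
          using h e d by (intro lip x) auto
        then show "\<bar>v (y + h) - v (x + h)\<bar> \<le> norm (y - x) * (G x + \<omega>)" by simp
      qed
      then have "2 * \<bar>F y - F x\<bar> \<le> 2 * (norm (y - x) * (G x + \<omega>))" by simp
      moreover have "\<bar>2 * F y - 2 * F x\<bar> = 2 * \<bar>F y - F x\<bar>" by (auto simp: abs_if)
      moreover have "2 * (norm (y - x) * (G x + \<omega>)) = 2 * (G x + \<omega>) * norm (y - x)" by (simp only: mult_ac)
      ultimately show "\<bar>2 * F y - 2 * F x\<bar> \<le> 2 * (G x + \<omega>) * norm (y - x)" by linarith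
    qed
  next
    have "F x = 0" if x: "R' + e \<le> infnorm (x - x0)" for x
    proof -
      have "\<bar>F x - 0\<bar> \<le> 0"
      proof (rule diff)
        fix h :: "real^'n" assume h: "norm h < e"
        have "infnorm (x - x0) \<le> infnorm (x + h - x0) + infnorm (- h)"
          using infnorm_triangle[of "x + h - x0" "- h"] by simp
        then have "R' \<le> infnorm (x + h - x0)" using h x infnorm_le_norm[of h] by (simp add: infnorm_neg)
        then show "\<bar>v (x + h) - 0\<bar> \<le> 0" using supp by simp
      qed
      then show ?thesis by simp
    qed
    then have sub: "{x. 2 * F x \<noteq> 0} \<subseteq> cbox (x0 - (R' + e) *\<^sub>R 1) (x0 + (R' + e) *\<^sub>R 1)"
      by (auto simp: cbox_eq_infnorm not_le intro: ccontr)
    then have cl: "closure {x. 2 * F x \<noteq> 0} \<subseteq> cbox (x0 - (R' + e) *\<^sub>R 1) (x0 + (R' + e) *\<^sub>R 1)"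
      by (intro closure_minimal) auto
    moreover have "cbox (x0 - (R' + e) *\<^sub>R 1) (x0 + (R' + e) *\<^sub>R 1) \<subseteq> cube x0 R"
      using e R by (auto simp: cbox_eq_infnorm mem_cube)
    moreover have "compact (closure {x. 2 * F x \<noteq> 0})"
      using sub bounded_subset[OF bounded_cbox] compact_closure by blast
    ultimately show "(\<lambda>x. 2 * F x) \<in> test_functions (cube x0 R)"
      using sm by (auto simp: test_functions_def supp_in_def)
  qed
qed

context Ap_weight
begin

lemma wintegral_eq:
  assumes "E \<in> sets borel" "f \<in> borel_measurable borel" "\<And>x. 0 \<le> f x"
  shows "wintegral w E f = (\<integral>\<^sup>+x\<in>E. ennreal (f x) \<partial>M)"
proof -
  have "wintegral w E f = (\<integral>\<^sup>+x. ennreal (f x * w x) * indicator E x \<partial>lborel)"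
    by (simp add: wintegral_def nn_integral_completion)
  also have "\<dots> = (\<integral>\<^sup>+x. ennreal (w x) * (ennreal (f x) * indicator E x) \<partial>lborel)"
    using assms by (intro nn_integral_cong) (simp add: ennreal_mult' w_nonneg mult_ac)
  also have "\<dots> = (\<integral>\<^sup>+x\<in>E. ennreal (f x) \<partial>M)"
    unfolding M_def using assms by (subst nn_integral_density) auto
  finally show ?thesis .
qed

text \<open>The error \<omega> can be made arbitrarily small because \<open>d\<close> may depend on
  it. The factor \<open>4 powr q\<close> comes from the doubling in the mollification and from
  \<open>G + \<omega> \<le> 2 * max G \<omega>\<close>.\<close>

lemma Cap_le_local_Lipschitz:
  fixes v G :: "real^'n \<Rightarrow> real"
  assumes v: "continuous_on UNIV v" and supp: "\<And>x. R' \<le> infnorm (x - x0) \<Longrightarrow> v x = 0"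
    and R: "0 < R" "R' < R" and K: "K \<subseteq> cube x0 R" "\<And>x. x \<in> K \<Longrightarrow> 1 \<le> v x" and q: "1 < q"
    and G: "\<And>x. 0 \<le> G x" "\<And>x. G x \<le> bG" "G \<in> borel_measurable borel"
    and lip: "\<And>\<omega>. 0 < \<omega> \<Longrightarrow> \<exists>d>0. \<forall>x\<in>cube x0 R. \<forall>x' x''. norm (x' - x) < d \<longrightarrow> norm (x'' - x) < d \<longrightarrow>
      \<bar>v x' - v x''\<bar> \<le> norm (x' - x'') * (G x + \<omega>)"
  shows "Cap q w K (cube x0 R) \<le> ennreal (4 powr q) * (\<integral>\<^sup>+x\<in>cube x0 R. ennreal (G x powr q) \<partial>M)"
proof (rule ennreal_le_epsilon)
  fix e :: real assume e: "0 < e"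
  note [measurable] = G(3)
  let ?U = "cube x0 R"
  let ?m = "measure M ?U"
  have m: "0 < ?m" using R by (intro M_cube_pos)
  \<comment> \<open>Chosen so that the contribution \<open>4 powr q * \<omega> powr q * ?m\<close>
    is exactly \<open>e\<close>.\<close>
  define \<omega> where "\<omega> = (e / (4 powr q * ?m)) powr (1 / q)"
  have \<omega>: "0 < \<omega>" using e m by (simp add: \<omega>_def)
  obtain d where d: "0 < d" "\<And>x x' x''. x \<in> ?U \<Longrightarrow> norm (x' - x) < d \<Longrightarrow> norm (x'' - x) < d \<Longrightarrow>
      \<bar>v x' - v x''\<bar> \<le> norm (x' - x'') * (G x + \<omega>)"
    using lip[OF \<omega>] by blast
  have "\<exists>\<phi>\<in>test_functions ?U. (\<forall>x\<in>K. 1 \<le> \<phi> x) \<and> (\<forall>x\<in>?U. norm (gradient \<phi> x) \<le> 2 * (G x + \<omega>))"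
    by (rule mollified_test_function[OF v supp R(2) K \<omega> d(1) G(1,2)]) (use d(2) in auto)
  then obtain \<phi> where \<phi>: "\<phi> \<in> test_functions ?U" "\<forall>x\<in>K. 1 \<le> \<phi> x"
      "\<And>x. x \<in> ?U \<Longrightarrow> norm (gradient \<phi> x) \<le> 2 * (G x + \<omega>)"
    by blast
  have "smooth_on UNIV \<phi>" using \<phi>(1) by (simp add: test_functions_def)
  then have [measurable]: "gradient \<phi> \<in> borel_measurable borel"
    by (intro borel_measurable_continuous_onI continuous_on_gradient)
  have "Cap q w K ?U \<le> wintegral w ?U (\<lambda>x. norm (gradient \<phi> x) powr q)"
    unfolding Cap_def using \<phi> by (intro INF_lower) auto
  also have "\<dots> = (\<integral>\<^sup>+x\<in>?U. ennreal (norm (gradient \<phi> x) powr q) \<partial>M)"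
    by (rule wintegral_eq) auto
  also have "\<dots> \<le> (\<integral>\<^sup>+x. ennreal (4 powr q) * (ennreal (G x powr q) * indicator ?U x) + ennreal (4 powr q * \<omega> powr q) * indicator ?U x \<partial>M)"
  proof (intro nn_integral_mono)
    fix x
    show "ennreal (norm (gradient \<phi> x) powr q) * indicator ?U x \<le>
      ennreal (4 powr q) * (ennreal (G x powr q) * indicator ?U x) + ennreal (4 powr q * \<omega> powr q) * indicator ?U x"
    proof (cases "x \<in> ?U")
      case True
      have "norm (gradient \<phi> x) powr q \<le> (4 * max (G x) \<omega>) powr q"
        using \<phi>(3)[OF True] q by (intro powr_mono2) auto
      also have "\<dots> = 4 powr q * max (G x) \<omega> powr q" using \<omega> by (simp add: powr_mult)
      also have "\<dots> \<le> 4 powr q * (G x powr q + \<omega> powr q)"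
        by (intro mult_left_mono) (auto simp: max_def)
      finally show ?thesis using True
        by (simp add: ennreal_mult[symmetric] ennreal_plus[symmetric] distrib_left ennreal_leI del: ennreal_plus)
    qed simp
  qed
  also have "\<dots> = ennreal (4 powr q) * (\<integral>\<^sup>+x\<in>?U. ennreal (G x powr q) \<partial>M) + ennreal (4 powr q * \<omega> powr q) * emeasure M ?U"
    by (subst nn_integral_add) (auto simp: nn_integral_cmult nn_integral_cmult_indicator)
  also have "emeasure M ?U = ennreal ?m"
    using M_finite[OF cube_borel order_refl, of x0 R] by (intro emeasure_eq_ennreal_measure) auto
  also have "ennreal (4 powr q * \<omega> powr q) * ennreal ?m = ennreal e"
    using e m q by (simp add: \<omega>_def powr_powr flip: ennreal_mult)
  finally show "Cap q w K ?U \<le> ennreal (4 powr q) * (\<integral>\<^sup>+x\<in>?U. ennreal (G x powr q) \<partial>M) + ennreal e" .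
qed

end

section \<open>Extension across the boundary of a cube\<close>

text \<open>The relative distance to the cube, scaled to reach 1 at radius \<open>5 / 4 * r\<close>,
  so that the extension is constant well inside the cube of radius \<open>2 * r\<close>.\<close>

definition collar :: "real^'a \<Rightarrow> real \<Rightarrow> real^'a \<Rightarrow> real" where
  "collar x0 r x = min 1 (max 0 (4 * (infnorm (x - x0) / r - 1)))"

definition cube_ext :: "(real^'a \<Rightarrow> real) \<Rightarrow> real^'a \<Rightarrow> real \<Rightarrow> real^'a \<Rightarrow> real" where
  "cube_ext u x0 r x = cube_mean u ((1 - collar x0 r x) *\<^sub>R x + collar x0 r x *\<^sub>R x0) (collar x0 r x * r / 2)"

lemma collar_bounds: "0 \<le> collar x0 r x" "collar x0 r x \<le> 1"
  by (auto simp: collar_def)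

lemma collar_eq_0: "0 < r \<Longrightarrow> infnorm (x - x0) \<le> r \<Longrightarrow> collar x0 r x = 0"
  by (auto simp: collar_def max_def min_def field_simps)

lemma collar_eq_1: "0 < r \<Longrightarrow> 5 / 4 * r \<le> infnorm (x - x0) \<Longrightarrow> collar x0 r x = 1"
  by (auto simp: collar_def max_def min_def field_simps)

lemma collar_cases:
  assumes "0 < r"
  obtains "infnorm (x - x0) \<le> r" "collar x0 r x = 0"
    | "0 < collar x0 r x" "collar x0 r x < 1" "infnorm (x - x0) = r * (1 + collar x0 r x / 4)"
    | "5 / 4 * r \<le> infnorm (x - x0)" "collar x0 r x = 1"
proof -
  consider "infnorm (x - x0) \<le> r" | "5 / 4 * r \<le> infnorm (x - x0)"
    | "r < infnorm (x - x0)" "infnorm (x - x0) < 5 / 4 * r" by linarith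
  then show thesis
  proof cases
    case 1
    then show thesis using that(1) collar_eq_0[OF assms] by blast
  next
    case 2
    then show thesis using that(3) collar_eq_1[OF assms] by blast
  next
    case 3
    then have "collar x0 r x = 4 * (infnorm (x - x0) / r - 1)"
      using assms by (auto simp: collar_def max_def min_def field_simps)
    then have "0 < collar x0 r x" "collar x0 r x < 1" "infnorm (x - x0) = r * (1 + collar x0 r x / 4)"
      using 3 assms by (simp_all only:) (simp_all add: field_simps)
    then show thesis by (rule that(2))
  qed
qed

lemma collar_Lipschitz:
  assumes "0 < r" shows "\<bar>collar x0 r x - collar x0 r y\<bar> \<le> 4 / r * norm (x - y)"
proof -
  have "\<bar>collar x0 r x - collar x0 r y\<bar> \<le> \<bar>4 * (infnorm (x - x0) / r - 1) - 4 * (infnorm (y - x0) / r - 1)\<bar>"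
    by (auto simp: collar_def max_def min_def)
  also have "\<dots> = 4 / r * \<bar>infnorm (x - x0) - infnorm (y - x0)\<bar>"
  proof -
    have "4 * (infnorm (x - x0) / r - 1) - 4 * (infnorm (y - x0) / r - 1) = 4 / r * (infnorm (x - x0) - infnorm (y - x0))"
      using assms by (simp add: field_simps)
    then show ?thesis using assms by (simp only: abs_mult) simp
  qed
  also have "\<dots> \<le> 4 / r * infnorm (x - y)"
    using absdiff_infnorm[of "x - x0" "y - x0"] assms by (intro mult_left_mono) auto
  also have "\<dots> \<le> 4 / r * norm (x - y)"
    using assms infnorm_le_norm by (intro mult_left_mono) auto
  finally show ?thesis .
qed

lemma collar_continuous: "continuous_on S (collar x0 r)"
  unfolding collar_def divide_inverse by (intro continuous_intros)

lemma ext_inside: "0 < r \<Longrightarrow> infnorm (x - x0) \<le> r \<Longrightarrow> cube_ext u x0 r x = u x"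
  by (simp add: cube_ext_def collar_eq_0 cube_mean_0)

lemma ext_outside: "0 < r \<Longrightarrow> 5 / 4 * r \<le> infnorm (x - x0) \<Longrightarrow> cube_ext u x0 r x = cube_mean u x0 (r / 2)"
  by (simp add: cube_ext_def collar_eq_1)

text \<open>For fixed \<open>y\<close> this maps the space into the closed cube and is Lipschitz
  near it. The extension is an average over \<open>y\<close> of \<open>u\<close> composed with these
  maps.\<close>

definition ext_point :: "real^'a \<Rightarrow> real \<Rightarrow> real^'a \<Rightarrow> real^'a \<Rightarrow> real^'a" where
  "ext_point x0 r y x = (1 - collar x0 r x) *\<^sub>R x + collar x0 r x *\<^sub>R x0 + (collar x0 r x * r / 2) *\<^sub>R y"

lemma ext_eq_mean: "cube_ext u x0 r x = (\<integral>y. u (ext_point x0 r y x) \<partial>unit_cube)"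
  by (simp add: cube_ext_def cube_mean_def ext_point_def)

text \<open>In the collar with parameter \<open>t\<close> the point has \<open>infnorm\<close>
  distance \<open>r * (1 + t / 4)\<close> from the centre, and
  \<open>(1 - t) * (1 + t / 4) + t / 2 = 1 - t / 4 - t * t / 4\<close>: the contraction outweighs
  both the distance outside the cube and the averaging radius.\<close>

lemma ext_point_inside:
  assumes r: "0 < r" and y: "infnorm y \<le> 1"
  shows "infnorm (ext_point x0 r y x - x0) \<le> r"
proof -
  let ?t = "collar x0 r x" and ?X = "infnorm (x - x0)"
  have "ext_point x0 r y x - x0 = (1 - ?t) *\<^sub>R (x - x0) + (?t * r / 2) *\<^sub>R y"
    by (simp add: ext_point_def algebra_simps)
  then have "infnorm (ext_point x0 r y x - x0) \<le> (1 - ?t) * ?X + (?t * r / 2) * infnorm y"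
    using infnorm_triangle[of "(1 - ?t) *\<^sub>R (x - x0)" "(?t * r / 2) *\<^sub>R y"] collar_bounds[of x0 r x] r
    by (simp add: infnorm_mul)
  also have "\<dots> \<le> (1 - ?t) * ?X + (?t * r / 2) * 1"
    using y r collar_bounds[of x0 r x] by (intro add_left_mono mult_left_mono) auto
  also have "\<dots> \<le> r"
  proof (cases rule: collar_cases[OF r, of x x0])
    case 2
    have "(1 - ?t) * (r * (1 + ?t / 4)) + ?t * r / 2 * 1 = r - r * (?t / 4 + ?t * ?t / 4)"
      by (simp add: field_simps)
    moreover have "0 \<le> r * (?t / 4 + ?t * ?t / 4)" using r 2 by simp
    ultimately show ?thesis unfolding 2(3) by linarith
  qed (use r in auto)
  finally show ?thesis .
qed

text \<open>The constant is 1 for the contraction plus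
  \<open>4 / r * (CARD('a) * (7 / 2 * r))\<close> for the variation of the collar parameter, where
  \<open>7 / 2 * r\<close> bounds the \<open>infnorm\<close> of
  \<open>x' - x0 - (r / 2) *\<^sub>R y\<close>.\<close>

lemma ext_point_Lipschitz:
  fixes x x' x0 y :: "real^'a"
  assumes r: "0 < r" and y: "infnorm y \<le> 1" and x: "infnorm (x' - x0) \<le> 3 * r"
  shows "norm (ext_point x0 r y x - ext_point x0 r y x') \<le> 15 * CARD('a) * norm (x - x')"
proof -
  let ?t = "collar x0 r x" and ?t' = "collar x0 r x'"
  have "ext_point x0 r y x - ext_point x0 r y x' = (1 - ?t) *\<^sub>R (x - x') - (?t - ?t') *\<^sub>R (x' - x0 - (r / 2) *\<^sub>R y)"
    by (simp add: ext_point_def algebra_simps)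
  then have "norm (ext_point x0 r y x - ext_point x0 r y x') \<le> norm ((1 - ?t) *\<^sub>R (x - x')) + norm ((?t - ?t') *\<^sub>R (x' - x0 - (r / 2) *\<^sub>R y))"
    by (metis norm_triangle_ineq4)
  also have "norm ((1 - ?t) *\<^sub>R (x - x')) \<le> 1 * norm (x - x')"
    using collar_bounds[of x0 r x] by (simp add: mult_left_le_one_le)
  also have "norm ((?t - ?t') *\<^sub>R (x' - x0 - (r / 2) *\<^sub>R y)) \<le> (4 / r * norm (x - x')) * (CARD('a) * (7 / 2 * r))"
    unfolding norm_scaleR
  proof (rule mult_mono)
    show "\<bar>?t - ?t'\<bar> \<le> 4 / r * norm (x - x')" by (rule collar_Lipschitz[OF r])
    have "norm (x' - x0 - (r / 2) *\<^sub>R y) \<le> CARD('a) * infnorm (x' - x0 - (r / 2) *\<^sub>R y)"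
      by (rule norm_le_card_infnorm)
    also have "\<dots> \<le> CARD('a) * (7 / 2 * r)"
    proof (rule mult_left_mono)
      have "infnorm (x' - x0 - (r / 2) *\<^sub>R y) \<le> infnorm (x' - x0) + infnorm (- ((r / 2) *\<^sub>R y))"
        using infnorm_triangle[of "x' - x0" "- ((r / 2) *\<^sub>R y)"] by simp
      also have "\<dots> \<le> 3 * r + r / 2 * 1"
      proof -
        have "r * infnorm y \<le> r" using y r by simp
        moreover have "infnorm (- ((r / 2) *\<^sub>R y)) = r / 2 * infnorm y" using r by (simp add: infnorm_neg infnorm_mul)
        ultimately show ?thesis using x by simp
      qed
      finally show "infnorm (x' - x0 - (r / 2) *\<^sub>R y) \<le> 7 / 2 * r" by simp
    qed simp
    finally show "norm (x' - x0 - (r / 2) *\<^sub>R y) \<le> CARD('a) * (7 / 2 * r)" .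
  qed (use r in auto)
  also have "(4 / r * norm (x - x')) * (CARD('a) * (7 / 2 * r)) = 14 * CARD('a) * norm (x - x')"
    using r by simp
  also have "1 * norm (x - x') + 14 * CARD('a) * norm (x - x') \<le> 15 * CARD('a) * norm (x - x')"
    using mult_right_mono[of 1 "real CARD('a)" "norm (x - x')"] by (simp add: Suc_leI algebra_simps)
  finally show ?thesis by simp
qed

lemma ext_point_continuous: "continuous_on S (ext_point x0 r y)"
  unfolding ext_point_def by (intro continuous_intros collar_continuous) auto

lemma ext_point_measurable [measurable]: "(\<lambda>y. ext_point x0 r y x) \<in> borel_measurable borel"
  unfolding ext_point_def by measurable

lemma ext_local_Lipschitz:
  fixes u f :: "real^'a \<Rightarrow> real" and x0 :: "real^'a"
  assumes f: "continuous_on UNIV f" "\<And>y. 0 \<le> f y" "\<And>y. f y \<le> bf"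
    and u: "continuous_on UNIV u" "\<And>y. \<bar>u y\<bar> \<le> bu" and r: "0 < r"
    and grad: "\<And>x y. infnorm (x - x0) \<le> r \<Longrightarrow> infnorm (y - x0) \<le> r \<Longrightarrow>
      \<bar>u x - u y\<bar> \<le> norm (x - y) * (\<integral>s. f ((1 - s) *\<^sub>R x + s *\<^sub>R y) \<partial>uniform_measure lborel {0..1})"
    and \<omega>: "0 < \<omega>"
  obtains d where "0 < d" "\<And>x x' x''. x \<in> cube x0 (2 * r) \<Longrightarrow> norm (x' - x) < d \<Longrightarrow> norm (x'' - x) < d \<Longrightarrow>
      \<bar>cube_ext u x0 r x' - cube_ext u x0 r x''\<bar> \<le> norm (x' - x'') * (15 * real CARD('a) * (cube_ext f x0 r x + \<omega>))"
proof -
  interpret V: prob_space "unit_cube :: (real^'a) measure" by (rule prob_space_unit_cube)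
  define U where "U = uniform_measure lborel {0..1::real}"
  interpret U: prob_space U unfolding U_def by (rule prob_space_uniform_measure) auto
  have Usets [simp, measurable_cong]: "sets U = sets borel" by (simp add: U_def)
  have AE_U: "AE s in U. 0 \<le> s \<and> s \<le> 1" unfolding U_def by (rule AE_uniform_measureI) auto
  have [measurable]: "f \<in> borel_measurable borel" "u \<in> borel_measurable borel"
    using f u by (auto intro: borel_measurable_continuous_onI)
  have bf: "0 \<le> bf" using f(2)[of 0] f(3)[of 0] by linarith
  let ?L = "15 * real CARD('a)"
  have "1 \<le> real CARD('a)" by (simp add: Suc_leI)
  then have L: "1 \<le> ?L" by linarith
  have uc: "uniformly_continuous_on {z. infnorm (z - x0) \<le> r} f"
    unfolding cbox_eq_infnorm[symmetric]
    by (intro compact_uniformly_continuous continuous_on_subset[OF f(1)]) auto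
  then obtain e where e: "0 < e" "\<And>a b. infnorm (a - x0) \<le> r \<Longrightarrow> infnorm (b - x0) \<le> r \<Longrightarrow> dist b a < e \<Longrightarrow>
      dist (f b) (f a) < \<omega>"
    using \<omega> unfolding uniformly_continuous_on_def by (metis mem_Collect_eq)
  have conv: "convex {z. infnorm (z - x0) \<le> r}"
    unfolding cbox_eq_infnorm[symmetric] by (rule convex_box)
  \<comment> \<open>The bound \<open>r\<close> keeps the points within \<open>3 * r\<close> of the
    centre, and \<open>e / ?L\<close> keeps their images within \<open>e\<close> of each
    other.\<close>
  define d where "d = min r (e / ?L)"
  have d: "0 < d" "d \<le> r" "?L * d \<le> e" using r e L by (auto simp: d_def min_def field_simps)
  show thesis
  proof (rule that[OF d(1)])
    fix x x' x'' assume x: "x \<in> cube x0 (2 * r)" and x': "norm (x' - x) < d" and x'': "norm (x'' - x) < d"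
    have in3: "infnorm (z - x0) \<le> 3 * r" if "norm (z - x) < d" for z
    proof -
      have "infnorm (z - x0) \<le> infnorm (z - x) + infnorm (x - x0)"
        using infnorm_triangle[of "z - x" "x - x0"] by simp
      then show ?thesis using infnorm_le_norm[of "z - x"] that d x by (simp add: mem_cube)
    qed
    have step: "\<bar>u (ext_point x0 r y x') - u (ext_point x0 r y x'')\<bar> \<le> ?L * norm (x' - x'') * (f (ext_point x0 r y x) + \<omega>)"
      if y: "infnorm y < 1" for y
    proof -
      let ?P = "ext_point x0 r y"
      have Pin: "infnorm (?P z - x0) \<le> r" for z using y by (intro ext_point_inside r) auto
      have near: "norm (?P z - ?P x) < e" if "norm (z - x) < d" for z
      proof -
        have "norm (?P z - ?P x) \<le> ?L * norm (z - x)"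
          using ext_point_Lipschitz[OF r, of y x x0 z] y in3[of x] d by simp
        also have "\<dots> < ?L * d" using that L by (intro mult_strict_left_mono) auto
        finally show ?thesis using d by simp
      qed
      have "\<bar>u (?P x') - u (?P x'')\<bar> \<le> norm (?P x' - ?P x'') * (\<integral>s. f ((1 - s) *\<^sub>R ?P x' + s *\<^sub>R ?P x'') \<partial>U)"
        unfolding U_def by (intro grad Pin)
      also have "(\<integral>s. f ((1 - s) *\<^sub>R ?P x' + s *\<^sub>R ?P x'') \<partial>U) \<le> (\<integral>s. f (?P x) + \<omega> \<partial>U)"
      proof (rule integral_mono_AE)
        show "integrable U (\<lambda>s. f ((1 - s) *\<^sub>R ?P x' + s *\<^sub>R ?P x''))"
          by (rule U.integrable_const_bound[of _ bf]) (use f in auto)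
        show "AE s in U. f ((1 - s) *\<^sub>R ?P x' + s *\<^sub>R ?P x'') \<le> f (?P x) + \<omega>"
          using AE_U
        proof eventually_elim
          fix s :: real assume s: "0 \<le> s \<and> s \<le> 1"
          let ?z = "(1 - s) *\<^sub>R ?P x' + s *\<^sub>R ?P x''"
          have "?z \<in> {z. infnorm (z - x0) \<le> r}"
            using convexD[OF conv, of "?P x'" "?P x''" "1 - s" s] Pin s by auto
          moreover have "?z \<in> ball (?P x) e"
            using convexD[OF convex_ball, of "?P x'" "?P x" e "?P x''" "1 - s" s] near x' x'' s
            by (auto simp: dist_norm norm_minus_commute)
          ultimately have "dist (f ?z) (f (?P x)) < \<omega>"
            using Pin by (intro e(2)) (auto simp: dist_commute)
          then show "f ?z \<le> f (?P x) + \<omega>" by (simp add: dist_real_def)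
        qed
      qed auto
      also have "\<dots> = f (?P x) + \<omega>" using U.prob_space by (simp add: U_def)
      also have "norm (?P x' - ?P x'') \<le> ?L * norm (x' - x'')"
        using ext_point_Lipschitz[OF r, of y x'' x0 x'] y in3[OF x''] by simp
      finally show ?thesis using f(2)[of "?P x"] \<omega> by (simp add: mult_left_mono mult_right_mono)
    qed
    have iu: "integrable unit_cube (\<lambda>y. u (ext_point x0 r y z))" for z
      by (rule V.integrable_const_bound[of _ bu]) (use u in auto)
    have if': "integrable unit_cube (\<lambda>y. f (ext_point x0 r y z))" for z
      by (rule V.integrable_const_bound[of _ bf]) (use f in auto)
    have "cube_ext u x0 r x' - cube_ext u x0 r x'' = (\<integral>y. u (ext_point x0 r y x') - u (ext_point x0 r y x'') \<partial>unit_cube)"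
      using iu by (simp add: ext_eq_mean)
    also have "\<bar>\<dots>\<bar> \<le> (\<integral>y. \<bar>u (ext_point x0 r y x') - u (ext_point x0 r y x'')\<bar> \<partial>unit_cube)"
      by (rule integral_abs_bound)
    also have "\<dots> \<le> (\<integral>y. ?L * norm (x' - x'') * (f (ext_point x0 r y x) + \<omega>) \<partial>unit_cube)"
    proof (rule integral_mono_AE)
      show "integrable unit_cube (\<lambda>y. \<bar>u (ext_point x0 r y x') - u (ext_point x0 r y x'')\<bar>)" using iu by auto
      show "integrable unit_cube (\<lambda>y. ?L * norm (x' - x'') * (f (ext_point x0 r y x) + \<omega>))" using if' by auto
      show "AE y in unit_cube. \<bar>u (ext_point x0 r y x') - u (ext_point x0 r y x'')\<bar> \<le> ?L * norm (x' - x'') * (f (ext_point x0 r y x) + \<omega>)"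
        using AE_unit_cube by (rule eventually_mono) (rule step)
    qed
    also have "\<dots> = ?L * norm (x' - x'') * (cube_ext f x0 r x + \<omega>)"
      using if' V.prob_space by (simp add: ext_eq_mean)
    finally show "\<bar>cube_ext u x0 r x' - cube_ext u x0 r x''\<bar> \<le> norm (x' - x'') * (?L * (cube_ext f x0 r x + \<omega>))"
      by (simp add: mult_ac)
  qed
qed

lemma ext_continuous:
  assumes "continuous_on UNIV u" "\<And>y. \<bar>u y\<bar> \<le> bu"
  shows "continuous_on UNIV (cube_ext u x0 r)"
  unfolding ext_eq_mean[abs_def]
proof -
  interpret V: prob_space "unit_cube :: (real^'a) measure" by (rule prob_space_unit_cube)
  have [measurable]: "u \<in> borel_measurable borel" using assms(1) by (rule borel_measurable_continuous_onI)
  have c: "continuous_on UNIV (\<lambda>x. u (ext_point x0 r y x))" for y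
    by (intro continuous_on_compose2[OF assms(1)] ext_point_continuous) auto
  show "continuous_on UNIV (\<lambda>x. \<integral>y. u (ext_point x0 r y x) \<partial>unit_cube)"
    unfolding continuous_on_sequentially
  proof safe
    fix X :: "nat \<Rightarrow> real^'a" and a assume X: "X \<longlonglongrightarrow> a"
    have "(\<lambda>i. \<integral>y. u (ext_point x0 r y (X i)) \<partial>unit_cube) \<longlonglongrightarrow> (\<integral>y. u (ext_point x0 r y a) \<partial>unit_cube)"
    proof (rule integral_dominated_convergence[where w="\<lambda>_. bu"])
      show "AE y in unit_cube. (\<lambda>i. u (ext_point x0 r y (X i))) \<longlonglongrightarrow> u (ext_point x0 r y a)"
        using c X by (auto simp: continuous_on_sequentially o_def)
    qed (use assms in auto)
    then show "((\<lambda>x. \<integral>y. u (ext_point x0 r y x) \<partial>unit_cube) \<circ> X) \<longlonglongrightarrow> (\<integral>y. u (ext_point x0 r y a) \<partial>unit_cube)"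
      by (simp add: o_def)
  qed
qed

lemma ext_bounds:
  assumes "continuous_on UNIV f" "\<And>y. 0 \<le> f y" "\<And>y. f y \<le> bf"
  shows "0 \<le> cube_ext f x0 r x" "cube_ext f x0 r x \<le> bf"
proof -
  interpret V: prob_space "unit_cube :: (real^'a) measure" by (rule prob_space_unit_cube)
  have [measurable]: "f \<in> borel_measurable borel" using assms(1) by (rule borel_measurable_continuous_onI)
  have bf: "0 \<le> bf" using assms(2)[of 0] assms(3)[of 0] by linarith
  show "0 \<le> cube_ext f x0 r x" unfolding cube_ext_def by (rule cube_mean_nonneg) (rule assms)
  have "cube_ext f x0 r x \<le> (\<integral>y. bf \<partial>(unit_cube :: (real^'a) measure))"
    unfolding ext_eq_mean by (intro integral_mono V.integrable_const_bound[of _ bf]) (use assms bf in auto)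
  then show "cube_ext f x0 r x \<le> bf" using V.prob_space by simp
qed

context Aq_weight
begin

text \<open>Outside the cube, \<open>cube_mean_powr_le\<close> bounds the extension by averages over
  cubes inside. The distance of such a cube to the boundary is comparable with its radius, so the
  boundary distance of \<open>z\<close> determines the size of the cubes containing \<open>z\<close>
  up to a factor, as \<open>overlap\<close> requires. The boundary itself is a null set.\<close>

lemma ext_energy:
  fixes f :: "real^'a \<Rightarrow> real" and x0 :: "real^'a"
  assumes f: "continuous_on UNIV f" "\<And>y. 0 \<le> f y" "\<And>y. f y \<le> bf" and r: "0 < r"
  shows "(\<integral>\<^sup>+x\<in>cube x0 (2 * r). ennreal (cube_ext f x0 r x powr q) \<partial>M)
    \<le> ennreal ((1 + B * A * 30 powr (CARD('a) * p)) * (LINT z:cube x0 r|M. f z powr q))"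
proof -
  let ?c = "\<lambda>x. (1 - collar x0 r x) *\<^sub>R x + collar x0 r x *\<^sub>R x0" and ?t = "\<lambda>x. collar x0 r x * r / 2"
  let ?Q = "cube x0 r"
  define E where "E = {x. r < infnorm (x - x0) \<and> infnorm (x - x0) < 2 * r}"
  define I where "I = (LINT z:?Q|M. f z powr q)"
  have I0: "0 \<le> I" unfolding I_def set_lebesgue_integral_def by (intro integral_nonneg_AE) auto
  have [measurable]: "f \<in> borel_measurable borel" using f(1) by (rule borel_measurable_continuous_onI)
  have [measurable]: "collar x0 r \<in> borel_measurable borel" "E \<in> sets borel"
    by (auto simp: E_def intro!: borel_measurable_continuous_onI collar_continuous)
  have frontier: "AE x in M. infnorm (x - x0) \<noteq> r"
  proof (rule AE_M)
    have "cbox (x0 - r *\<^sub>R 1) (x0 + r *\<^sub>R 1) - box (x0 - r *\<^sub>R 1) (x0 + r *\<^sub>R 1) \<in> null_sets lborel"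
      using negligible_frontier_interval[of "x0 - r *\<^sub>R 1" "x0 + r *\<^sub>R 1"]
      by (simp add: negligible_iff_null_sets null_sets_completion_iff)
    then have "AE x in lborel. x \<notin> cbox (x0 - r *\<^sub>R 1) (x0 + r *\<^sub>R 1) - box (x0 - r *\<^sub>R 1) (x0 + r *\<^sub>R 1)"
      by (rule AE_not_in)
    then show "AE x in lborel. infnorm (x - x0) \<noteq> r"
      unfolding cbox_eq_infnorm cube_box[symmetric] by eventually_elim (auto simp: mem_cube)
  qed
  \<comment> \<open>The averaging cube of \<open>x\<close> sits at depth comparable with
    \<open>collar x0 r x * r\<close> below the boundary.\<close>
  have geo: "r - infnorm (z - x0) > collar x0 r x * r / 4 \<and> r - infnorm (z - x0) < 3 / 2 * (collar x0 r x * r)"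
    if x: "x \<in> E" and z: "z \<in> cube (?c x) (?t x)" for x z
  proof -
    let ?s = "collar x0 r x" and ?X = "infnorm (x - x0)"
    have "?c x - x0 = (1 - ?s) *\<^sub>R (x - x0)" by (simp add: algebra_simps)
    then have "infnorm (?c x - x0) = (1 - ?s) * ?X" using collar_bounds[of x0 r x] by (simp add: infnorm_mul)
    moreover have "\<bar>infnorm (z - x0) - infnorm (?c x - x0)\<bar> < ?t x"
    proof -
      define c where "c = ?c x"
      show ?thesis using absdiff_infnorm[of "z - x0" "c - x0"] z unfolding c_def[symmetric] by (simp add: mem_cube)
    qed
    ultimately have zb: "\<bar>infnorm (z - x0) - (1 - ?s) * ?X\<bar> < ?s * r / 2" by simp
    show ?thesis
    proof (cases rule: collar_cases[OF r, of x x0])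
      case 1 then show ?thesis using x by (simp add: E_def)
    next
      case 2
      have "(1 - ?s) * ?X = r - 3 / 4 * (?s * r) - ?s * ?s * r / 4"
        unfolding 2(3) by (simp add: field_simps)
      moreover have "0 < ?s * ?s * r" "?s * ?s * r < ?s * r" using 2 r by auto
      moreover have "infnorm (z - x0) - (1 - ?s) * ?X < ?s * r / 2" "(1 - ?s) * ?X - infnorm (z - x0) < ?s * r / 2"
        using zb by linarith+
      ultimately show ?thesis by (intro conjI) linarith+
    next
      case 3
      then show ?thesis using zb r by (auto simp: abs_less_iff)
    qed
  qed
  have tpos: "0 < ?t x" if "x \<in> E" for x
  proof (cases rule: collar_cases[OF r, of x x0])
    case 1 then show ?thesis using that by (simp add: E_def)
  qed (use r in auto)
  let ?h = "\<lambda>x. ennreal (cube_ext f x0 r x powr q)"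
  have [measurable]: "cube_ext f x0 r \<in> borel_measurable borel"
    using ext_continuous[OF f(1), of bf] f by (intro borel_measurable_continuous_onI) auto
  have "(\<integral>\<^sup>+x\<in>cube x0 (2 * r). ?h x \<partial>M) \<le> (\<integral>\<^sup>+x. ?h x * indicator ?Q x + ?h x * indicator E x \<partial>M)"
  proof (rule nn_integral_mono_AE)
    show "AE x in M. ?h x * indicator (cube x0 (2 * r)) x \<le> ?h x * indicator ?Q x + ?h x * indicator E x"
      using frontier
    proof eventually_elim
      fix x assume x: "infnorm (x - x0) \<noteq> r"
      consider "x \<in> ?Q" | "x \<in> E" | "x \<notin> cube x0 (2 * r)" using x unfolding mem_cube E_def mem_Collect_eq by (metis linorder_less_linear)
      then show "?h x * indicator (cube x0 (2 * r)) x \<le> ?h x * indicator ?Q x + ?h x * indicator E x"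
        by cases (auto simp: indicator_def)
    qed
  qed
  also have "\<dots> = (\<integral>\<^sup>+x\<in>?Q. ?h x \<partial>M) + (\<integral>\<^sup>+x\<in>E. ?h x \<partial>M)"
    by (rule nn_integral_add) measurable
  also have "(\<integral>\<^sup>+x\<in>?Q. ?h x \<partial>M) = (\<integral>\<^sup>+x\<in>?Q. ennreal (f x powr q) \<partial>M)"
    using r by (intro nn_integral_cong) (auto simp: indicator_def mem_cube ext_inside)
  also have "(\<integral>\<^sup>+x\<in>E. ?h x \<partial>M) \<le>
      (\<integral>\<^sup>+x\<in>E. (\<integral>\<^sup>+z\<in>cube (?c x) (?t x). (ennreal B * ennreal (f z powr q)) \<partial>M) * ennreal (1 / measure M (cube (?c x) (?t x))) \<partial>M)"
  proof (intro nn_integral_mono)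
    fix x
    show "?h x * indicator E x \<le>
      ((\<integral>\<^sup>+z\<in>cube (?c x) (?t x). (ennreal B * ennreal (f z powr q)) \<partial>M) * ennreal (1 / measure M (cube (?c x) (?t x)))) * indicator E x"
    proof (cases "x \<in> E")
      case True
      have g: "(\<integral>\<^sup>+z\<in>cube (?c x) (?t x). (ennreal B * ennreal (f z powr q)) \<partial>M) =
          ennreal B * ennreal (LINT z:cube (?c x) (?t x)|M. f z powr q)"
        unfolding mult.assoc by (subst nn_integral_cmult) (auto simp: nn_integral_powr[OF f(1,2)])
      have "0 \<le> (LINT z:cube (?c x) (?t x)|M. f z powr q)"
        unfolding set_lebesgue_integral_def by (intro integral_nonneg_AE) auto
      moreover have "cube_ext f x0 r x powr q \<le> B * ((LINT z:cube (?c x) (?t x)|M. f z powr q) / measure M (cube (?c x) (?t x)))"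
        unfolding cube_ext_def by (rule cube_mean_powr_le[OF f(1,2) tpos[OF True]])
      ultimately show ?thesis unfolding g using True B by (simp add: ennreal_mult[symmetric] ennreal_leI)
    qed simp
  qed
  also have "(\<integral>\<^sup>+x\<in>E. (\<integral>\<^sup>+z\<in>cube (?c x) (?t x). (ennreal B * ennreal (f z powr q)) \<partial>M) * ennreal (1 / measure M (cube (?c x) (?t x))) \<partial>M)
     \<le> ennreal (A * 30 powr (CARD('a) * p)) * (\<integral>\<^sup>+z\<in>?Q. (ennreal B * ennreal (f z powr q)) \<partial>M)"
  \<comment> \<open>By \<open>geo\<close> the radius 10 times the depth exceeds \<open>5 / 2\<close>
    times \<open>collar x0 r x * r\<close>, enough to reach \<open>x\<close> and its cube. It is
    below 15 times that quantity, which is 30 times the averaging radius.\<close>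
  proof (rule overlap[where \<rho>="\<lambda>z. 10 * (r - infnorm (z - x0))"])
    show "0 < ?t x" if "x \<in> E" for x using tpos[OF that] .
    show "cube (?c x) (?t x) \<subseteq> ?Q" if x: "x \<in> E" for x
    proof
      fix z assume z: "z \<in> cube (?c x) (?t x)"
      show "z \<in> ?Q" using geo[OF x z] tpos[OF x] by (simp add: mem_cube)
    qed
    fix x z assume x: "x \<in> E" and z: "z \<in> cube (?c x) (?t x)"
    let ?s = "collar x0 r x"
    have s: "0 < ?s * r" using tpos[OF x] by simp
    have zc: "infnorm (?c x - z) < ?s * r / 2" using z by (simp add: mem_cube infnorm_sub)
    have "?c x - x = ?s *\<^sub>R (x0 - x)" by (simp add: algebra_simps)
    then have "infnorm (?c x - x) = ?s * infnorm (x - x0)"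
      using collar_bounds[of x0 r x] by (simp add: infnorm_mul infnorm_sub)
    also have "\<dots> \<le> ?s * (2 * r)"
      using x collar_bounds[of x0 r x] by (intro mult_left_mono) (auto simp: E_def)
    finally have xc: "infnorm (?c x - x) \<le> 2 * (?s * r)" by simp
    have "infnorm (x - z) \<le> infnorm (x - ?c x) + infnorm (?c x - z)"
      using infnorm_triangle[of "x - ?c x" "?c x - z"] by simp
    then have "infnorm (x - z) < 5 / 2 * (?s * r)" using xc zc infnorm_sub[of x "?c x"] by linarith
    then have 1: "x \<in> cube z (10 * (r - infnorm (z - x0)))" using geo[OF x z] by (simp add: mem_cube)
    have "cube (?c x) (?t x) \<subseteq> cube z (10 * (r - infnorm (z - x0)))"
    proof (rule cube_subset)
      show "infnorm (?c x - z) + ?t x \<le> 10 * (r - infnorm (z - x0))"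
      proof -
        have "X + S / 2 \<le> 10 * e" if "X < S / 2" "S / 4 < e" "0 < S" for X S e :: real
          using that by linarith
        from this[OF zc conjunct1[OF geo[OF x z]] s] show ?thesis .
      qed
    qed
    show "x \<in> cube z (10 * (r - infnorm (z - x0))) \<and> cube (?c x) (?t x) \<subseteq> cube z (10 * (r - infnorm (z - x0)))
        \<and> 10 * (r - infnorm (z - x0)) \<le> 30 * ?t x"
    proof -
      have "10 * e \<le> 30 * (S / 2)" if "e < 3 / 2 * S" for e S :: real using that by linarith
      from this[OF conjunct2[OF geo[OF x z]]] 1 show ?thesis
        using \<open>cube (?c x) (?t x) \<subseteq> cube z (10 * (r - infnorm (z - x0)))\<close> by blast
    qed
  qed auto
  also have "(\<integral>\<^sup>+z\<in>?Q. (ennreal B * ennreal (f z powr q)) \<partial>M) = ennreal B * ennreal I"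
    unfolding mult.assoc I_def by (subst nn_integral_cmult) (auto simp: nn_integral_powr[OF f(1,2)])
  also have "(\<integral>\<^sup>+x\<in>?Q. ennreal (f x powr q) \<partial>M) + ennreal (A * 30 powr (CARD('a) * p)) * (ennreal B * ennreal I) =
      ennreal ((1 + B * A * 30 powr (CARD('a) * p)) * I)"
    using A B I0 by (simp add: nn_integral_powr[OF f(1,2)] I_def[symmetric] flip: ennreal_mult ennreal_plus) (simp add: algebra_simps)
  finally show ?thesis by (simp add: I_def add_left_mono)
qed

end

section \<open>Capacity and means\<close>

lemma integral_unit_interval:
  fixes g :: "real \<Rightarrow> real"
  assumes "continuous_on UNIV g"
  shows "(\<integral>s. g s \<partial>uniform_measure lborel {0..1}) = integral {0..1} g"
proof -
  have [measurable]: "g \<in> borel_measurable borel" using assms by (rule borel_measurable_continuous_onI)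
  have U: "uniform_measure lborel {0..1::real} = density lborel (\<lambda>s. ennreal (indicator {0..1} s))"
    unfolding uniform_measure_def
    by (rule arg_cong2[where f=density]) (simp_all add: divide_ennreal_def fun_eq_iff ennreal_indicator)
  have "(\<integral>s. g s \<partial>uniform_measure lborel {0..1}) = (LINT s:{0..1}|lborel. g s)"
    unfolding U set_lebesgue_integral_def by (subst integral_density) auto
  also have "\<dots> = integral {0..1} g"
    using assms by (intro set_borel_integral_eq_integral(2) borel_integrable_atLeastAtMost')
      (auto intro: continuous_on_subset)
  finally show ?thesis .
qed

text \<open>The fundamental theorem of calculus along a segment. \<open>f\<close> has to agree with
  the norm of the gradient on \<open>S\<close> alone, so it may be any continuous extension.\<close>

lemma gradient_upper_gradient:
  fixes u f :: "real^'n \<Rightarrow> real"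
  assumes S: "convex S" "S \<subseteq> U" "open U" and u: "\<And>z. z \<in> U \<Longrightarrow> u differentiable (at z)"
    and f: "continuous_on UNIV f" "\<And>z. z \<in> S \<Longrightarrow> f z = norm (gradient u z)"
    and x: "x \<in> S" and y: "y \<in> S"
  shows "\<bar>u x - u y\<bar> \<le> norm (x - y) * (\<integral>s. f ((1 - s) *\<^sub>R x + s *\<^sub>R y) \<partial>uniform_measure lborel {0..1})"
proof -
  let ?z = "\<lambda>s::real. (1 - s) *\<^sub>R x + s *\<^sub>R y"
  have z: "?z s \<in> S" if "s \<in> {0..1}" for s
    using convexD[OF S(1) x y, of "1 - s" s] that by auto
  have d: "((\<lambda>s. u (?z s)) has_vector_derivative (gradient u (?z s) \<bullet> (y - x))) (at s within {0..1})"
    if "s \<in> {0..1}" for s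
  proof -
    have zd: "(?z has_derivative (\<lambda>h. h *\<^sub>R (y - x))) (at s within {0..1})"
      by (auto intro!: derivative_eq_intros simp: algebra_simps)
    have "((\<lambda>s. u (?z s)) has_derivative (\<lambda>h. gradient u (?z s) \<bullet> (h *\<^sub>R (y - x)))) (at s within {0..1})"
      using has_derivative_compose[OF zd has_derivative_gradient[OF u]] z[OF that] S(2) by blast
    then show ?thesis by (simp add: has_vector_derivative_def)
  qed
  have i1: "((\<lambda>s. gradient u (?z s) \<bullet> (y - x)) has_integral (u (?z 1) - u (?z 0))) {0..1}"
    by (rule fundamental_theorem_of_calculus) (use d in auto)
  have c: "continuous_on UNIV (\<lambda>s. f (?z s))"
    by (intro continuous_on_compose2[OF f(1)] continuous_intros) auto
  have i2: "(\<lambda>s. norm (x - y) * f (?z s)) integrable_on {0..1}"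
    using c by (intro integrable_continuous_real continuous_intros continuous_on_subset[OF c]) auto
  have "norm (integral {0..1} (\<lambda>s. gradient u (?z s) \<bullet> (y - x))) \<le> integral {0..1} (\<lambda>s. norm (x - y) * f (?z s))"
  proof (rule integral_norm_bound_integral[OF _ i2])
    show "(\<lambda>s. gradient u (?z s) \<bullet> (y - x)) integrable_on {0..1}" using i1 by blast
    show "norm (gradient u (?z s) \<bullet> (y - x)) \<le> norm (x - y) * f (?z s)" if "s \<in> {0..1}" for s
      using Cauchy_Schwarz_ineq2[of "gradient u (?z s)" "y - x"] f(2)[OF z[OF that]]
      by (simp add: norm_minus_commute mult.commute)
  qed
  then show ?thesis
    using i1 by (simp add: integral_unique integral_unit_interval[OF c] abs_minus_commute)
qed

context Aq_weight
begin

text \<open>The competitor \<open>1 - collar\<close> has slope \<open>4 / r\<close>, and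
  \<open>Cap_le_local_Lipschitz\<close> contributes another 4. Besides finiteness of the capacity,
  this shows that the capacity quotient cannot be small compared with \<open>r\<close>.\<close>

lemma Cap_le_cutoff:
  assumes r: "0 < r" and K: "K \<subseteq> closure (cube x0 r)"
  shows "Cap q w K (cube x0 (2 * r)) \<le> ennreal ((16 / r) powr q * measure M (cube x0 (2 * r)))"
proof -
  let ?U = "cube x0 (2 * r)"
  have "Cap q w K ?U \<le> ennreal (4 powr q) * (\<integral>\<^sup>+x\<in>?U. ennreal ((4 / r) powr q) \<partial>M)"
  proof (rule Cap_le_local_Lipschitz[where v="\<lambda>x. 1 - collar x0 r x" and R'="5 / 4 * r" and bG="4 / r"])
    show "continuous_on UNIV (\<lambda>x. 1 - collar x0 r x)" by (intro continuous_intros collar_continuous)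
    show "K \<subseteq> ?U" using K r by (auto simp: closure_cube mem_cube)
    show "1 \<le> 1 - collar x0 r x" if "x \<in> K" for x
      using that K r collar_eq_0[OF r, of x x0] by (auto simp: closure_cube)
    fix \<omega> :: real assume \<omega>: "0 < \<omega>"
    have "\<bar>(1 - collar x0 r x') - (1 - collar x0 r x'')\<bar> \<le> norm (x' - x'') * (4 / r + \<omega>)" for x' x''
    proof -
      have "\<bar>(1 - collar x0 r x') - (1 - collar x0 r x'')\<bar> = \<bar>collar x0 r x' - collar x0 r x''\<bar>" by linarith
      also have "\<dots> \<le> 4 / r * norm (x' - x'')" by (rule collar_Lipschitz[OF r])
      also have "\<dots> \<le> norm (x' - x'') * (4 / r + \<omega>)" using \<omega> by (simp add: algebra_simps)
      finally show ?thesis .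
    qed
    then show "\<exists>d>0. \<forall>x\<in>?U. \<forall>x' x''. norm (x' - x) < d \<longrightarrow> norm (x'' - x) < d \<longrightarrow>
        \<bar>(1 - collar x0 r x') - (1 - collar x0 r x'')\<bar> \<le> norm (x' - x'') * (4 / r + \<omega>)"
      by (intro exI[of _ 1]) auto
  qed (use r q in \<open>auto simp: collar_eq_1\<close>)
  also have "(\<integral>\<^sup>+x\<in>?U. ennreal ((4 / r) powr q) \<partial>M) = ennreal ((4 / r) powr q) * emeasure M ?U"
    by (simp add: nn_integral_cmult_indicator)
  also have "emeasure M ?U = ennreal (measure M ?U)"
    using M_finite[OF cube_borel order_refl, of x0 "2 * r"] by (intro emeasure_eq_ennreal_measure) auto
  also have "ennreal (4 powr q) * (ennreal ((4 / r) powr q) * ennreal (measure M ?U)) =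
      ennreal ((4 * (4 / r)) powr q * measure M ?U)"
    using r by (subst powr_mult) (auto simp: ennreal_mult mult_ac)
  finally show ?thesis by simp
qed

text \<open>Dividing by the mean normalises the competitor to 1 on \<open>K\<close>, where
  \<open>u\<close> vanishes, and to 0 far away; multiplying by its power then removes the
  normalisation. The constant 60 is 4 from \<open>Cap_le_local_Lipschitz\<close> times 15 from the
  extension.\<close>

lemma mean_Cap_le:
  fixes u f :: "real^'a \<Rightarrow> real" and x0 :: "real^'a"
  assumes f: "continuous_on UNIV f" "\<And>y. 0 \<le> f y" "\<And>y. f y \<le> bf"
    and u: "continuous_on UNIV u" "\<And>y. \<bar>u y\<bar> \<le> bu" and r: "0 < r"
    and grad: "\<And>x y. infnorm (x - x0) \<le> r \<Longrightarrow> infnorm (y - x0) \<le> r \<Longrightarrow>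
      \<bar>u x - u y\<bar> \<le> norm (x - y) * (\<integral>s. f ((1 - s) *\<^sub>R x + s *\<^sub>R y) \<partial>uniform_measure lborel {0..1})"
    and K: "K \<subseteq> closure (cube x0 r)" "\<And>x. x \<in> K \<Longrightarrow> u x = 0"
  shows "ennreal (\<bar>cube_mean u x0 (r / 2)\<bar> powr q) * Cap q w K (cube x0 (2 * r)) \<le>
    ennreal ((60 * real CARD('a)) powr q * ((1 + B * A * 30 powr (CARD('a) * p)) * (LINT z:cube x0 r|M. f z powr q)))"
proof (cases "cube_mean u x0 (r / 2) = 0")
  case True
  then show ?thesis by simp
next
  case False
  let ?a = "cube_mean u x0 (r / 2)" and ?U = "cube x0 (2 * r)"
  define N where "N = 15 * real CARD('a)"
  \<comment> \<open>The factor by which \<open>1 - cube_ext u x0 r x / ?a\<close> scales the upper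
    gradient \<open>cube_ext f\<close>.\<close>
  define l where "l = N / \<bar>?a\<bar>"
  have N: "0 < N" by (simp add: N_def)
  have l: "0 < l" using False N by (simp add: l_def)
  have I0: "0 \<le> (LINT z:cube x0 r|M. f z powr q)"
    unfolding set_lebesgue_integral_def by (intro integral_nonneg_AE) auto
  have [measurable]: "cube_ext f x0 r \<in> borel_measurable borel"
    using ext_continuous[OF f(1), of bf] f by (intro borel_measurable_continuous_onI) auto
  have "Cap q w K ?U \<le> ennreal (4 powr q) * (\<integral>\<^sup>+x\<in>?U. ennreal ((l * cube_ext f x0 r x) powr q) \<partial>M)"
  proof (rule Cap_le_local_Lipschitz[where v="\<lambda>x. 1 - cube_ext u x0 r x / ?a" and R'="5 / 4 * r" and bG="l * bf"])
    show "continuous_on UNIV (\<lambda>x. 1 - cube_ext u x0 r x / ?a)"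
      using False by (intro continuous_intros ext_continuous[OF u]) auto
    show "1 - cube_ext u x0 r x / ?a = 0" if "5 / 4 * r \<le> infnorm (x - x0)" for x
      using False by (simp add: ext_outside[OF r that])
    show "K \<subseteq> ?U" using K r by (auto simp: closure_cube mem_cube)
    show "1 \<le> 1 - cube_ext u x0 r x / ?a" if "x \<in> K" for x
    proof -
      have "infnorm (x - x0) \<le> r" using that K(1) r by (auto simp: closure_cube)
      then show ?thesis using ext_inside[OF r, of x x0 u] K(2)[OF that] by simp
    qed
    show "0 \<le> l * cube_ext f x0 r x" "l * cube_ext f x0 r x \<le> l * bf" for x
      using ext_bounds[OF f, of x0 r x] l by auto
    fix \<omega> :: real assume \<omega>: "0 < \<omega>"
    obtain d where d: "0 < d" "\<And>x x' x''. x \<in> ?U \<Longrightarrow> norm (x' - x) < d \<Longrightarrow> norm (x'' - x) < d \<Longrightarrow>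
      \<bar>cube_ext u x0 r x' - cube_ext u x0 r x''\<bar> \<le> norm (x' - x'') * (15 * real CARD('a) * (cube_ext f x0 r x + \<omega> / l))"
      using ext_local_Lipschitz[OF f u r grad, where \<omega>="\<omega> / l"] divide_pos_pos[OF \<omega> l] by blast
    have "\<bar>(1 - cube_ext u x0 r x' / ?a) - (1 - cube_ext u x0 r x'' / ?a)\<bar> \<le> norm (x' - x'') * (l * cube_ext f x0 r x + \<omega>)"
      if "x \<in> ?U" "norm (x' - x) < d" "norm (x'' - x) < d" for x x' x''
    proof -
      have "\<bar>(1 - cube_ext u x0 r x' / ?a) - (1 - cube_ext u x0 r x'' / ?a)\<bar> = \<bar>cube_ext u x0 r x' - cube_ext u x0 r x''\<bar> / \<bar>?a\<bar>"
        by (simp add: abs_divide[symmetric] diff_divide_distrib abs_minus_commute)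
      also have "\<dots> \<le> norm (x' - x'') * (N * (cube_ext f x0 r x + \<omega> / l)) / \<bar>?a\<bar>"
        using d(2)[OF that] by (intro divide_right_mono) (auto simp: N_def)
      also have "\<dots> = norm (x' - x'') * (l * (cube_ext f x0 r x + \<omega> / l))" by (simp add: l_def)
      also have "l * (cube_ext f x0 r x + \<omega> / l) = l * cube_ext f x0 r x + \<omega>" using l by (simp add: distrib_left)
      finally show ?thesis .
    qed
    then show "\<exists>d>0. \<forall>x\<in>?U. \<forall>x' x''. norm (x' - x) < d \<longrightarrow> norm (x'' - x) < d \<longrightarrow>
        \<bar>(1 - cube_ext u x0 r x' / ?a) - (1 - cube_ext u x0 r x'' / ?a)\<bar> \<le> norm (x' - x'') * (l * cube_ext f x0 r x + \<omega>)"
      using d(1) by blast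
  qed (use r q in auto)
  also have "(\<integral>\<^sup>+x\<in>?U. ennreal ((l * cube_ext f x0 r x) powr q) \<partial>M) =
      (\<integral>\<^sup>+x. ennreal (l powr q) * (ennreal (cube_ext f x0 r x powr q) * indicator ?U x) \<partial>M)"
    using ext_bounds[OF f] l by (intro nn_integral_cong) (simp add: powr_mult ennreal_mult mult.assoc)
  also have "\<dots> = ennreal (l powr q) * (\<integral>\<^sup>+x\<in>?U. ennreal (cube_ext f x0 r x powr q) \<partial>M)"
    by (rule nn_integral_cmult) measurable
  also have "\<dots> \<le> ennreal (l powr q) * ennreal ((1 + B * A * 30 powr (CARD('a) * p)) * (LINT z:cube x0 r|M. f z powr q))"
    by (intro mult_left_mono ext_energy[OF f r]) auto
  finally have "Cap q w K ?U \<le> ennreal (4 powr q) * (ennreal (l powr q) *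
      ennreal ((1 + B * A * 30 powr (CARD('a) * p)) * (LINT z:cube x0 r|M. f z powr q)))"
    by (simp add: mult_left_mono)
  then have "ennreal (\<bar>?a\<bar> powr q) * Cap q w K ?U \<le> ennreal (\<bar>?a\<bar> powr q) * (ennreal (4 powr q) * (ennreal (l powr q) *
      ennreal ((1 + B * A * 30 powr (CARD('a) * p)) * (LINT z:cube x0 r|M. f z powr q))))"
    by (intro mult_left_mono) auto
  also have "\<dots> = ennreal ((\<bar>?a\<bar> powr q * 4 powr q * l powr q) *
      ((1 + B * A * 30 powr (CARD('a) * p)) * (LINT z:cube x0 r|M. f z powr q)))"
    using A B I0 by (simp add: ennreal_mult mult_ac)
  also have "\<bar>?a\<bar> powr q * 4 powr q * l powr q = (\<bar>?a\<bar> * 4 * l) powr q"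
    using l by (simp add: powr_mult)
  also have "\<bar>?a\<bar> * 4 * l = 60 * real CARD('a)" using False by (simp add: l_def N_def)
  finally show ?thesis .
qed

definition poincare_const :: real where
  "poincare_const = (2 * CARD('a)) powr p * (B powr p * A * 4 * (A * 4 powr (CARD('a) * p)))"

lemma poincare_const_pos: "0 < poincare_const"
  using A B by (simp add: poincare_const_def)

lemma measure_cube_mono: "cube y t \<subseteq> cube x s \<Longrightarrow> measure M (cube y t) \<le> measure M (cube x s)"
  using M_finite[OF cube_borel order_refl, of x s] by (intro measure_mono_fmeasurable fmeasurableI) auto

lemma emeasure_cube_eq: "emeasure M (cube x s) = ennreal (measure M (cube x s))"
  using M_finite[OF cube_borel order_refl, of x s] by (intro emeasure_eq_ennreal_measure) auto

text \<open>Chebyshev's inequality is used twice on the cube of radius \<open>4 * r\<close>: on a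
  subcube where \<phi> is 0 it forces \<open>\<bar>a\<bar> \<le> 1 / 8\<close>, and on the
  superlevel set, where \<phi> then differs from \<open>a\<close> by at least \<open>1 / 8\<close>,
  it gives the claim. In the condition on \<gamma>, \<open>8 powr p\<close> stems from this
  threshold and \<open>A * 8 powr (CARD('a) * p)\<close> from doubling between radii
  \<open>r / 2\<close> and \<open>4 * r\<close>.\<close>

lemma superlevel_small:
  assumes r: "0 < r" and \<phi>: "\<phi> \<in> test_functions (cube x0 (2 * r))"
    and \<gamma>: "0 < \<gamma>" "2 * \<gamma> \<le> 1" "8 powr p * A * 8 powr (CARD('a) * p) * (poincare_const * 4 powr p * (2 * \<gamma>)) \<le> 1 / 2"
    and small: "(LINT z:cube x0 (2 * r)|M. norm (gradient \<phi> z) powr q) \<le> 2 * \<gamma> * r powr (- q) * measure M (cube x0 (2 * r))"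
  shows "measure M {x \<in> cube x0 (r / 2). 1 / 4 < \<phi> x} \<le> measure M (cube x0 (r / 2)) / 2"
proof -
  let ?f = "\<lambda>z. norm (gradient \<phi> z)"
  define supp where "supp = closure {x. \<phi> x \<noteq> 0}"
  have sm: "smooth_on UNIV \<phi>" and cs: "compact supp" "supp \<subseteq> cube x0 (2 * r)"
    using \<phi> by (auto simp: test_functions_def supp_in_def supp_def)
  have out: "\<phi> z = 0 \<and> gradient \<phi> z = 0" if "z \<notin> supp" for z
  proof
    have o: "open (- supp)" by (simp add: supp_def open_Compl)
    have 0: "\<phi> y = 0" if "y \<in> - supp" for y using that closure_subset[of "{x. \<phi> x \<noteq> 0}"] by (auto simp: supp_def)
    show "\<phi> z = 0" using 0 that by simp
    have "(\<phi> has_derivative (\<lambda>h. 0 \<bullet> h)) (at z)"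
      by (rule has_derivative_transform_within_open[OF _ o, of "\<lambda>_. 0"]) (use 0 that in auto)
    then show "gradient \<phi> z = 0" by (rule gradient_eqI)
  qed
  have cont: "continuous_on UNIV \<phi>" "continuous_on UNIV ?f"
    using sm by (auto intro!: smooth_on_continuous continuous_on_norm continuous_on_gradient)
  have [measurable]: "\<phi> \<in> borel_measurable borel" using cont by (auto intro: borel_measurable_continuous_onI)
  have "bounded (?f ` supp)" "bounded (\<phi> ` supp)"
    using cs cont by (auto intro!: compact_imp_bounded compact_continuous_image intro: continuous_on_subset)
  then obtain bf bu where b: "\<And>z. z \<in> supp \<Longrightarrow> ?f z \<le> bf" "\<And>z. z \<in> supp \<Longrightarrow> \<bar>\<phi> z\<bar> \<le> bu"
    unfolding bounded_iff by fastforce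
  have bf: "?f z \<le> max bf 0" for z using b(1)[of z] out[of z] by (cases "z \<in> supp") auto
  have bu: "\<bar>\<phi> z\<bar> \<le> max bu 0" for z using b(2)[of z] out[of z] by (cases "z \<in> supp") auto
  define a where "a = cube_mean \<phi> x0 (4 * r / 2)"
  let ?m4 = "measure M (cube x0 (4 * r))" and ?m2 = "measure M (cube x0 (2 * r))" and ?mh = "measure M (cube x0 (r / 2))"
  let ?I = "LINT z:cube x0 (2 * r)|M. ?f z powr q"
  have m4: "0 < ?m4" using r by (intro M_cube_pos) auto
  have sub: "cube x0 (2 * r) \<subseteq> cube x0 (4 * r)" using r by (intro cube_subset) (auto simp: infnorm_0)
  have I4: "(LINT z:cube x0 (4 * r)|M. ?f z powr q) = ?I"
    unfolding set_lebesgue_integral_def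
  proof (rule Bochner_Integration.integral_cong)
    fix z
    show "indicator (cube x0 (4 * r)) z *\<^sub>R ?f z powr q = indicator (cube x0 (2 * r)) z *\<^sub>R ?f z powr q"
      using out[of z] cs(2) sub q by (cases "z \<in> supp") (auto simp: indicator_def)
  qed simp
  have I0: "0 \<le> ?I" unfolding set_lebesgue_integral_def by (intro integral_nonneg_AE) auto
  define S where "S = poincare_const * 4 powr p * (2 * \<gamma>)"
  have S: "0 < S" using poincare_const_pos \<gamma> by (simp add: S_def)
  have W: "(\<integral>\<^sup>+x\<in>cube x0 (4 * r). ennreal (\<bar>\<phi> x - a\<bar> powr p) \<partial>M) \<le> ennreal (S * ?m4)"
  proof -
    have "(\<integral>\<^sup>+x\<in>cube x0 (4 * r). ennreal (\<bar>\<phi> x - a\<bar> powr p) \<partial>M) \<le>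
        ennreal ((2 * CARD('a)) powr p * (B powr p * A * 4 * (A * 4 powr (CARD('a) * p))) * (4 * r) powr p * ?m4 *
         ((LINT z:cube x0 (4 * r)|M. ?f z powr q) / ?m4) powr (p / q))"
      unfolding a_def
    proof (rule poincare[OF cont(2) _ bf cont(1) bu])
      fix x y :: "real^'a"
      show "\<bar>\<phi> x - \<phi> y\<bar> \<le> norm (x - y) * (\<integral>s. ?f ((1 - s) *\<^sub>R x + s *\<^sub>R y) \<partial>uniform_measure lborel {0..1})"
        by (rule gradient_upper_gradient[of UNIV UNIV]) (use cont sm in \<open>auto intro: smooth_on_differentiable\<close>)
    qed (use r in auto)
    also have "\<dots> \<le> ennreal (S * ?m4)"
    proof (rule ennreal_leI)
      have "?I / ?m4 \<le> 2 * \<gamma> * r powr (- q)"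
      proof -
        have "?I \<le> 2 * \<gamma> * r powr (- q) * ?m4"
          by (rule order_trans[OF small mult_left_mono[OF measure_cube_mono[OF sub]]]) (use \<gamma> in simp)
        then show ?thesis using m4 by (simp add: pos_divide_le_eq)
      qed
      then have "(?I / ?m4) powr (p / q) \<le> (2 * \<gamma> * r powr (- q)) powr (p / q)"
        using I0 p q by (intro powr_mono2) auto
      also have "\<dots> = (2 * \<gamma>) powr (p / q) * r powr (- p)"
        using \<gamma> q by (simp add: powr_mult powr_powr)
      \<comment> \<open>Since \<open>2 * \<gamma> \<le> 1\<close> and \<open>p / q \<ge> 1\<close>,
        the power can be lowered, which makes the bound independent of \<open>q\<close>.\<close>
      also have "\<dots> \<le> (2 * \<gamma>) powr 1 * r powr (- p)"
        using \<gamma> q p by (intro mult_right_mono powr_mono') (auto simp: pos_le_divide_eq)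
      finally have "(?I / ?m4) powr (p / q) \<le> 2 * \<gamma> * r powr (- p)" using \<gamma> by simp
      then have "poincare_const * (4 * r) powr p * ?m4 * (?I / ?m4) powr (p / q) \<le> poincare_const * (4 * r) powr p * ?m4 * (2 * \<gamma> * r powr (- p))"
        using poincare_const_pos by (intro mult_left_mono) auto
      also have "\<dots> = S * ?m4" using r by (simp add: S_def powr_mult powr_minus field_simps)
      finally show "(2 * CARD('a)) powr p * (B powr p * A * 4 * (A * 4 powr (CARD('a) * p))) * (4 * r) powr p * ?m4 *
         ((LINT z:cube x0 (4 * r)|M. ?f z powr q) / ?m4) powr (p / q) \<le> S * ?m4"
        by (simp add: poincare_const_def I4)
    qed
    finally show ?thesis .
  qed
  have cheb: "c * measure M E \<le> S * ?m4" if E: "E \<in> sets borel" "E \<subseteq> cube x0 (4 * r)" and c: "0 \<le> c"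
    and ge: "\<And>x. x \<in> E \<Longrightarrow> c \<le> \<bar>\<phi> x - a\<bar> powr p" for E c
  proof -
    have "ennreal c * emeasure M E = (\<integral>\<^sup>+x. ennreal c * indicator E x \<partial>M)"
      using E by (simp add: nn_integral_cmult_indicator)
    also have "\<dots> \<le> (\<integral>\<^sup>+x\<in>cube x0 (4 * r). ennreal (\<bar>\<phi> x - a\<bar> powr p) \<partial>M)"
      using E ge by (intro nn_integral_mono) (auto simp: indicator_def intro!: ennreal_leI)
    also note W
    also have "emeasure M E = ennreal (measure M E)"
      using M_finite[OF E] by (intro emeasure_eq_ennreal_measure) auto
    finally have "ennreal (c * measure M E) \<le> ennreal (S * ?m4)" using c by (simp add: ennreal_mult)
    then show ?thesis using S m4 by (subst (asm) ennreal_le_iff) auto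
  qed
  have bound: "8 powr p * A * 8 powr (CARD('a) * p) * S \<le> 1 / 2" using \<gamma>(3) by (simp add: S_def)
  have a_small: "\<bar>a\<bar> \<le> 1 / 8"
  proof -
    \<comment> \<open>The subcube in the corner of the cube of radius \<open>4 * r\<close> is
      disjoint from the cube of radius \<open>2 * r\<close>, hence from the support of
      \<phi>.\<close>
    let ?y = "x0 + (3 * r) *\<^sub>R 1"
    let ?C = "cube ?y r"
    have Csub: "?C \<subseteq> cube x0 (4 * r)" using r by (intro cube_subset) (simp add: infnorm_one)
    have mC: "?m4 * (r / (4 * r)) powr (CARD('a) * p) \<le> A * measure M ?C"
      using r by (intro doubling Csub) auto
    have "\<bar>a\<bar> powr p * measure M ?C \<le> S * ?m4"
    proof (rule cheb[OF _ Csub])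
      fix x assume x: "x \<in> ?C"
      have "infnorm (?y - x0) \<le> infnorm (?y - x) + infnorm (x - x0)"
        using infnorm_triangle[of "?y - x" "x - x0"] by simp
      then have "x \<notin> cube x0 (2 * r)" using x r infnorm_sub[of ?y x] infnorm_one[of "3 * r", where 'a='a] by (simp add: mem_cube)
      then have "x \<notin> supp" using cs by blast
      then show "\<bar>a\<bar> powr p \<le> \<bar>\<phi> x - a\<bar> powr p" using out[of x] by simp
    qed auto
    then have "\<bar>a\<bar> powr p * (A * measure M ?C) \<le> A * (S * ?m4)" using A by (simp add: mult.left_commute mult_left_mono)
    moreover have "\<bar>a\<bar> powr p * (?m4 * (r / (4 * r)) powr (CARD('a) * p)) \<le> \<bar>a\<bar> powr p * (A * measure M ?C)"
      using mC by (intro mult_left_mono) auto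
    ultimately have "\<bar>a\<bar> powr p * (?m4 * (r / (4 * r)) powr (CARD('a) * p)) \<le> A * (S * ?m4)" by linarith
    also have "r / (4 * r) = 1 / 4" using r by simp
    finally have "\<bar>a\<bar> powr p \<le> A * 4 powr (CARD('a) * p) * S" using m4 by (simp add: powr_divide field_simps)
    also have "\<dots> \<le> A * 8 powr (CARD('a) * p) * S"
      using A S p by (intro mult_right_mono mult_left_mono powr_mono2) auto
    also have "\<dots> \<le> (1 / 8) powr p"
      using bound by (simp add: powr_divide field_simps)
    finally show ?thesis using powr_less_mono2[of p "1 / 8" "\<bar>a\<bar>"] p by fastforce
  qed
  let ?E = "{x \<in> cube x0 (r / 2). 1 / 4 < \<phi> x}"
  have "{x. 1 / 4 < \<phi> x} \<in> sets borel" by measurable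
  then have "cube x0 (r / 2) \<inter> {x. 1 / 4 < \<phi> x} \<in> sets borel" by (intro sets.Int) auto
  moreover have "?E = cube x0 (r / 2) \<inter> {x. 1 / 4 < \<phi> x}" by blast
  ultimately have E: "?E \<in> sets borel" by simp
  have subh: "cube x0 (r / 2) \<subseteq> cube x0 (4 * r)" using r by (intro cube_subset) (auto simp: infnorm_0)
  have "(1 / 8) powr p * measure M ?E \<le> S * ?m4"
  proof (rule cheb[OF E])
    fix x assume "x \<in> ?E"
    then show "(1 / 8) powr p \<le> \<bar>\<phi> x - a\<bar> powr p" using a_small p by (intro powr_mono2) auto
  qed (use subh in auto)
  then have "measure M ?E \<le> 8 powr p * S * ?m4" by (simp add: powr_divide field_simps)
  also have "?m4 \<le> A * 8 powr (CARD('a) * p) * ?mh"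
  proof -
    have "?m4 * (r / 2 / (4 * r)) powr (CARD('a) * p) \<le> A * ?mh" using r by (intro doubling subh) auto
    also have "r / 2 / (4 * r) = 1 / 8" using r by simp
    finally show ?thesis by (simp add: powr_divide field_simps)
  qed
  finally have "measure M ?E \<le> (8 powr p * A * 8 powr (CARD('a) * p) * S) * ?mh" using S by (simp add: mult_left_mono mult_ac)
  also have "\<dots> \<le> 1 / 2 * ?mh" using bound by (intro mult_right_mono) auto
  finally show ?thesis by simp
qed

end

section \<open>The two estimates\<close>

lemma ennreal_rpow_ennreal: "0 \<le> x \<Longrightarrow> ennreal_rpow (ennreal x) a = ennreal (x powr a)"
  by (simp add: ennreal_rpow_def)

lemma ennreal_rpow_mono:
  assumes "x \<le> ennreal y" "0 \<le> y" "0 \<le> a"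
  shows "ennreal_rpow x a \<le> ennreal (y powr a)"
proof -
  have "x \<noteq> \<infinity>" using assms(1) by (metis ennreal_neq_top infinity_ennreal_def neq_top_trans)
  then obtain z where z: "x = ennreal z" "0 \<le> z" by (cases x) auto
  then have "z \<le> y" using assms by simp
  then show ?thesis using z assms by (simp add: ennreal_rpow_ennreal ennreal_leI powr_mono2)
qed

lemma ennreal_rpow_lower:
  assumes "ennreal y \<le> x" "0 \<le> y" "0 \<le> a"
  shows "ennreal (y powr a) \<le> ennreal_rpow x a"
proof (cases x)
  case (real z)
  then show ?thesis using assms by (simp add: ennreal_rpow_ennreal ennreal_leI powr_mono2)
qed (simp add: ennreal_rpow_def)

context Ap_weight
begin

lemma wmeasure_cube: "wmeasure w (cube x s) = ennreal (measure M (cube x s))"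
proof -
  have "wmeasure w (cube x s) = wintegral w (cube x s) (\<lambda>_. 1)" by (simp add: wmeasure_def wintegral_def)
  also have "\<dots> = emeasure M (cube x s)" by (subst wintegral_eq) auto
  also have "\<dots> = ennreal (measure M (cube x s))"
    using M_finite[OF cube_borel order_refl, of x s] by (intro emeasure_eq_ennreal_measure) auto
  finally show ?thesis .
qed

lemma wintegral_cong: "(\<And>x. x \<in> E \<Longrightarrow> f x = g x) \<Longrightarrow> wintegral w E f = wintegral w E g"
  unfolding wintegral_def by (intro nn_integral_cong) (auto simp: indicator_def)

end

text \<open>The support of \<open>1 - \<phi>\<close> may touch \<open>K\<close>. Cutting off at
  level \<open>1 / 2\<close> separates the support from \<open>K\<close> by a positive distance,
  because \<open>{x. \<phi> x \<le> 1 / 2}\<close> is closed and \<open>K\<close> is compact. Where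
  \<open>\<phi> x \<le> 1 / 4\<close>, the argument of \<open>flat 0\<close> is at least
  \<open>1 / 2\<close>, whence \<open>exp (- 2)\<close>.\<close>

lemma truncation:
  fixes \<phi> :: "real^'a \<Rightarrow> real"
  assumes \<phi>: "smooth_on UNIV \<phi>" and K: "compact K" "\<And>x. x \<in> K \<Longrightarrow> 1 \<le> \<phi> x"
  defines "u \<equiv> \<lambda>x. flat 0 (1 - 2 * \<phi> x)"
  shows "smooth_on UNIV u" "u \<in> smooth_vanishing_near S K" "\<And>x. norm (gradient u x) \<le> 2 * norm (gradient \<phi> x)"
    "\<And>x. \<phi> x \<le> 1 / 4 \<Longrightarrow> exp (- 2) \<le> u x"
proof -
  have cont: "continuous_on UNIV \<phi>" using \<phi> by (rule smooth_on_continuous)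
  have "(\<lambda>x. 1 + (- 2) * \<phi> x) \<in> smooth_closure"
    by (intro smooth_closure.add smooth_closure.mult smooth_closure.base[OF smooth_on_const] smooth_closure.base[OF \<phi>])
  then have i: "smooth_on UNIV (\<lambda>x. 1 + (- 2) * \<phi> x)" by (rule smooth_on_closure)
  show u: "smooth_on UNIV u"
    using smooth_on_closure[OF smooth_closure.flat[OF i, of 0]] by (simp add: u_def)
  have "{x. \<phi> x \<le> 1 / 2} \<inter> K = {}" using K(2) by force
  moreover have "closed {x. \<phi> x \<le> 1 / 2}" using cont by (intro closed_Collect_le) auto
  ultimately obtain d where d: "0 < d" "\<And>x y. \<phi> x \<le> 1 / 2 \<Longrightarrow> y \<in> K \<Longrightarrow> d \<le> dist x y"
    using separate_closed_compact[of "{x. \<phi> x \<le> 1 / 2}" K] K(1) by auto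
  have "supp_in S u \<subseteq> {x. \<phi> x \<le> 1 / 2}"
    unfolding supp_in_def using \<open>closed {x. \<phi> x \<le> 1 / 2}\<close>
    by (intro closure_minimal) (auto simp: u_def flat_def split: if_splits)
  then have "ennreal d \<le> set_dist (supp_in S u) K"
    unfolding set_dist_def using d(2) by (intro INF_greatest) (auto intro!: ennreal_leI)
  then have "0 < set_dist (supp_in S u) K" using d(1) by (meson ennreal_less_zero_iff less_le_trans)
  then show "u \<in> smooth_vanishing_near S K"
    using u by (auto simp: smooth_vanishing_near_def smooth_up_to_def intro!: exI[of _ UNIV])
  show "norm (gradient u x) \<le> 2 * norm (gradient \<phi> x)" for x
  proof -
    have "((\<lambda>x. 1 - 2 * \<phi> x) has_derivative (\<lambda>h. - 2 * (gradient \<phi> x \<bullet> h))) (at x)"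
      by (auto intro!: derivative_eq_intros has_derivative_gradient smooth_on_differentiable \<phi>)
    from has_derivative_compose[OF this flat_has_real_derivative[of 0 "1 - 2 * \<phi> x", unfolded has_field_derivative_def]]
    have "(u has_derivative (\<lambda>h. ((- 2 * flat 2 (1 - 2 * \<phi> x)) *\<^sub>R gradient \<phi> x) \<bullet> h)) (at x)"
      by (simp add: u_def mult_ac numeral_2_eq_2)
    then have "gradient u x = (- 2 * flat 2 (1 - 2 * \<phi> x)) *\<^sub>R gradient \<phi> x" by (rule gradient_eqI)
    then have "norm (gradient u x) = 2 * (\<bar>flat 2 (1 - 2 * \<phi> x)\<bar> * norm (gradient \<phi> x))" by (simp add: abs_mult)
    also have "\<dots> \<le> 2 * (1 * norm (gradient \<phi> x))"
      by (intro mult_left_mono mult_right_mono flat_2_le_1) auto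
    finally show ?thesis by simp
  qed
  show "exp (- 2) \<le> u x" if "\<phi> x \<le> 1 / 4" for x
  proof -
    have "1 / 2 \<le> 1 - 2 * \<phi> x" using that by simp
    then have "- 2 \<le> - 1 / (1 - 2 * \<phi> x)" by (simp add: field_simps)
    then show ?thesis using \<open>1 / 2 \<le> 1 - 2 * \<phi> x\<close> by (simp add: u_def flat_def)
  qed
qed

text \<open>Outside the closed cube \<open>u\<close> is under no global control, so it is replaced
  by the continuous extension that clamps the argument to the cube. The norm of its gradient is
  clamped separately: \<open>f\<close> is not the gradient norm of \<open>v\<close>, and the two are
  linked only by the segment inequality inside the cube.\<close>

lemma vanishing_data:
  fixes u :: "real^'n \<Rightarrow> real"
  assumes r: "0 < r" and u: "u \<in> smooth_vanishing_near (closure (cube x0 r)) K"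
    and K: "K \<subseteq> closure (cube x0 r)"
  obtains v bu f bf where "continuous_on UNIV v" "\<And>y. \<bar>v y\<bar> \<le> bu"
    "continuous_on UNIV f" "\<And>y. 0 \<le> f y" "\<And>y. f y \<le> bf"
    "\<And>x. infnorm (x - x0) \<le> r \<Longrightarrow> v x = u x" "\<And>x. infnorm (x - x0) \<le> r \<Longrightarrow> f x = norm (gradient u x)"
    "\<And>x y. infnorm (x - x0) \<le> r \<Longrightarrow> infnorm (y - x0) \<le> r \<Longrightarrow>
      \<bar>v x - v y\<bar> \<le> norm (x - y) * (\<integral>s. f ((1 - s) *\<^sub>R x + s *\<^sub>R y) \<partial>uniform_measure lborel {0..1})"
    "\<And>x. x \<in> K \<Longrightarrow> v x = 0"
proof -
  let ?a = "x0 - r *\<^sub>R 1" and ?b = "x0 + r *\<^sub>R 1"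
  define S where "S = cbox ?a ?b"
  have S: "S = {x. infnorm (x - x0) \<le> r}" "closure (cube x0 r) = S"
    using r by (auto simp: S_def cbox_eq_infnorm closure_cube)
  have conv: "convex S" by (simp add: S_def)
  obtain U where U: "open U" "S \<subseteq> U" "smooth_on U u"
    using u by (auto simp: smooth_vanishing_near_def smooth_up_to_def S)
  have cu: "continuous_on S u" by (rule continuous_on_subset[OF smooth_on_continuous[OF U(3)] U(2)])
  have cg: "continuous_on S (\<lambda>x. norm (gradient u x))"
    by (intro continuous_on_norm continuous_on_subset[OF continuous_on_gradient[OF U(3)] U(2)])
  have du: "u differentiable (at z)" if "z \<in> U" for z
  proof -
    have "Ck_on 1 U u" using U(3) by (simp add: smooth_on_def)
    then have "u differentiable_on U" by simp
    then have "u differentiable (at z within U)" using that by (simp add: differentiable_on_def)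
    then show ?thesis by (simp only: at_within_open[OF that U(1)])
  qed
  define v where "v = ext_cont u ?a ?b"
  define f where "f = ext_cont (\<lambda>x. norm (gradient u x)) ?a ?b"
  have v: "continuous_on UNIV v" and f: "continuous_on UNIV f"
    unfolding v_def f_def using cu cg by (auto simp: S_def intro!: continuous_on_ext_cont)
  have ve: "v x = u x" if "infnorm (x - x0) \<le> r" for x
    unfolding v_def using that by (intro ext_cont_cancel_cbox) (simp add: cbox_eq_infnorm)
  have fe: "f x = norm (gradient u x)" if "infnorm (x - x0) \<le> r" for x
    unfolding f_def using that by (intro ext_cont_cancel_cbox) (simp add: cbox_eq_infnorm)
  have "bounded (range v)" "bounded (range f)"
    unfolding v_def f_def ext_cont_def
    by (intro clamp_bounded compact_imp_bounded compact_continuous_image; use cu cg in \<open>simp add: S_def\<close>)+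
  then obtain bu bf where b: "\<And>y. \<bar>v y\<bar> \<le> bu" "\<And>y. \<bar>f y\<bar> \<le> bf"
    unfolding bounded_iff by (metis UNIV_I image_eqI real_norm_def)
  show thesis
  proof (rule that[OF v b(1) f _ _ ve fe])
    show "0 \<le> f y" for y by (simp add: f_def ext_cont_def)
    show "f y \<le> bf" for y using b(2)[of y] by simp
    show "\<bar>v x - v y\<bar> \<le> norm (x - y) * (\<integral>s. f ((1 - s) *\<^sub>R x + s *\<^sub>R y) \<partial>uniform_measure lborel {0..1})"
      if "infnorm (x - x0) \<le> r" "infnorm (y - x0) \<le> r" for x y
    proof -
      have "\<bar>u x - u y\<bar> \<le> norm (x - y) * (\<integral>s. f ((1 - s) *\<^sub>R x + s *\<^sub>R y) \<partial>uniform_measure lborel {0..1})"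
        by (rule gradient_upper_gradient[OF conv U(2,1) du f]) (use that fe in \<open>auto simp: S(1)\<close>)
      then show ?thesis using that by (simp add: ve)
    qed
    \<comment> \<open>Otherwise \<open>x\<close> lies both in \<open>K\<close> and in the support of
      \<open>u\<close>, whose distance would be 0.\<close>
    show "v x = 0" if x: "x \<in> K" for x
    proof (rule ccontr)
      assume "v x \<noteq> 0"
      moreover have "x \<in> S" using x K S by auto
      ultimately have "x \<in> supp_in S u" using ve closure_subset[of "{x \<in> S. u x \<noteq> 0}"] by (auto simp: supp_in_def S)
      then have "set_dist (supp_in S u) K \<le> (INF y\<in>K. ennreal (dist x y))"
        unfolding set_dist_def by (rule INF_lower)
      also have "\<dots> \<le> ennreal (dist x x)" using x by (rule INF_lower)
      finally have "set_dist (supp_in S u) K \<le> ennreal (dist x x)" .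
      then show False using u by (simp add: smooth_vanishing_near_def S)
    qed
  qed auto
qed

section \<open>Upper estimate of the Poincare constant by capacity\<close>

context Aq_weight
begin

text \<open>The constant of \<open>mean_Cap_le\<close> with the power \<open>q\<close> enlarged to
  \<open>p\<close>.\<close>

definition mean_const :: real where
  "mean_const = (60 * real CARD('a)) powr p * (1 + B * A * 30 powr (CARD('a) * p))"

text \<open>The leading 2 comes from splitting \<open>u\<close> into its oscillation and its mean,
  and \<open>16 powr p\<close> from the bound \<open>r \<le> 16 * \<kappa>\<close> by the capacity
  quotient.\<close>

definition upper_const :: real where
  "upper_const = 2 * (poincare_const * 16 powr p + mean_const powr p) powr (1 / p)"

lemma mean_const_ge: "1 \<le> mean_const"
proof -
  have "1 \<le> real CARD('a)" by (simp add: Suc_leI)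
  then have "1 \<le> (60 * real CARD('a)) powr p" using p by (intro ge_one_powr_ge_zero) linarith+
  moreover have "1 \<le> 1 + B * A * 30 powr (CARD('a) * p)" using A B by simp
  ultimately show ?thesis unfolding mean_const_def using mult_mono[of 1 _ 1] by fastforce
qed

lemma upper_const_pos: "0 < upper_const"
proof -
  have "0 < poincare_const * 16 powr p + mean_const powr p" using poincare_const_pos mean_const_ge by (intro add_pos_pos mult_pos_pos) auto
  then show ?thesis by (simp add: upper_const_def)
qed

text \<open>The deviation from the mean is bounded by \<open>poincare\<close> with a factor
  \<open>r\<close>, and the mean itself by \<open>mean_Cap_le\<close> with the capacity quotient. If
  the capacity is 0, the quotient is infinite and the inequality carries no information.\<close>

lemma capacity_poincare:
  assumes r: "0 < r" and K: "K \<subseteq> closure (cube x0 r)"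
    and u: "u \<in> smooth_vanishing_near (closure (cube x0 r)) K"
  shows "poincare_ineq p q w x0 r r (ennreal (upper_const / r) * cap_quotient q w K x0 r) u"
proof (cases "Cap q w K (cube x0 (2 * r)) = 0")
  case True
  have "0 < measure M (cube x0 (2 * r))" using r by (intro M_cube_pos) auto
  then have "cap_quotient q w K x0 r = \<infinity>"
    using True by (simp add: cap_quotient_def wmeasure_cube ennreal_rpow_def ennreal_divide_zero)
  then have "ennreal (upper_const / r) * cap_quotient q w K x0 r = \<infinity>"
    using upper_const_pos r by (simp add: ennreal_mult_top)
  then show ?thesis by (simp add: poincare_ineq_def)
next
  case False
  let ?Q = "cube x0 r"
  define m m2 where "m = measure M ?Q" and "m2 = measure M (cube x0 (2 * r))"
  have m: "0 < m" "0 < m2" using r by (auto simp: m_def m2_def intro!: M_cube_pos)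
  have mm: "m \<le> m2" unfolding m_def m2_def using r by (intro measure_cube_mono cube_subset) (auto simp: infnorm_0)
  have cut: "Cap q w K (cube x0 (2 * r)) \<le> ennreal ((16 / r) powr q * m2)"
    using Cap_le_cutoff[OF r K] by (simp add: m2_def)
  then have "Cap q w K (cube x0 (2 * r)) \<noteq> \<infinity>" by (metis ennreal_neq_top infinity_ennreal_def neq_top_trans)
  then obtain cp where cp: "Cap q w K (cube x0 (2 * r)) = ennreal cp" "0 < cp"
    using False by (cases "Cap q w K (cube x0 (2 * r))") (auto simp: order_le_less)
  define \<kappa> where "\<kappa> = (m2 / cp) powr (1 / q)"
  have \<kappa>: "0 < \<kappa>" using m cp by (simp add: \<kappa>_def)
  have cq: "cap_quotient q w K x0 r = ennreal \<kappa>"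
    using m cp by (simp add: cap_quotient_def wmeasure_cube m2_def[symmetric] divide_ennreal ennreal_rpow_ennreal \<kappa>_def)
  \<comment> \<open>The oscillation term carries \<open>r\<close> in place of the capacity quotient;
    the cutoff bound on the capacity allows the exchange.\<close>
  have r\<kappa>: "r \<le> 16 * \<kappa>"
  proof -
    have "cp \<le> (16 / r) powr q * m2" using cut m cp by (simp add: ennreal_le_iff)
    then have "(r / 16) powr q \<le> m2 / cp" using cp r by (simp add: powr_divide field_simps)
    then have "r / 16 \<le> \<kappa>" unfolding \<kappa>_def using r m cp q by (subst (asm) powr_le_iff_root) auto
    then show ?thesis by simp
  qed
  obtain v bu f bf where v: "continuous_on UNIV v" "\<And>y. \<bar>v y\<bar> \<le> bu"
    and f: "continuous_on UNIV f" "\<And>y. 0 \<le> f y" "\<And>y. f y \<le> bf"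
    and eq: "\<And>x. infnorm (x - x0) \<le> r \<Longrightarrow> v x = u x" "\<And>x. infnorm (x - x0) \<le> r \<Longrightarrow> f x = norm (gradient u x)"
    and grad: "\<And>x y. infnorm (x - x0) \<le> r \<Longrightarrow> infnorm (y - x0) \<le> r \<Longrightarrow>
      \<bar>v x - v y\<bar> \<le> norm (x - y) * (\<integral>s. f ((1 - s) *\<^sub>R x + s *\<^sub>R y) \<partial>uniform_measure lborel {0..1})"
    and vK: "\<And>x. x \<in> K \<Longrightarrow> v x = 0"
  proof (rule vanishing_data[OF r u K], goal_cases)
    case 1
    from 1(2-) show ?case by (rule 1(1))
  qed
  have [measurable]: "v \<in> borel_measurable borel" "f \<in> borel_measurable borel"
    using v f by (auto intro: borel_measurable_continuous_onI)
  define I where "I = (LINT z:?Q|M. f z powr q)"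
  have I0: "0 \<le> I" unfolding I_def set_lebesgue_integral_def by (intro integral_nonneg_AE) auto
  define a where "a = cube_mean v x0 (r / 2)"
  define J where "J = (I / m) powr (1 / q)"
  have J0: "0 \<le> J" by (simp add: J_def)
  have Jp: "(I / m) powr (p / q) = J powr p" by (simp add: J_def powr_powr)
  have P: "(\<integral>\<^sup>+x\<in>?Q. ennreal (\<bar>v x - a\<bar> powr p) \<partial>M) \<le> ennreal (poincare_const * r powr p * m * J powr p)"
    using poincare[OF f v r grad] by (simp add: poincare_const_def m_def I_def a_def Jp[symmetric])
  have a: "\<bar>a\<bar> \<le> mean_const * \<kappa> * J"
  proof -
    have "ennreal (\<bar>a\<bar> powr q) * ennreal cp \<le>
      ennreal ((60 * real CARD('a)) powr q * ((1 + B * A * 30 powr (CARD('a) * p)) * I))"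
      using mean_Cap_le[OF f v r grad K vK] by (simp add: cp a_def I_def)
    then have "\<bar>a\<bar> powr q * cp \<le> (60 * real CARD('a)) powr q * ((1 + B * A * 30 powr (CARD('a) * p)) * I)"
      using cp I0 A B by (simp add: ennreal_mult[symmetric])
    also have "\<dots> \<le> (60 * real CARD('a)) powr p * ((1 + B * A * 30 powr (CARD('a) * p)) * I)"
    proof (intro mult_right_mono powr_mono)
      have "1 \<le> real CARD('a)" by (simp add: Suc_leI)
      then show "1 \<le> 60 * real CARD('a)" by linarith
    qed (use q A B I0 in auto)
    finally have "\<bar>a\<bar> powr q * cp \<le> mean_const * I" by (simp add: mean_const_def mult_ac)
    then have "\<bar>a\<bar> powr q \<le> mean_const * (I / cp)" using cp by (simp add: field_simps)
    also have "I / cp = I / m * (m / cp)" using m by simp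
    \<comment> \<open>The energy is normalised by the mass of the cube of radius \<open>r\<close>,
      the capacity by that of radius \<open>2 * r\<close>; here monotonicity of the mass is
      sufficient.\<close>
    also have "\<dots> \<le> I / m * (m2 / cp)" using I0 m mm cp by (intro mult_left_mono divide_right_mono) auto
    finally have "\<bar>a\<bar> powr q \<le> mean_const * (I / m * (m2 / cp))" using mean_const_ge by (simp add: mult_left_mono)
    then have "\<bar>a\<bar> \<le> (mean_const * (I / m * (m2 / cp))) powr (1 / q)"
      using mean_const_ge I0 m cp q by (subst (asm) powr_le_iff_root) auto
    also have "\<dots> = mean_const powr (1 / q) * (J * \<kappa>)"
      using mean_const_ge I0 m cp by (simp add: powr_mult J_def \<kappa>_def del: times_divide_eq_left times_divide_eq_right)
    also have "\<dots> \<le> mean_const powr 1 * (J * \<kappa>)"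
      using mean_const_ge q J0 \<kappa> by (intro mult_right_mono powr_mono) auto
    finally show ?thesis using mean_const_ge by (simp add: mult_ac)
  qed
  define X where "X = (poincare_const * 16 powr p + mean_const powr p) * (2 / r * \<kappa> * J) powr p"
  have X0: "0 \<le> X" using poincare_const_pos by (simp add: X_def)
  have W: "wintegral w ?Q (\<lambda>x. \<bar>u x / r\<bar> powr p) \<le> ennreal (X * m)"
  proof -
    have "wintegral w ?Q (\<lambda>x. \<bar>u x / r\<bar> powr p) = wintegral w ?Q (\<lambda>x. \<bar>v x / r\<bar> powr p)"
      by (rule wintegral_cong) (simp add: eq(1) mem_cube)
    also have "\<dots> = (\<integral>\<^sup>+x\<in>?Q. ennreal (\<bar>v x / r\<bar> powr p) \<partial>M)" by (rule wintegral_eq) auto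
    also have "\<dots> \<le> (\<integral>\<^sup>+x. ennreal ((2 / r) powr p) * (ennreal (\<bar>v x - a\<bar> powr p) * indicator ?Q x) +
        ennreal ((2 / r) powr p * \<bar>a\<bar> powr p) * indicator ?Q x \<partial>M)"
    proof (intro nn_integral_mono)
      fix x
      have "\<bar>v x / r\<bar> powr p \<le> (2 / r * max \<bar>v x - a\<bar> \<bar>a\<bar>) powr p"
      proof (rule powr_mono2)
        have "\<bar>v x\<bar> \<le> \<bar>v x - a\<bar> + \<bar>a\<bar>" by linarith
        also have "\<dots> \<le> 2 * max \<bar>v x - a\<bar> \<bar>a\<bar>"
          using max.cobounded1[of "\<bar>v x - a\<bar>" "\<bar>a\<bar>"] max.cobounded2[of "\<bar>a\<bar>" "\<bar>v x - a\<bar>"] by linarith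
        finally show "\<bar>v x / r\<bar> \<le> 2 / r * max \<bar>v x - a\<bar> \<bar>a\<bar>" using r by (simp add: divide_right_mono)
      qed (use p in auto)
      also have "\<dots> = (2 / r) powr p * max \<bar>v x - a\<bar> \<bar>a\<bar> powr p" using r by (subst powr_mult) auto
      also have "\<dots> \<le> (2 / r) powr p * (\<bar>v x - a\<bar> powr p + \<bar>a\<bar> powr p)"
        by (intro mult_left_mono) (auto simp: max_def)
      finally show "ennreal (\<bar>v x / r\<bar> powr p) * indicator ?Q x \<le> ennreal ((2 / r) powr p) * (ennreal (\<bar>v x - a\<bar> powr p) * indicator ?Q x) +
        ennreal ((2 / r) powr p * \<bar>a\<bar> powr p) * indicator ?Q x"
        by (auto simp: indicator_def ennreal_mult[symmetric] ennreal_plus[symmetric] distrib_left intro!: ennreal_leI simp del: ennreal_plus)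
    qed
    also have "\<dots> = ennreal ((2 / r) powr p) * (\<integral>\<^sup>+x\<in>?Q. ennreal (\<bar>v x - a\<bar> powr p) \<partial>M) + ennreal ((2 / r) powr p * \<bar>a\<bar> powr p) * emeasure M ?Q"
      by (subst nn_integral_add) (auto simp: nn_integral_cmult nn_integral_cmult_indicator)
    also have "\<dots> \<le> ennreal ((2 / r) powr p) * ennreal (poincare_const * r powr p * m * J powr p) + ennreal ((2 / r) powr p * \<bar>a\<bar> powr p) * ennreal m"
      unfolding emeasure_cube_eq m_def[symmetric] by (intro add_mono mult_left_mono P) auto
    also have "\<dots> = ennreal ((2 / r) powr p * (poincare_const * r powr p * m * J powr p) + (2 / r) powr p * \<bar>a\<bar> powr p * m)"
      using poincare_const_pos m by (simp add: ennreal_mult[symmetric] ennreal_plus[symmetric] del: ennreal_plus)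
    also have "\<dots> \<le> ennreal (X * m)"
    proof (rule ennreal_leI)
      have "r powr p \<le> (16 * \<kappa>) powr p" using r r\<kappa> p by (intro powr_mono2) auto
      then have 1: "r powr p \<le> 16 powr p * \<kappa> powr p" using \<kappa> by (simp add: powr_mult)
      have "\<bar>a\<bar> powr p \<le> (mean_const * \<kappa> * J) powr p" using a p by (intro powr_mono2) auto
      then have 2: "\<bar>a\<bar> powr p \<le> mean_const powr p * (\<kappa> powr p * J powr p)" using \<kappa> J0 mean_const_ge by (simp add: powr_mult)
      have X: "X * m = (2 / r) powr p * (poincare_const * (16 powr p * \<kappa> powr p) * m * J powr p) + (2 / r) powr p * (mean_const powr p * (\<kappa> powr p * J powr p)) * m"
        using r \<kappa> J0 by (simp add: X_def powr_mult algebra_simps del: times_divide_eq_left times_divide_eq_right)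
      show "(2 / r) powr p * (poincare_const * r powr p * m * J powr p) + (2 / r) powr p * \<bar>a\<bar> powr p * m \<le> X * m"
        unfolding X using 1 2 poincare_const_pos m by (intro add_mono mult_left_mono mult_right_mono) auto
    qed
    finally show ?thesis .
  qed
  have "wintegral w ?Q (\<lambda>x. \<bar>u x / r\<bar> powr p) / wmeasure w ?Q \<le> ennreal (X * m) / ennreal m"
    unfolding wmeasure_cube m_def[symmetric] by (intro divide_right_mono_ennreal W)
  also have "\<dots> = ennreal X" using m X0 by (simp add: divide_ennreal)
  finally have "ennreal_rpow (wintegral w ?Q (\<lambda>x. \<bar>u x / r\<bar> powr p) / wmeasure w ?Q) (1 / p) \<le> ennreal (X powr (1 / p))"
    using X0 p by (intro ennreal_rpow_mono) auto
  also have "X powr (1 / p) = upper_const / r * \<kappa> * J"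
  proof -
    have "X powr (1 / p) = (poincare_const * 16 powr p + mean_const powr p) powr (1 / p) * (2 / r * \<kappa> * J)"
      unfolding X_def using poincare_const_pos r \<kappa> J0 p by (subst powr_mult) (auto simp: powr_powr)
    then show ?thesis by (simp add: upper_const_def)
  qed
  also have "ennreal (upper_const / r * \<kappa> * J) = ennreal (upper_const / r) * ennreal \<kappa> * ennreal J"
    using upper_const_pos r \<kappa> J0 by (simp add: ennreal_mult del: times_divide_eq_left)
  also have "ennreal J = ennreal_rpow (wintegral w ?Q (\<lambda>x. norm (gradient u x) powr q) / wmeasure w ?Q) (1 / q)"
  proof -
    have "wintegral w ?Q (\<lambda>x. norm (gradient u x) powr q) = wintegral w ?Q (\<lambda>x. f x powr q)"
      by (rule wintegral_cong) (simp add: eq(2) mem_cube)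
    also have "\<dots> = ennreal I" by (subst wintegral_eq) (auto simp: nn_integral_powr[OF f(1,2)] I_def)
    finally show ?thesis using m I0 by (simp add: wmeasure_cube m_def[symmetric] divide_ennreal ennreal_rpow_ennreal J_def)
  qed
  finally show ?thesis by (simp add: poincare_ineq_def cq)
qed

section \<open>Lower estimate for negligible sets\<close>

definition small_const :: real where
  "small_const = min (1 / 4) (1 / (4 * (8 powr p * A * 8 powr (CARD('a) * p) * (poincare_const * 4 powr p))))"

text \<open>\<open>exp (- 2)\<close> is the value reached by the truncation. The 4 combines the half
  of the cube on which it is reached and the factor 2 in its gradient; the rest compares the masses
  of the cubes of radii \<open>r\<close> and \<open>2 * r\<close>.\<close>

definition lower_const :: real where
  "lower_const = exp (- 2) / (4 * (A * 2 powr (CARD('a) * p)))"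

text \<open>These are the requirements of \<open>superlevel_small\<close>. \<open>1 / 4\<close>
  secures the bounds on \<gamma> itself, and the other term of the minimum solves the last
  inequality with equality.\<close>

lemma small_const_bounds: "0 < small_const" "small_const < 1 / 2" "2 * small_const \<le> 1"
  "8 powr p * A * 8 powr (CARD('a) * p) * (poincare_const * 4 powr p * (2 * small_const)) \<le> 1 / 2"
proof -
  define Z where "Z = 8 powr p * A * 8 powr (CARD('a) * p) * (poincare_const * 4 powr p)"
  have Z: "0 < Z" using A poincare_const_pos by (simp add: Z_def)
  have g: "small_const = min (1 / 4) (1 / (4 * Z))" by (simp add: small_const_def Z_def)
  show "0 < small_const" "small_const < 1 / 2" "2 * small_const \<le> 1" using Z by (auto simp: g min_def)
  have "Z * (2 * small_const) \<le> Z * (2 * (1 / (4 * Z)))" using Z by (intro mult_left_mono) (auto simp: g)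
  also have "\<dots> = 1 / 2" using Z by simp
  finally show "8 powr p * A * 8 powr (CARD('a) * p) * (poincare_const * 4 powr p * (2 * small_const)) \<le> 1 / 2"
    by (simp add: Z_def mult_ac)
qed

lemma lower_const_pos: "0 < lower_const"
  using A by (simp add: lower_const_def)

text \<open>Truncated near-optimal test functions make the left side of the inequality at least a
  multiple of \<open>1 / r\<close>, while its right side is \<open>C\<close> times the normalised
  capacity. Solving for \<open>C\<close> gives the quotient.\<close>

lemma capacity_necessary:
  assumes r: "0 < r" and K: "K \<in> negligible_sets w small_const q x0 r"
    and ineq: "\<And>u. u \<in> smooth_vanishing_near (closure (cube x0 r)) K \<Longrightarrow> poincare_ineq p q w x0 (r / 2) r C u"
  shows "ennreal (lower_const / r) * cap_quotient q w K x0 r \<le> C"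
proof (cases "C = \<infinity>")
  case True
  then show ?thesis by simp
next
  case False
  then obtain cc where C: "C = ennreal cc" "0 \<le> cc" by (cases C) auto
  let ?U = "cube x0 (2 * r)"
  define m1 m2 mh where "m1 = measure M (cube x0 r)" and "m2 = measure M ?U" and "mh = measure M (cube x0 (r / 2))"
  have m: "0 < m1" "0 < m2" "0 < mh" using r by (auto simp: m1_def m2_def mh_def intro!: M_cube_pos)
  have Kc: "closed K" "K \<subseteq> closure (cube x0 r)" using K by (auto simp: negligible_sets_def)
  have "bounded K" using Kc(2) bounded_subset[OF bounded_closure[OF bounded_cube]] by blast
  then have Kcomp: "compact K" using Kc by (simp add: compact_eq_bounded_closed)
  have capneg: "Cap q w K ?U / ennreal m2 \<le> ennreal (small_const * r powr (- q))"
    using K by (simp add: negligible_sets_def wmeasure_cube m2_def)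
  have capfin: "Cap q w K ?U \<le> ennreal ((16 / r) powr q * m2)"
    using Cap_le_cutoff[OF r Kc(2)] by (simp add: m2_def)
  then have "Cap q w K ?U \<noteq> \<infinity>" by (metis ennreal_neq_top infinity_ennreal_def neq_top_trans)
  then obtain cp where cp: "Cap q w K ?U = ennreal cp" "0 \<le> cp" by (cases "Cap q w K ?U") auto
  have "cp / m2 \<le> small_const * r powr (- q)"
    using capneg cp m small_const_bounds by (simp add: divide_ennreal)
  then have cpg: "cp \<le> small_const * r powr (- q) * m2" using m by (simp add: field_simps)
  have "0 < small_const * r powr (- q) * m2" using small_const_bounds r m by simp
  \<comment> \<open>The infimum need not be attained; the strict inequality leaves room for energies
    between the capacity and the threshold of \<open>superlevel_small\<close>.\<close>
  then have cpg2: "cp < 2 * small_const * r powr (- q) * m2" using cpg by linarith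
  define L where "L = exp (- 2) / (4 * r)"
  have L: "0 < L" using r by (simp add: L_def)
  have key: "L powr q * m1 \<le> cc powr q * i"
    if \<phi>: "\<phi> \<in> test_functions ?U" "\<And>x. x \<in> K \<Longrightarrow> 1 \<le> \<phi> x"
      and i: "i = (LINT z:?U|M. norm (gradient \<phi> z) powr q)" and small: "i \<le> 2 * small_const * r powr (- q) * m2" for \<phi> i
  proof -
    have sm: "smooth_on UNIV \<phi>" using \<phi>(1) by (simp add: test_functions_def)
    define u where "u = (\<lambda>x. flat 0 (1 - 2 * \<phi> x))"
    note tr = truncation[OF sm Kcomp \<phi>(2), folded u_def]
    have cg: "continuous_on UNIV (gradient \<phi>)" using sm by (rule continuous_on_gradient)
    have cphi: "continuous_on UNIV \<phi>" using sm by (rule smooth_on_continuous)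
    have [measurable]: "\<phi> \<in> borel_measurable borel" "gradient \<phi> \<in> borel_measurable borel"
      using cg cphi by (auto intro: borel_measurable_continuous_onI)
    have i0: "0 \<le> i" unfolding i set_lebesgue_integral_def by (intro integral_nonneg_AE) auto
    let ?E = "{x \<in> cube x0 (r / 2). 1 / 4 < \<phi> x}"
    have E: "?E = cube x0 (r / 2) \<inter> {x. 1 / 4 < \<phi> x}" by blast
    have Eb: "?E \<in> sets borel" unfolding E by measurable
    have mE: "measure M ?E \<le> mh / 2"
      using superlevel_small[OF r \<phi>(1) small_const_bounds(1,3,4)] small by (simp add: i m2_def mh_def)
    let ?G = "cube x0 (r / 2) - ?E"
    have mG: "mh / 2 \<le> measure M ?G"
    proof -
      have "measure M ?G = mh - measure M ?E"
        unfolding mh_def using M_finite[OF cube_borel order_refl, of x0 "r / 2"] Eb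
        by (intro measure_Diff) (auto simp: less_top[symmetric])
      then show ?thesis using mE by simp
    qed
    have Gb: "?G \<in> sets borel" using Eb by (intro sets.Diff) auto
    have "emeasure M ?G = ennreal (measure M ?G)"
      using M_finite[OF Gb, of x0 "r / 2"] by (intro emeasure_eq_ennreal_measure) auto
    define l where "l = (exp (- 2) / r) powr p"
    have "ennreal (l * (mh / 2)) \<le> wintegral w (cube x0 (r / 2)) (\<lambda>x. \<bar>u x / r\<bar> powr p)"
    proof -
      have um: "u \<in> borel_measurable borel"
        using smooth_on_continuous[OF tr(1)] by (rule borel_measurable_continuous_onI)
      have "ennreal (l * (mh / 2)) \<le> ennreal l * emeasure M ?G"
      proof -
        have "0 \<le> l" by (simp add: l_def)
        then have "l * (mh / 2) \<le> l * measure M ?G" using mG by (intro mult_left_mono) auto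
        then show ?thesis unfolding \<open>emeasure M ?G = ennreal (measure M ?G)\<close>
          using \<open>0 \<le> l\<close> by (simp only: ennreal_mult[symmetric] measure_nonneg ennreal_leI)
      qed
      also have "\<dots> = (\<integral>\<^sup>+x. ennreal l * indicator ?G x \<partial>M)" using Gb by (simp add: nn_integral_cmult_indicator)
      also have "\<dots> \<le> (\<integral>\<^sup>+x\<in>cube x0 (r / 2). ennreal (\<bar>u x / r\<bar> powr p) \<partial>M)"
      proof (intro nn_integral_mono)
        fix x
        show "ennreal l * indicator ?G x \<le> ennreal (\<bar>u x / r\<bar> powr p) * indicator (cube x0 (r / 2)) x"
        proof (cases "x \<in> ?G")
          case True
          then have "\<phi> x \<le> 1 / 4" by auto
          then have "exp (- 2) \<le> u x" using truncation(4)[OF sm Kcomp \<phi>(2), of x] by (simp add: u_def)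
          then have "exp (- 2) / r \<le> \<bar>u x / r\<bar>" using r by (auto simp: divide_right_mono abs_of_nonneg intro!: order_trans[OF divide_right_mono abs_ge_self])
          then have "l \<le> \<bar>u x / r\<bar> powr p" unfolding l_def using r p by (intro powr_mono2) auto
          then show ?thesis using True by (simp add: ennreal_leI)
        qed simp
      qed
      also have "\<dots> = wintegral w (cube x0 (r / 2)) (\<lambda>x. \<bar>u x / r\<bar> powr p)"
        using um by (intro wintegral_eq[symmetric]) auto
      finally show ?thesis .
    qed
    then have "ennreal (l * (mh / 2)) / ennreal mh \<le> wintegral w (cube x0 (r / 2)) (\<lambda>x. \<bar>u x / r\<bar> powr p) / wmeasure w (cube x0 (r / 2))"
      by (simp add: wmeasure_cube mh_def[symmetric] divide_right_mono_ennreal)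
    then have low: "ennreal (l / 2) \<le> wintegral w (cube x0 (r / 2)) (\<lambda>x. \<bar>u x / r\<bar> powr p) / wmeasure w (cube x0 (r / 2))"
      using m by (simp add: divide_ennreal l_def)
    have up: "wintegral w (cube x0 r) (\<lambda>x. norm (gradient u x) powr q) / wmeasure w (cube x0 r) \<le> ennreal (2 powr q * i / m1)"
    proof -
      have [measurable]: "gradient u \<in> borel_measurable borel"
        using continuous_on_gradient[OF tr(1)] by (rule borel_measurable_continuous_onI)
      have sub: "cube x0 r \<subseteq> ?U" using r by (intro cube_subset) (auto simp: infnorm_0)
      have "wintegral w (cube x0 r) (\<lambda>x. norm (gradient u x) powr q) = (\<integral>\<^sup>+x\<in>cube x0 r. ennreal (norm (gradient u x) powr q) \<partial>M)"
        by (rule wintegral_eq) auto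
      also have "\<dots> \<le> (\<integral>\<^sup>+x. ennreal (2 powr q) * (ennreal (norm (gradient \<phi> x) powr q) * indicator ?U x) \<partial>M)"
      proof (intro nn_integral_mono)
        fix x
        have "norm (gradient u x) powr q \<le> (2 * norm (gradient \<phi> x)) powr q"
          using tr(3)[of x] q by (intro powr_mono2) auto
        then have "ennreal (norm (gradient u x) powr q) \<le> ennreal (2 powr q) * ennreal (norm (gradient \<phi> x) powr q)"
          by (simp add: powr_mult ennreal_mult[symmetric] ennreal_leI)
        then show "ennreal (norm (gradient u x) powr q) * indicator (cube x0 r) x \<le>
            ennreal (2 powr q) * (ennreal (norm (gradient \<phi> x) powr q) * indicator ?U x)"
          using sub by (auto simp: indicator_def)
      qed
      also have "\<dots> = ennreal (2 powr q) * (\<integral>\<^sup>+x\<in>?U. ennreal (norm (gradient \<phi> x) powr q) \<partial>M)"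
        by (rule nn_integral_cmult) measurable
      also have "(\<integral>\<^sup>+x\<in>?U. ennreal (norm (gradient \<phi> x) powr q) \<partial>M) = ennreal i"
        unfolding i by (rule nn_integral_powr) (auto intro: continuous_on_norm cg)
      also have "ennreal (2 powr q) * ennreal i = ennreal (2 powr q * i)" using i0 by (simp add: ennreal_mult)
      finally have "wintegral w (cube x0 r) (\<lambda>x. norm (gradient u x) powr q) / ennreal m1 \<le> ennreal (2 powr q * i) / ennreal m1"
        by (rule divide_right_mono_ennreal)
      then show ?thesis using i0 m by (simp add: wmeasure_cube m1_def[symmetric] divide_ennreal)
    qed
    have "ennreal ((l / 2) powr (1 / p)) \<le> ennreal_rpow
       (wintegral w (cube x0 (r / 2)) (\<lambda>x. \<bar>u x / r\<bar> powr p) / wmeasure w (cube x0 (r / 2))) (1 / p)"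
      using p by (intro ennreal_rpow_lower low) (auto simp: l_def)
    also have "\<dots> \<le> C * ennreal_rpow
       (wintegral w (cube x0 r) (\<lambda>x. norm (gradient u x) powr q) / wmeasure w (cube x0 r)) (1 / q)"
      using ineq[OF tr(2)] False by (simp add: poincare_ineq_def)
    also have "\<dots> \<le> C * ennreal ((2 powr q * i / m1) powr (1 / q))"
      using up i0 m q by (intro mult_left_mono ennreal_rpow_mono) auto
    finally have "(l / 2) powr (1 / p) \<le> cc * (2 powr q * i / m1) powr (1 / q)"
      using C i0 m by (simp add: ennreal_mult[symmetric])
    moreover have "exp (- 2) / r / 2 \<le> (l / 2) powr (1 / p)"
    proof -
      \<comment> \<open>The root of \<open>1 / 2\<close> is replaced by \<open>1 / 2\<close>, which
        removes the exponent \<open>p\<close> from the constant.\<close>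
      have "(1 / 2) powr 1 \<le> (1 / 2 :: real) powr (1 / p)" using p by (intro powr_mono') auto
      then have "exp (- 2) / r * (1 / 2) \<le> exp (- 2) / r * (1 / 2) powr (1 / p)"
        using r by (intro mult_left_mono) auto
      moreover have "exp (- 2) / r = l powr (1 / p)" using r p by (simp add: l_def powr_powr)
      moreover have "(l * (1 / 2)) powr (1 / p) = l powr (1 / p) * (1 / 2) powr (1 / p)" by (rule powr_mult)
      ultimately show ?thesis by simp
    qed
    moreover have "(2 powr q * i / m1) powr (1 / q) = 2 * (i / m1) powr (1 / q)"
    proof -
      have "(2 powr q * i / m1) powr (1 / q) = (2 powr q * (i / m1)) powr (1 / q)" by simp
      also have "\<dots> = (2 powr q) powr (1 / q) * (i / m1) powr (1 / q)" by (rule powr_mult)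
      also have "(2 powr q) powr (1 / q) = (2::real)" using q by (simp add: powr_powr)
      finally show ?thesis .
    qed
    moreover have half_le: "X / 2 \<le> Y" if "X \<le> 2 * Y" for X Y :: real using that by simp
    ultimately have "exp (- 2) / r / 2 \<le> cc * (2 * (i / m1) powr (1 / q))" by simp
    also have "\<dots> = 2 * (cc * (i / m1) powr (1 / q))" by simp
    finally have "exp (- 2) / r / 2 / 2 \<le> cc * (i / m1) powr (1 / q)" by (rule half_le)
    then have "L \<le> cc * (i / m1) powr (1 / q)" by (simp add: L_def mult.commute)
    then have "L powr q \<le> (cc * (i / m1) powr (1 / q)) powr q" using L q by (intro powr_mono2) auto
    also have "\<dots> = cc powr q * (i / m1)" using C i0 m q by (simp add: powr_mult powr_powr)
    finally show ?thesis using m by (simp add: field_simps)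
  qed
  \<comment> \<open>Each energy level \<open>y\<close> above the capacity is undercut by an actual
    test function, to which \<open>key\<close> applies.\<close>
  have le_y: "L powr q * m1 \<le> cc powr q * y" if y: "cp < y" "y < 2 * small_const * r powr (- q) * m2" for y
  proof -
    have "Cap q w K ?U < ennreal y" using y cp by (simp add: ennreal_less_iff)
    then obtain \<phi> where \<phi>: "\<phi> \<in> test_functions ?U" "\<forall>x\<in>K. 1 \<le> \<phi> x"
        "wintegral w ?U (\<lambda>x. norm (gradient \<phi> x) powr q) < ennreal y"
      unfolding Cap_def INF_less_iff by blast
    let ?i = "LINT z:?U|M. norm (gradient \<phi> z) powr q"
    have i0: "0 \<le> ?i" unfolding set_lebesgue_integral_def by (intro integral_nonneg_AE) auto
    have cg: "continuous_on UNIV (gradient \<phi>)" using \<phi>(1) by (simp add: test_functions_def continuous_on_gradient)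
    have [measurable]: "gradient \<phi> \<in> borel_measurable borel" using cg by (rule borel_measurable_continuous_onI)
    have "wintegral w ?U (\<lambda>x. norm (gradient \<phi> x) powr q) = (\<integral>\<^sup>+x\<in>?U. ennreal (norm (gradient \<phi> x) powr q) \<partial>M)"
      by (rule wintegral_eq) auto
    also have "\<dots> = ennreal ?i" by (rule nn_integral_powr) (auto intro: continuous_on_norm cg)
    finally have iy: "?i < y" using \<phi>(3) i0 by (simp add: ennreal_less_iff)
    have "L powr q * m1 \<le> cc powr q * ?i" using \<phi> iy y by (intro key[OF _ _ refl]) auto
    also have "\<dots> \<le> cc powr q * y" using iy by (intro mult_left_mono) auto
    finally show ?thesis .
  qed
  \<comment> \<open>Here \<open>y\<close> decreases to the capacity; the limit is taken after
    dividing by \<open>cc powr q\<close>, so \<open>cc = 0\<close> is treated apart.\<close>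
  have le: "L powr q * m1 \<le> cc powr q * cp"
  proof (cases "cc = 0")
    case True
    obtain y where "cp < y" "y < 2 * small_const * r powr (- q) * m2" using cpg2 dense by blast
    then show ?thesis using le_y True by simp
  next
    case False
    then have c: "0 < cc powr q" using C by simp
    have "L powr q * m1 / cc powr q \<le> cp"
    proof (rule dense_ge_bounded[OF cpg2])
      fix y assume "cp < y" "y < 2 * small_const * r powr (- q) * m2"
      then show "L powr q * m1 / cc powr q \<le> y" using le_y c by (simp add: pos_divide_le_eq mult.commute)
    qed
    then show ?thesis using c by (simp add: pos_divide_le_eq mult.commute)
  qed
  \<comment> \<open>A finite \<open>C\<close> forces a positive capacity, so the quotient below is a
    real number.\<close>
  have "0 < cp"
  proof (rule ccontr)
    assume "\<not> 0 < cp"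
    then have "L powr q * m1 \<le> 0" using le cp by simp
    then show False using L m by (simp add: mult_le_0_iff)
  qed
  define D where "D = A * 2 powr (CARD('a) * p)"
  have D: "1 \<le> D" using A p mult_mono[of 1 A 1 "2 powr (CARD('a) * p)"] by (simp add: D_def ge_one_powr_ge_zero)
  have mD: "m2 \<le> D * m1"
  proof -
    have "m2 * (r / (2 * r)) powr (CARD('a) * p) \<le> A * m1"
      unfolding m1_def m2_def using r by (intro doubling cube_subset) (auto simp: infnorm_0)
    also have "r / (2 * r) = 1 / 2" using r by simp
    finally show ?thesis by (simp add: D_def powr_divide field_simps)
  qed
  have "(L / D) powr q * (m2 / cp) \<le> cc powr q"
  proof -
    \<comment> \<open>One factor \<open>D\<close> compensates the passage from \<open>m2\<close> to
      \<open>m1\<close>, and \<open>D \<ge> 1\<close> lets it be absorbed under the power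
      \<open>q\<close>.\<close>
    have "(1 / D) powr q \<le> (1 / D) powr 1" using D q by (intro powr_mono') auto
    then have "L powr q * (1 / D) powr q \<le> L powr q * (1 / D)"
      using D by (intro mult_left_mono) auto
    then have "(L / D) powr q \<le> L powr q * (1 / D)"
      by (simp only: powr_mult[symmetric]) simp
    then have "(L / D) powr q * m2 \<le> L powr q * (1 / D) * (D * m1)"
      using mD m D by (intro mult_mono) auto
    also have "\<dots> = L powr q * m1" using D by simp
    also note le
    finally show ?thesis using \<open>0 < cp\<close> by (simp add: pos_divide_le_eq)
  qed
  then have "((L / D) powr q * (m2 / cp)) powr (1 / q) \<le> (cc powr q) powr (1 / q)"
    using m \<open>0 < cp\<close> q by (intro powr_mono2) auto
  then have "L / D * (m2 / cp) powr (1 / q) \<le> cc"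
  proof -
    have "q * (1 / q) = 1" using q by simp
    then have "((L / D) powr q) powr (1 / q) = L / D" "(cc powr q) powr (1 / q) = cc"
      using L D C by (simp_all only: powr_powr) simp_all
    moreover have "((L / D) powr q * (m2 / cp)) powr (1 / q) = ((L / D) powr q) powr (1 / q) * (m2 / cp) powr (1 / q)"
      by (rule powr_mult)
    moreover note \<open>((L / D) powr q * (m2 / cp)) powr (1 / q) \<le> (cc powr q) powr (1 / q)\<close>
    ultimately show ?thesis by simp
  qed
  moreover have "lower_const / r = L / D" using r by (simp add: lower_const_def L_def D_def)
  moreover have "cap_quotient q w K x0 r = ennreal ((m2 / cp) powr (1 / q))"
    using m \<open>0 < cp\<close> cp by (simp add: cap_quotient_def wmeasure_cube m2_def[symmetric] divide_ennreal ennreal_rpow_ennreal)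
  ultimately show ?thesis using L D C by (simp add: ennreal_mult[symmetric] ennreal_leI)
qed

end

section \<open>Borel versions of weights\<close>

text \<open>A weight is only Lebesgue measurable and positive almost everywhere; changing it on a
  null set alters none of the integrals in the theorem.\<close>

lemma weight_borel_version:
  fixes \<mu> :: "real^'n \<Rightarrow> real"
  assumes "weight \<mu>"
  obtains w where "w \<in> borel_measurable borel" "\<And>x. 0 \<le> w x" "AE x in lebesgue. \<mu> x = w x"
    "AE x in lborel. 0 < w x" "\<And>x s. set_integrable lborel (cube x s) w"
proof -
  have ai: "set_integrable lebesgue S \<mu>" if "compact S" for S
    using assms that by (auto simp: weight_def)
  have pos: "AE x in lebesgue. 0 < \<mu> x" using assms by (simp add: weight_def)
  \<comment> \<open>Integrability is given on compact sets only, so measurability comes from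
    exhausting the space by balls.\<close>
  have "\<mu> \<in> borel_measurable lebesgue"
  proof (rule borel_measurable_LIMSEQ_real)
    show "(\<lambda>x. indicator (cball 0 (real i)) x *\<^sub>R \<mu> x) \<in> borel_measurable lebesgue" for i
      using ai[of "cball 0 (real i)"] by (auto simp: set_integrable_def)
    fix x :: "real^'n"
    obtain N :: nat where N: "norm x \<le> real N" using real_arch_simple by blast
    have "\<forall>\<^sub>F i in sequentially. indicator (cball 0 (real i)) x *\<^sub>R \<mu> x = \<mu> x"
      using eventually_ge_at_top[of N] by eventually_elim (use N in \<open>auto simp: indicator_def\<close>)
    then show "(\<lambda>i. indicator (cball 0 (real i)) x *\<^sub>R \<mu> x) \<longlonglongrightarrow> \<mu> x"
      by (rule tendsto_eventually)
  qed
  then obtain w0 where w0: "w0 \<in> borel_measurable lborel" "AE x in lborel. \<mu> x = w0 x"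
    using completion_ex_borel_measurable_real by blast
  define w where "w x = max 0 (w0 x)" for x
  have w: "w \<in> borel_measurable borel" using w0(1) by (auto simp: w_def[abs_def])
  have eq0: "AE x in lebesgue. \<mu> x = w0 x" using w0(2) by (rule AE_completion)
  have eq: "AE x in lebesgue. \<mu> x = w x" using eq0 pos by eventually_elim (auto simp: w_def)
  have "AE x in lebesgue. 0 < w x" using eq pos by eventually_elim auto
  then have posw: "AE x in lborel. 0 < w x" using w by (subst (asm) AE_completion_iff) auto
  have "set_integrable lborel (cube x s) w" for x s
  proof -
    have "set_integrable lebesgue (closure (cube x s)) \<mu>" by (rule ai) (simp add: compact_closure)
    then have "set_integrable lebesgue (cube x s) \<mu>"
      by (rule set_integrable_subset) (auto intro: closure_subset[THEN subsetD])
    then have i1: "integrable lebesgue (\<lambda>y. indicator (cube x s) y *\<^sub>R \<mu> y)" by (simp add: set_integrable_def)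
    have ae: "AE y in lebesgue. indicator (cube x s) y *\<^sub>R \<mu> y = indicator (cube x s) y *\<^sub>R w y"
      using eq by eventually_elim simp
    have "(\<lambda>y. indicator (cube x s) y *\<^sub>R w y) \<in> borel_measurable lebesgue"
      by (rule measurable_completion) (use w in measurable)
    then have "integrable lebesgue (\<lambda>y. indicator (cube x s) y *\<^sub>R w y)"
      by (rule integrable_cong_AE_imp[OF i1 _ ae])
    then show ?thesis using w unfolding set_integrable_def by (subst (asm) integrable_completion) auto
  qed
  with w posw eq show thesis by (intro that[of w]) (auto simp: w_def)
qed

text \<open>Translates the extended nonnegative supremum into real inequalities for the Borel
  version, including local integrability of the dual weight. The maximum with 1 supplies the
  normalisation \<open>1 \<le> A\<close> of the locale.\<close>

lemma Ap_weight_version: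
  fixes \<mu> :: "real^'n \<Rightarrow> real"
  assumes \<mu>: "\<mu> \<in> Ap_class p" and p: "1 < p"
  obtains w where "Ap_weight w p (max 1 (enn2real (Ap_const p \<mu>)))" "AE x in lebesgue. \<mu> x = w x"
proof -
  have fin: "Ap_const p \<mu> < \<infinity>" and wt: "weight \<mu>" using \<mu> by (auto simp: Ap_class_def)
  obtain w where w: "w \<in> borel_measurable borel" "\<And>x. 0 \<le> w x" "AE x in lebesgue. \<mu> x = w x"
    "AE x in lborel. 0 < w x" "\<And>x s. set_integrable lborel (cube x s) w"
    using weight_borel_version[OF wt] by blast
  note [measurable] = w(1)
  let ?d = "\<lambda>y. w y powr (- 1 / (p - 1))"
  define Ac where "Ac = enn2real (Ap_const p \<mu>)"
  have Ac: "Ap_const p \<mu> = ennreal Ac" "0 \<le> Ac" using fin by (auto simp: Ac_def)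
  have *: "set_integrable lborel (cube x s) ?d \<and> cube_avg lborel w x s * cube_avg lborel ?d x s powr (p - 1) \<le> Ac"
    if s: "0 < s" for x s
  proof -
    let ?Q = "cube x s"
    define V where "V = (2 * s) ^ CARD('n)"
    have V: "0 < V" using s by (simp add: V_def)
    have leb: "emeasure lebesgue ?Q = ennreal V" using s by (simp add: V_def emeasure_cube)
    have e1: "(\<integral>\<^sup>+y\<in>?Q. ennreal (\<mu> y) \<partial>lebesgue) = (\<integral>\<^sup>+y\<in>?Q. ennreal (w y) \<partial>lborel)"
    proof -
      have "(\<integral>\<^sup>+y\<in>?Q. ennreal (\<mu> y) \<partial>lebesgue) = (\<integral>\<^sup>+y\<in>?Q. ennreal (w y) \<partial>lebesgue)"
        using w(3) by (intro nn_integral_cong_AE) (auto elim: eventually_mono)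
      then show ?thesis by (simp add: nn_integral_completion)
    qed
    have e2: "(\<integral>\<^sup>+y\<in>?Q. ennreal (\<mu> y powr (- 1 / (p - 1))) \<partial>lebesgue) = (\<integral>\<^sup>+y\<in>?Q. ennreal (?d y) \<partial>lborel)"
    proof -
      have "(\<integral>\<^sup>+y\<in>?Q. ennreal (\<mu> y powr (- 1 / (p - 1))) \<partial>lebesgue) = (\<integral>\<^sup>+y\<in>?Q. ennreal (?d y) \<partial>lebesgue)"
        using w(3) by (intro nn_integral_cong_AE) (auto elim: eventually_mono)
      then show ?thesis by (simp add: nn_integral_completion)
    qed
    define m where "m = (LINT y:?Q|lborel. w y)"
    have m0: "(\<integral>\<^sup>+y\<in>?Q. ennreal (w y) \<partial>lborel) = ennreal m"
    proof -
      have "(\<integral>\<^sup>+y. ennreal (indicator ?Q y *\<^sub>R w y) \<partial>lborel) = ennreal m"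
        unfolding m_def set_lebesgue_integral_def using w(2) w(5)[of x s]
        by (intro nn_integral_eq_integral) (auto simp: set_integrable_def)
      moreover have "(\<integral>\<^sup>+y. ennreal (indicator ?Q y *\<^sub>R w y) \<partial>lborel) = (\<integral>\<^sup>+y\<in>?Q. ennreal (w y) \<partial>lborel)"
        by (intro nn_integral_cong) (simp add: indicator_def)
      ultimately show ?thesis by simp
    qed
    \<comment> \<open>In \<open>ennreal\<close> the product of 0 and \<infinity> is 0, so a finite
      \<open>A_p\<close> constant makes the dual integral finite only once the mass of the cube is
      known to be positive.\<close>
    have "m \<noteq> 0"
    proof
      assume "m = 0"
      then have "AE y in lborel. ennreal (w y) * indicator ?Q y = 0"
        using m0 nn_integral_0_iff_AE[of "\<lambda>y. ennreal (w y) * indicator ?Q y" lborel] by simp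
      with w(4) have "AE y in lborel. y \<notin> ?Q"
        by eventually_elim (auto simp: indicator_def split: if_splits)
      then have "emeasure lborel ?Q = 0" using AE_iff_null_sets[of ?Q lborel] by auto
      then show False using s by (simp add: emeasure_cube)
    qed
    moreover have "0 \<le> m" unfolding m_def set_lebesgue_integral_def using w(2) by (intro integral_nonneg_AE) auto
    ultimately have m: "0 < m" by simp
    let ?D = "\<integral>\<^sup>+y\<in>?Q. ennreal (?d y) \<partial>lborel"
    have "(ennreal m / ennreal V) * ennreal_rpow (?D / ennreal V) (p - 1) \<le> Ap_const p \<mu>"
    proof -
      have "(case (x, s) of (x0, s) \<Rightarrow> ((\<integral>\<^sup>+x\<in>cube x0 s. ennreal (\<mu> x) \<partial>lebesgue) / emeasure lebesgue (cube x0 s)) *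
        ennreal_rpow ((\<integral>\<^sup>+x\<in>cube x0 s. ennreal (\<mu> x powr (- 1 / (p - 1))) \<partial>lebesgue) / emeasure lebesgue (cube x0 s)) (p - 1))
        \<le> Ap_const p \<mu>"
        unfolding Ap_const_def using s by (intro SUP_upper) auto
      then show ?thesis by (simp only: case_prod_conv e1 e2 m0 leb)
    qed
    then have le: "ennreal (m / V) * ennreal_rpow (?D / ennreal V) (p - 1) \<le> ennreal Ac"
      using m V by (simp add: divide_ennreal Ac)
    have Dfin: "?D \<noteq> \<infinity>"
    proof
      assume "?D = \<infinity>"
      then have "ennreal_rpow (?D / ennreal V) (p - 1) = \<infinity>" using V by (simp add: ennreal_rpow_def ennreal_top_divide)
      then have "ennreal (m / V) * \<infinity> \<le> ennreal Ac" using le by simp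
      moreover have "ennreal (m / V) * \<infinity> = \<infinity>" using m V by (simp add: ennreal_mult_top)
      ultimately show False by (simp add: top_unique)
    qed
    have Dn: "(\<integral>\<^sup>+y. ennreal (indicator ?Q y *\<^sub>R ?d y) \<partial>lborel) = ?D"
      by (intro nn_integral_cong) (simp add: indicator_def)
    have di: "set_integrable lborel ?Q ?d"
      unfolding set_integrable_def
      by (rule integrableI_nonneg) (use Dfin Dn in \<open>auto simp: less_top[symmetric]\<close>)
    have D: "?D = ennreal (LINT y:?Q|lborel. ?d y)"
      unfolding Dn[symmetric] set_lebesgue_integral_def using di
      by (intro nn_integral_eq_integral) (auto simp: set_integrable_def)
    have D0: "0 \<le> (LINT y:?Q|lborel. ?d y)" unfolding set_lebesgue_integral_def by (intro integral_nonneg_AE) auto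
    have "ennreal (m / V * ((LINT y:?Q|lborel. ?d y) / V) powr (p - 1)) \<le> ennreal Ac"
      using le D D0 V m
      by (simp add: divide_ennreal ennreal_rpow_ennreal ennreal_mult del: times_divide_eq_left)
    then have "m / V * ((LINT y:?Q|lborel. ?d y) / V) powr (p - 1) \<le> Ac" using Ac by (simp add: ennreal_le_iff)
    then show ?thesis using di by (simp add: cube_avg_def m_def V_def)
  qed
  have "Ap_weight w p (max 1 Ac)"
  proof
    show "set_integrable lborel (cube x s) ?d" for x s
    proof (cases "0 < s")
      case False
      \<comment> \<open>The locale asks for all radii; cubes of nonpositive radius are
        empty.\<close>
      then have "cube x s = {}" using infnorm_pos_le by (auto simp: mem_cube not_less) (smt (verit) infnorm_pos_le)
      then show ?thesis by (simp add: set_integrable_def)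
    qed (use * in blast)
    show "cube_avg lborel w x s * cube_avg lborel ?d x s powr (p - 1) \<le> max 1 Ac" if "0 < s" for x s
      using *[OF that, of x] by (meson max.coboundedI2)
  qed (use p w in auto)
  then show thesis using w(3) by (intro that) (auto simp: Ac_def)
qed

section \<open>Transfer to the original weight and choice of constants\<close>

lemma wintegral_cong_weight:
  "AE x in lebesgue. \<mu> x = w x \<Longrightarrow> wintegral \<mu> = wintegral w"
  unfolding wintegral_def fun_eq_iff
  by (intro allI nn_integral_cong_AE) (auto elim: eventually_mono)

lemma wmeasure_cong_weight:
  "AE x in lebesgue. \<mu> x = w x \<Longrightarrow> wmeasure \<mu> = wmeasure w"
  unfolding wmeasure_def fun_eq_iff
  by (intro allI nn_integral_cong_AE) (auto elim: eventually_mono)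

theorem proposition3p2:
  fixes p :: real and A :: ennreal
  assumes "CARD('n::finite) \<ge> 2" and "1 < p"
  shows "\<exists>p0 \<in> {1<..<p}. \<exists>c2 > 0. \<exists>\<gamma> \<in> {0<..<1/2}. \<exists>c3 > 0.
    \<forall>(\<mu> :: real ^ 'n \<Rightarrow> real) x0 (r :: real) K.
      \<mu> \<in> Ap_class p \<and> Ap_const p \<mu> = A \<and> 0 < r \<and> closed K \<and> K \<subseteq> closure (cube x0 r) \<longrightarrow>
      (\<forall>q \<in> {p0..p}.
        (\<exists>C :: ennreal.
           C \<le> ennreal (c2 / r) * cap_quotient q \<mu> K x0 r \<and>
           (\<forall>u \<in> smooth_vanishing_near (closure (cube x0 r)) K.
              poincare_ineq p q \<mu> x0 r r C u)) \<and>
        (\<forall>C :: ennreal.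
           (\<forall>u \<in> smooth_vanishing_near (closure (cube x0 r)) K.
              poincare_ineq p q \<mu> x0 (r / 2) r C u) \<longrightarrow>
           K \<in> negligible_sets \<mu> \<gamma> q x0 r \<longrightarrow>
           ennreal (c3 / r) * cap_quotient q \<mu> K x0 r \<le> C))"
proof -
  define A' where "A' = max 1 (enn2real A)"
  have A': "1 \<le> A'" by (simp add: A'_def)
  obtain p0 B where p0: "1 < p0" "p0 < p" and B: "1 \<le> B"
    and gap: "\<And>q. p0 \<le> q \<Longrightarrow> q \<le> p \<Longrightarrow> real CARD('n) * p * (p / q - 1) \<le> 1 / 2"
    and Aq: "\<And>(w :: real^'n \<Rightarrow> real) q f x s. Ap_weight w p A' \<Longrightarrow> p0 \<le> q \<Longrightarrow> q \<le> p \<Longrightarrow>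
      continuous_on UNIV f \<Longrightarrow> (\<And>y. 0 \<le> f y) \<Longrightarrow> 0 < s \<Longrightarrow>
      cube_avg lborel f x s powr q * cube_avg lborel w x s \<le>
        B * cube_avg (Ap_weight.M w) (\<lambda>y. f y powr q) x s"
  proof (rule Ap_open_ended[OF assms(2) A', where 'n='n], goal_cases)
    case 1
    from 1(2-) show ?case by (rule 1(1))
  qed
  have main: "Aq_weight w p A' q B" if "Ap_weight w p A'" "p0 \<le> q" "q \<le> p" for w :: "real^'n \<Rightarrow> real" and q
    using that p0 B gap Aq by (intro Aq_weight.intro Aq_weight_axioms.intro) auto
  show ?thesis
  \<comment> \<open>The constants are named through an interpretation of the locale, which needs a
    witness weight. If there is none, no weight has the constant \<open>A\<close> and arbitrary
    values will do.\<close>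
  proof (cases "\<exists>w :: real^'n \<Rightarrow> real. Ap_weight w p A'")
    case False
    have "\<not> (\<mu> \<in> Ap_class p \<and> Ap_const p \<mu> = A)" for \<mu> :: "real^'n \<Rightarrow> real"
      using False Ap_weight_version[of \<mu> p] assms(2) by (auto simp: A'_def)
    then show ?thesis
      using assms(2)
      by (rule_tac bexI[of _ "(1 + p) / 2"], rule_tac exI[of _ 1], rule_tac conjI, simp,
          rule_tac bexI[of _ "1 / 4"], rule_tac exI[of _ 1]) auto
  next
    case True
    then obtain w0 :: "real^'n \<Rightarrow> real" where w0: "Ap_weight w0 p A'" by blast
    \<comment> \<open>The definitions involve only the dimension, \<open>p\<close>,
      \<open>A'\<close> and \<open>B\<close>. Hence the constants named at \<open>w0\<close> with
      exponent \<open>p\<close> are the same terms as for any other weight and any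
      \<open>q\<close>.\<close>
    interpret W0: Aq_weight w0 p A' p B using main[OF w0] p0 by simp
    show ?thesis
    proof (rule bexI[of _ p0], rule exI[of _ W0.upper_const], rule conjI[OF W0.upper_const_pos], rule bexI[of _ W0.small_const],
        rule exI[of _ W0.lower_const], rule conjI[OF W0.lower_const_pos], intro allI impI ballI conjI)
      fix \<mu> :: "real^'n \<Rightarrow> real" and x0 and r :: real and K :: "(real^'n) set" and q
      assume h: "\<mu> \<in> Ap_class p \<and> Ap_const p \<mu> = A \<and> 0 < r \<and> closed K \<and> K \<subseteq> closure (cube x0 r)"
        and q: "q \<in> {p0..p}"
      obtain w where w: "Ap_weight w p A'" "AE x in lebesgue. \<mu> x = w x"
        using Ap_weight_version[of \<mu> p] h assms(2) by (auto simp: A'_def)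
      interpret Aq_weight w p A' q B using main[OF w(1)] q by simp
      note e = wintegral_cong_weight[OF w(2)] wmeasure_cong_weight[OF w(2)]
      have Ceq: "Cap q' \<mu> = Cap q' w" for q' by (simp add: Cap_def[abs_def] e)
      have qeq: "cap_quotient q \<mu> = cap_quotient q w" by (simp add: cap_quotient_def[abs_def] e Ceq)
      have peq: "poincare_ineq p q \<mu> = poincare_ineq p q w" by (simp add: poincare_ineq_def[abs_def] e)
      have neq: "negligible_sets \<mu> = negligible_sets w" by (simp add: negligible_sets_def[abs_def] e Ceq)
      show "\<exists>C :: ennreal. C \<le> ennreal (W0.upper_const / r) * cap_quotient q \<mu> K x0 r \<and>
           (\<forall>u \<in> smooth_vanishing_near (closure (cube x0 r)) K. poincare_ineq p q \<mu> x0 r r C u)"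
        unfolding qeq peq using h capacity_poincare by (intro exI[of _ "ennreal (W0.upper_const / r) * cap_quotient q w K x0 r"]) auto
      fix C :: ennreal
      assume "\<forall>u \<in> smooth_vanishing_near (closure (cube x0 r)) K. poincare_ineq p q \<mu> x0 (r / 2) r C u"
        and "K \<in> negligible_sets \<mu> W0.small_const q x0 r"
      then show "ennreal (W0.lower_const / r) * cap_quotient q \<mu> K x0 r \<le> C"
        unfolding qeq peq neq using h by (intro capacity_necessary) auto
    qed (use p0 W0.small_const_bounds in auto)
  qed
qed

end
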